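(* Let $B$ be a graphic matroid. Then $B \in \mathcal{GG}_3$ if and only if $B$ has a minor isomorphic to $M(G_i)$ for some $i \in \{3,4,5,6\}$, where $G_3,\dots,G_6$ are the graphs described below.
   Context: Splitting: let $B$ be a binary matroid represented over $GF(2)$ by a matrix $A$, and let $X \subseteq E(B)$. Let $A_X$ be the matrix obtained from $A$ by appending a new last row with entry $1$ in the columns of the elements of $X$ and $0$ elsewhere; the splitting matroid is $B_X = M(A_X)$. A binary gammoid is a matroid that is both binary and a gammoid (equivalently, one with no minor isomorphic to $U_{2,4}$ or $M(K_4)$). $\mathcal{GG}_k$ denotes the class of graphic matroids $B$ for which there exists $X \subseteq E(B)$ with $|X| = k$ such that $B_X$ is not a binary gammoid. $M(G)$ is the cycle matroid of $G$. $G_3 = K_4$ (with distinguished edges $x,y,z$ being the three edges incident with one vertex). $G_4$: vertices $t,a,b$; two parallel edges between $t$ and $a$, two parallel edges between $t$ and $b$, one edge between $a$ and $b$, and a loop at $t$. $G_5$: vertices $t,a,b$; two parallel edges between $t$ and $a$, two parallel edges between $t$ and $b$, one edge between $a$ and $b$, and a loop at $b$. $G_6$: vertices $t,a,b$; two parallel edges between each of the pairs $\{t,a\}$, $\{t,b\}$, $\{a,b\}$. *)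

theory Defs
  imports "Graph_Theory.Arc_Walk" "HOL-Library.Z2"
begin

section \<open>Matroids, isomorphism and minors\<close>

record 'a matroid =
  ground :: "'a set"
  indeps :: "'a set set"

definition matroid :: "'a matroid \<Rightarrow> bool" where
  "matroid M \<longleftrightarrow>
     finite (ground M) \<and> indeps M \<subseteq> Pow (ground M) \<and> {} \<in> indeps M \<and>
     (\<forall>I\<in>indeps M. \<forall>J\<subseteq>I. J \<in> indeps M) \<and>
     (\<forall>I\<in>indeps M. \<forall>J\<in>indeps M. card I < card J \<longrightarrow>
        (\<exists>x\<in>J - I. insert x I \<in> indeps M))"

definition isomorphic :: "'a matroid \<Rightarrow> 'b matroid \<Rightarrow> bool" where
  "isomorphic M N \<longleftrightarrow>
     (\<exists>f. bij_betw f (ground M) (ground N) \<and>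
          (\<forall>I\<subseteq>ground M. I \<in> indeps M \<longleftrightarrow> f ` I \<in> indeps N))"

definition delete :: "'a matroid \<Rightarrow> 'a set \<Rightarrow> 'a matroid" where
  "delete M D = \<lparr>ground = ground M - D, indeps = {I \<in> indeps M. I \<subseteq> ground M - D}\<rparr>"

definition basis_of :: "'a matroid \<Rightarrow> 'a set \<Rightarrow> 'a set \<Rightarrow> bool" where
  "basis_of M C J \<longleftrightarrow>
     J \<in> indeps M \<and> J \<subseteq> C \<and> (\<forall>x\<in>C - J. insert x J \<notin> indeps M)"

definition contract :: "'a matroid \<Rightarrow> 'a set \<Rightarrow> 'a matroid" where
  "contract M C =
     \<lparr>ground = ground M - C,
      indeps = {I. I \<subseteq> ground M - C \<and> (\<exists>J. basis_of M C J \<and> I \<union> J \<in> indeps M)}\<rparr>"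

definition minor :: "'a matroid \<Rightarrow> 'a matroid \<Rightarrow> bool" where
  "minor N M \<longleftrightarrow>
     (\<exists>C D. C \<subseteq> ground M \<and> D \<subseteq> ground M \<and> C \<inter> D = {} \<and> N = delete (contract M C) D)"

section \<open>Graphic matroids\<close>

text \<open>Undirected multigraphs, loops allowed: a loop is an edge with a single end.\<close>

record ('v, 'e) mgraph =
  mverts :: "'v set"
  medges :: "'e set"
  mends :: "'e \<Rightarrow> 'v set"

definition finite_mgraph :: "('v, 'e) mgraph \<Rightarrow> bool" where
  "finite_mgraph G \<longleftrightarrow>
     finite (mverts G) \<and> finite (medges G) \<and>
     (\<forall>e\<in>medges G. mends G e \<subseteq> mverts G \<and> card (mends G e) \<in> {1, 2})"

text \<open>The edge set of a closed walk with distinct edges and distinct vertices. Length one is a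
  loop, length two a pair of parallel edges.\<close>

definition cycle_edges :: "('v, 'e) mgraph \<Rightarrow> 'e set \<Rightarrow> bool" where
  "cycle_edges G C \<longleftrightarrow>
     (\<exists>vs es. es \<noteq> [] \<and> length vs = length es \<and> distinct vs \<and> distinct es \<and>
        set vs \<subseteq> mverts G \<and> set es \<subseteq> medges G \<and> C = set es \<and>
        (\<forall>i<length es. mends G (es ! i) = {vs ! i, vs ! (Suc i mod length vs)}))"

definition cycle_matroid :: "('v, 'e) mgraph \<Rightarrow> 'e matroid" where
  "cycle_matroid G =
     \<lparr>ground = medges G,
      indeps = {I. I \<subseteq> medges G \<and> (\<forall>C. cycle_edges G C \<longrightarrow> \<not> C \<subseteq> I)}\<rparr>"

text \<open>Every finite multigraph is isomorphic to one with vertices and edges in \<^typ>\<open>nat\<close>.\<close>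

definition graphic :: "'a matroid \<Rightarrow> bool" where
  "graphic M \<longleftrightarrow>
     matroid M \<and> (\<exists>G :: (nat, nat) mgraph. finite_mgraph G \<and> isomorphic M (cycle_matroid G))"

section \<open>Gammoids\<close>

definition linked_into :: "('v, 'b) pre_digraph \<Rightarrow> 'v set \<Rightarrow> 'v set \<Rightarrow> bool" where
  "linked_into G I T \<longleftrightarrow>
     (\<exists>p t. (\<forall>x\<in>I. t x \<in> T \<and> pre_digraph.apath G x (p x) (t x)) \<and>
        (\<forall>x\<in>I. \<forall>y\<in>I. x \<noteq> y \<longrightarrow>
           set (pre_digraph.awalk_verts G x (p x)) \<inter>
           set (pre_digraph.awalk_verts G y (p y)) = {}))"

definition linkage_matroid :: "('v, 'b) pre_digraph \<Rightarrow> 'v set \<Rightarrow> 'v set \<Rightarrow> 'v matroid" where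
  "linkage_matroid G S T = \<lparr>ground = S, indeps = {I. I \<subseteq> S \<and> linked_into G I T}\<rparr>"

definition gammoid :: "'a matroid \<Rightarrow> bool" where
  "gammoid M \<longleftrightarrow>
     matroid M \<and>
     (\<exists>(G :: (nat, nat) pre_digraph) S T. fin_digraph G \<and> S \<subseteq> verts G \<and> T \<subseteq> verts G \<and>
        isomorphic M (linkage_matroid G S T))"

section \<open>Binary matroids and splitting\<close>

text \<open>A matrix with \<open>m\<close> rows and columns labelled by \<open>E\<close> is a function
  \<open>A :: nat \<Rightarrow> 'a \<Rightarrow> 'f\<close>, of which only the entries \<open>A i e\<close> with \<open>i < m\<close>
  and \<open>e \<in> E\<close> matter. Linear independence is that of the family of columns, so equal columns
  with different labels are dependent.\<close>

definition vector_matroid :: "'a set \<Rightarrow> nat \<Rightarrow> (nat \<Rightarrow> 'a \<Rightarrow> 'f::field) \<Rightarrow> 'a matroid" where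
  "vector_matroid E m A =
     \<lparr>ground = E,
      indeps = {I. I \<subseteq> E \<and>
        (\<forall>c. (\<forall>i<m. (\<Sum>e\<in>I. c e * A i e) = 0) \<longrightarrow> (\<forall>e\<in>I. c e = 0))}\<rparr>"

definition represented_by :: "'a matroid \<Rightarrow> nat \<Rightarrow> (nat \<Rightarrow> 'a \<Rightarrow> bit) \<Rightarrow> bool" where
  "represented_by M m A \<longleftrightarrow> M = vector_matroid (ground M) m A"

definition binary :: "'a matroid \<Rightarrow> bool" where
  "binary M \<longleftrightarrow> matroid M \<and> (\<exists>m A. represented_by M m A)"

definition binary_gammoid :: "'a matroid \<Rightarrow> bool" where
  "binary_gammoid M \<longleftrightarrow> binary M \<and> gammoid M"

definition append_row :: "nat \<Rightarrow> (nat \<Rightarrow> 'a \<Rightarrow> bit) \<Rightarrow> 'a set \<Rightarrow> nat \<Rightarrow> 'a \<Rightarrow> bit" where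
  "append_row m A X = A(m := (\<lambda>e. if e \<in> X then 1 else 0))"

text \<open>The choice of the representing matrix is immaterial, see \<open>splitting_eq\<close> below.\<close>

definition splitting :: "'a matroid \<Rightarrow> 'a set \<Rightarrow> 'a matroid" where
  "splitting B X =
     (let (m, A) = (SOME (m, A). represented_by B m A)
      in vector_matroid (ground B) (Suc m) (append_row m A X))"

lemma vector_matroid_bit_indep_iff:
  fixes A :: "nat \<Rightarrow> 'a \<Rightarrow> bit"
  assumes "finite E"
  shows "I \<in> indeps (vector_matroid E m A) \<longleftrightarrow>
    I \<subseteq> E \<and> (\<forall>Z\<subseteq>I. (\<forall>i<m. (\<Sum>e\<in>Z. A i e) = 0) \<longrightarrow> Z = {})"
proof (cases "I \<subseteq> E")
  case True
  then have fin: "finite I" using assms finite_subset by blast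
  have s: "(\<Sum>e\<in>I. c e * A i e) = (\<Sum>e\<in>{e\<in>I. c e = 1}. A i e)" for c i
  proof -
    have "(\<Sum>e\<in>I. c e * A i e) = (\<Sum>e\<in>I. if c e = 1 then A i e else 0)"
      by (rule sum.cong) auto
    also have "\<dots> = (\<Sum>e\<in>{e\<in>I. c e = 1}. A i e)"
      using fin by (simp add: sum.inter_filter)
    finally show ?thesis .
  qed
  have "(\<forall>c. (\<forall>i<m. (\<Sum>e\<in>I. c e * A i e) = 0) \<longrightarrow> (\<forall>e\<in>I. c e = 0)) \<longleftrightarrow>
        (\<forall>Z\<subseteq>I. (\<forall>i<m. (\<Sum>e\<in>Z. A i e) = 0) \<longrightarrow> Z = {})" (is "?L \<longleftrightarrow> ?R")
  proof
    assume L: ?L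
    show ?R
    proof (intro allI impI)
      fix Z assume Z: "Z \<subseteq> I" "\<forall>i<m. (\<Sum>e\<in>Z. A i e) = 0"
      define c :: "'a \<Rightarrow> bit" where "c = (\<lambda>e. if e \<in> Z then 1 else 0)"
      have "{e\<in>I. c e = 1} = Z" using Z(1) by (auto simp: c_def)
      then have "\<forall>e\<in>I. c e = 0" using L s[of c] Z(2) by simp
      then show "Z = {}" using Z(1) by (auto simp: c_def split: if_splits)
    qed
  next
    assume R: ?R
    show ?L
    proof (intro allI impI)
      fix c assume "\<forall>i<m. (\<Sum>e\<in>I. c e * A i e) = 0"
      then have "\<forall>i<m. (\<Sum>e\<in>{e\<in>I. c e = 1}. A i e) = 0" unfolding s .
      then have "{e\<in>I. c e = 1} = {}"
        by (rule R[THEN spec, THEN mp, THEN mp, rotated]) (rule Collect_restrict)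
      then show "\<forall>e\<in>I. c e = 0" by auto
    qed
  qed
  then show ?thesis using True by (simp add: vector_matroid_def)
qed (auto simp: vector_matroid_def)

lemma vector_matroid_bit_kernel:
  fixes A A' :: "nat \<Rightarrow> 'a \<Rightarrow> bit"
  assumes fin: "finite E" and eq: "vector_matroid E m A = vector_matroid E m' A'"
    and "Z \<subseteq> E" and "\<forall>i<m. (\<Sum>e\<in>Z. A i e) = 0"
  shows "\<forall>i<m'. (\<Sum>e\<in>Z. A' i e) = 0"
  using assms(3,4)
proof (induction "card Z" arbitrary: Z rule: less_induct)
  case less
  have finZ: "finite Z" using less.prems(1) fin finite_subset by blast
  show ?case
  proof (cases "Z = {}")
    case False
    define dep where "dep = (\<lambda>C. C \<subseteq> Z \<and> C \<notin> indeps (vector_matroid E m A))"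
    have "dep Z"
      using False less.prems unfolding dep_def
      by (auto simp: vector_matroid_bit_indep_iff[OF fin])
    then obtain C where C: "dep C" and min: "\<And>D. dep D \<Longrightarrow> card C \<le> card D"
      using ex_has_least_nat[of dep Z card] by blast
    have CE: "C \<subseteq> E" "C \<subseteq> Z" "finite C"
      using C less.prems(1) finZ finite_subset unfolding dep_def by blast+
    have circuit: "(\<forall>i<n. (\<Sum>e\<in>C. F i e) = 0) \<and> C \<noteq> {}"
      if F: "vector_matroid E m A = vector_matroid E n F" for n and F :: "nat \<Rightarrow> 'a \<Rightarrow> bit"
    proof -
      have "C \<notin> indeps (vector_matroid E n F)"
        using C unfolding dep_def F by (rule conjunct2)
      then obtain Y where Y: "Y \<subseteq> C" "\<forall>i<n. (\<Sum>e\<in>Y. F i e) = 0" "Y \<noteq> {}"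
        using CE(1) by (simp add: vector_matroid_bit_indep_iff[OF fin]) metis
      have "Y \<notin> indeps (vector_matroid E n F)"
        using Y(2,3) unfolding vector_matroid_bit_indep_iff[OF fin] by blast
      then have "dep Y" using Y(1) CE(2) unfolding dep_def F by simp
      then have "Y = C" using min Y(1) CE(3) by (meson card_seteq)
      then show ?thesis using Y by blast
    qed
    have c: "\<forall>i<m. (\<Sum>e\<in>C. A i e) = 0" "\<forall>i<m'. (\<Sum>e\<in>C. A' i e) = 0" "C \<noteq> {}"
      using circuit[OF refl] circuit[OF eq] by auto
    have split: "(\<Sum>e\<in>Z. f e) = (\<Sum>e\<in>Z - C. f e) + (\<Sum>e\<in>C. f e)" for f :: "'a \<Rightarrow> bit"
      using sum.subset_diff[OF CE(2) finZ] .
    have "card (Z - C) < card Z"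
      using c(3) CE(2) finZ by (intro psubset_card_mono) auto
    moreover have "\<forall>i<m. (\<Sum>e\<in>Z - C. A i e) = 0"
      using less.prems(2) c(1) by (simp only: split add_0_right) simp
    ultimately have "\<forall>i<m'. (\<Sum>e\<in>Z - C. A' i e) = 0"
      using less.hyps[of "Z - C"] less.prems(1) by blast
    then show ?thesis using c(2) by (simp only: split add_0_right) simp
  qed simp
qed

lemma splitting_eq:
  assumes "finite (ground B)" and "represented_by B m A"
  shows "splitting B X = vector_matroid (ground B) (Suc m) (append_row m A X)"
proof -
  let ?E = "ground B"
  obtain m' A' where c: "(SOME (m, A). represented_by B m A) = (m', A')" by fastforce
  have rep': "represented_by B m' A'"
    using someI[of "\<lambda>(m, A). represented_by B m A" "(m, A)"] assms(2) c by simp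
  have eq: "vector_matroid ?E m A = vector_matroid ?E m' A'"
    using assms(2) rep' unfolding represented_by_def by metis
  have ker: "(\<forall>i<m. (\<Sum>e\<in>Z. A i e) = 0) \<longleftrightarrow> (\<forall>i<m'. (\<Sum>e\<in>Z. A' i e) = 0)"
    if "Z \<subseteq> ?E" for Z
    using vector_matroid_bit_kernel[OF assms(1) eq that]
      vector_matroid_bit_kernel[OF assms(1) eq[symmetric] that] by blast
  have row: "(\<forall>i<Suc n. (\<Sum>e\<in>Z. append_row n F X i e) = 0) \<longleftrightarrow>
      (\<forall>i<n. (\<Sum>e\<in>Z. F i e) = 0) \<and> (\<Sum>e\<in>Z. if e \<in> X then 1 else (0::bit)) = 0" for n F Z
    by (auto simp: append_row_def less_Suc_eq)
  have "indeps (vector_matroid ?E (Suc m') (append_row m' A' X)) =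
        indeps (vector_matroid ?E (Suc m) (append_row m A X))"
  proof (rule set_eqI)
    fix I
    have "(\<forall>Z\<subseteq>I. (\<forall>i<Suc m'. (\<Sum>e\<in>Z. append_row m' A' X i e) = 0) \<longrightarrow> Z = {}) \<longleftrightarrow>
      (\<forall>Z\<subseteq>I. (\<forall>i<Suc m. (\<Sum>e\<in>Z. append_row m A X i e) = 0) \<longrightarrow> Z = {})"
      if "I \<subseteq> ?E"
      unfolding row using ker subset_trans[OF _ that] by blast
    then show "I \<in> indeps (vector_matroid ?E (Suc m') (append_row m' A' X)) \<longleftrightarrow>
      I \<in> indeps (vector_matroid ?E (Suc m) (append_row m A X))"
      unfolding vector_matroid_bit_indep_iff[OF assms(1)] by blast
  qed
  then show ?thesis
    unfolding splitting_def c by (simp add: vector_matroid_def)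
qed

definition GG :: "nat \<Rightarrow> 'a matroid set" where
  "GG k = {B. graphic B \<and>
     (\<exists>X\<subseteq>ground B. card X = k \<and> \<not> binary_gammoid (splitting B X))}"

section \<open>The graphs \<open>G\<^sub>3, \<dots>, G\<^sub>6\<close>\<close>

text \<open>In \<open>G4\<close>, \<open>G5\<close> and \<open>G6\<close> the vertices \<open>t, a, b\<close> are \<open>0, 1, 2\<close>.\<close>

definition mgraph_of :: "nat \<Rightarrow> nat set list \<Rightarrow> (nat, nat) mgraph" where
  "mgraph_of n es = \<lparr>mverts = {..<n}, medges = {..<length es}, mends = (\<lambda>i. es ! i)\<rparr>"

definition G3 :: "(nat, nat) mgraph" where
  "G3 = mgraph_of 4 [{0, 1}, {0, 2}, {0, 3}, {1, 2}, {1, 3}, {2, 3}]"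

definition G4 :: "(nat, nat) mgraph" where
  "G4 = mgraph_of 3 [{0, 1}, {0, 1}, {0, 2}, {0, 2}, {1, 2}, {0}]"

definition G5 :: "(nat, nat) mgraph" where
  "G5 = mgraph_of 3 [{0, 1}, {0, 1}, {0, 2}, {0, 2}, {1, 2}, {2}]"

definition G6 :: "(nat, nat) mgraph" where
  "G6 = mgraph_of 3 [{0, 1}, {0, 1}, {0, 2}, {0, 2}, {1, 2}, {1, 2}]"

end

theory Submission
  imports Defs
begin

text \<open>
  A binary matroid is handled through its cycle space, a family of subsets of the ground set closed
  under symmetric difference. Minors of the matroid are projections of subspaces, and splitting by \<open>X\<close>
  passes to the subspace of the sets that meet \<open>X\<close> evenly, which has index at most two. A minor
  \<open>M(K\<^sub>4)\<close> of \<open>B\<^sub>X\<close> therefore comes from a minor of \<open>B\<close> whose cycle space is that of \<open>K\<^sub>4\<close> or is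
  generated by it and one further coset; this gives \<open>M(G\<^sub>3)\<close>, \<open>M(G\<^sub>4) = M(G\<^sub>5)\<close> and \<open>M(G\<^sub>6)\<close>.
  Conversely, for these minors a triad of \<open>K\<^sub>4\<close> meets the further coset oddly and serves as \<open>X\<close>.

  It remains that a binary matroid is a gammoid iff it has no \<open>M(K\<^sub>4)\<close> minor. Without such a minor
  there is a loop, a coloop, a parallel pair or a series pair, and each of these extensions can be
  carried out in the digraph. In a gammoid, by Hall's theorem, independence is governed by a function
  that satisfies inclusion-exclusion inequalities, which the four triangles of \<open>K\<^sub>4\<close> violate.
\<close>

section \<open>Binary spaces and their matroids\<close>

text \<open>\<open>splitting\<close> yields a matrix matroid over the two-element field, so only the
  gammoid property of it is ever at stake. The size three of \<open>X\<close> is the size of a triad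
  of K4.

  Contraction is the obstacle in excluding M(K4), as it has no direct counterpart in the digraph.
  The contracted set is therefore kept through a basis \<open>J\<close>, whose share is subtracted
  from the function that governs independence. Submodularity of that function would not suffice,
  because every matroid rank function is submodular. What separates gammoids is the inequality of
  order four. It comes from counting the vertices whose out-neighbours are trapped in a set: the
  counted sets intersect exactly and can only gain on unions. Hall's theorem applies because linking
  \<open>I\<close> into \<open>T\<close> amounts to matching the vertices outside \<open>T\<close>
  into those outside \<open>I\<close>.

  In the search for a series-parallel reduction mere existence is not inductive: a pair found after
  deleting \<open>f\<close> may grow by \<open>f\<close> when \<open>f\<close> returns. The
  induction therefore prescribes an element that the reduction has to avoid.\<close>

definition bspace :: "'a set \<Rightarrow> 'a set set \<Rightarrow> bool" where
  "bspace E K \<longleftrightarrow> finite E \<and> K \<subseteq> Pow E \<and> {} \<in> K \<and> (\<forall>Y\<in>K. \<forall>Z\<in>K. sym_diff Y Z \<in> K)"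

definition indep_in :: "'a set set \<Rightarrow> 'a set \<Rightarrow> bool" where
  "indep_in K I \<longleftrightarrow> (\<forall>Z\<in>K. Z \<subseteq> I \<longrightarrow> Z = {})"

definition space_matroid :: "'a set \<Rightarrow> 'a set set \<Rightarrow> 'a matroid" where
  "space_matroid E K = \<lparr>ground = E, indeps = {I. I \<subseteq> E \<and> indep_in K I}\<rparr>"

text \<open>\<open>C\<close> is the contracted set and \<open>S\<close> the ground set of the minor;
  all other elements are deleted, which restricts the members to
  \<open>C \<union> S\<close>.\<close>

definition minor_space :: "'a set set \<Rightarrow> 'a set \<Rightarrow> 'a set \<Rightarrow> 'a set set" where
  "minor_space K C S = {Z - C |Z. Z \<in> K \<and> Z \<subseteq> C \<union> S}"

lemma ground_space_matroid [simp]: "ground (space_matroid E K) = E"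
  and indeps_space_matroid: "I \<in> indeps (space_matroid E K) \<longleftrightarrow> I \<subseteq> E \<and> indep_in K I"
  by (auto simp: space_matroid_def)

lemma bspaceD:
  assumes "bspace E K"
  shows "finite E" "{} \<in> K" "Z \<in> K \<Longrightarrow> Z \<subseteq> E" "Y \<in> K \<Longrightarrow> Z \<in> K \<Longrightarrow> sym_diff Y Z \<in> K"
  using assms by (auto simp: bspace_def)

lemma indep_in_insert_circuit:
  assumes "indep_in K I" "\<not> indep_in K (insert x I)"
  obtains Z where "Z \<in> K" "x \<in> Z" "Z \<subseteq> insert x I"
  using assms by (auto simp: indep_in_def)

text \<open>A maximal independent set spans: each \<open>x\<close> outside \<open>J\<close> lies in
  a member of \<open>K\<close> contained in \<open>insert x J\<close>, and adding that member trades
  \<open>x\<close> for elements of \<open>J\<close>.\<close>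

lemma reduce_into_basis:
  assumes K: "bspace E K" and J: "indep_in K J"
    and max: "\<And>x. x \<in> P - J \<Longrightarrow> \<not> indep_in K (insert x J)"
    and "finite Y" and "Y \<subseteq> P"
  shows "\<exists>W\<subseteq>J. sym_diff Y W \<in> K"
proof -
  \<comment> \<open>The bound is widened to \<open>P \<union> J\<close> because an exchange brings
    in elements of \<open>J\<close>, which need not lie in \<open>P\<close>.\<close>
  have "\<exists>W\<subseteq>J. sym_diff Y W \<in> K" if "finite Y" "Y \<subseteq> P \<union> J" for Y
    using that
  proof (induction "card (Y - J)" arbitrary: Y rule: less_induct)
    case less
    show ?case
    proof (cases "Y \<subseteq> J")
      case True
      then show ?thesis using bspaceD(2)[OF K] by (intro exI[of _ Y]) auto
    next
      case False
      then obtain x where x: "x \<in> Y" "x \<notin> J" by blast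
      then have xP: "x \<in> P - J" using less.prems(2) by auto
      obtain Z where Z: "Z \<in> K" "x \<in> Z" "Z \<subseteq> insert x J"
        using indep_in_insert_circuit[OF J max[OF xP]] .
      have finZ: "finite Z" using K Z(1) by (meson bspaceD(1,3) finite_subset)
      have "sym_diff Y Z - J \<subset> Y - J" using x Z by auto
      then have "card (sym_diff Y Z - J) < card (Y - J)"
        using less.prems(1) by (intro psubset_card_mono) auto
      moreover have "finite (sym_diff Y Z)" using less.prems(1) finZ by auto
      moreover have "sym_diff Y Z \<subseteq> P \<union> J" using less.prems(2) Z(3) xP by auto
      ultimately obtain W where W: "W \<subseteq> J" "sym_diff (sym_diff Y Z) W \<in> K"
        using less.hyps by blast
      have "sym_diff (sym_diff (sym_diff Y Z) W) Z \<in> K" by (rule bspaceD(4)[OF K W(2) Z(1)])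
      moreover have "sym_diff (sym_diff (sym_diff Y Z) W) Z = sym_diff Y W" by auto
      ultimately have "sym_diff Y W \<in> K" by simp
      then show ?thesis using W(1) by blast
    qed
  qed
  then show ?thesis using assms(4,5) by blast
qed

text \<open>Augmentation by counting: if no element of \<open>J\<close> extends \<open>I\<close>,
  every subset of \<open>J\<close> is congruent modulo \<open>K\<close> to a subset of
  \<open>I\<close>. Independence of \<open>J\<close> makes this assignment injective, so
  \<open>2 ^ card J \<le> 2 ^ card I\<close>.\<close>

lemma matroid_space_matroid:
  assumes K: "bspace E K"
  shows "matroid (space_matroid E K)"
proof -
  have "\<exists>x\<in>J - I. insert x I \<subseteq> E \<and> indep_in K (insert x I)"
    if I: "I \<subseteq> E" "indep_in K I" and J: "J \<subseteq> E" "indep_in K J" and lt: "card I < card J" for I J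
  proof (rule ccontr)
    assume "\<not> ?thesis"
    then have max: "\<not> indep_in K (insert x I)" if "x \<in> J - I" for x using I J that by auto
    have finE: "finite E" by (rule bspaceD(1)[OF K])
    then have fin: "finite I" "finite J" using I J finite_subset by blast+
    have "\<forall>Y\<in>Pow J. \<exists>W. W \<subseteq> I \<and> sym_diff Y W \<in> K"
      using reduce_into_basis[OF K I(2) max] fin(2) finite_subset by (metis PowD)
    then obtain w where w: "\<And>Y. Y \<subseteq> J \<Longrightarrow> w Y \<subseteq> I \<and> sym_diff Y (w Y) \<in> K"
      by (metis PowI)
    have "inj_on w (Pow J)"
    proof (rule inj_onI)
      fix Y Y' assume Y: "Y \<in> Pow J" "Y' \<in> Pow J" "w Y = w Y'"
      have "sym_diff (sym_diff Y (w Y)) (sym_diff Y' (w Y')) \<in> K"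
        using w[of Y] w[of Y'] Y(1,2) by (intro bspaceD(4)[OF K, of "sym_diff Y (w Y)"]) auto
      moreover have "sym_diff (sym_diff Y (w Y)) (sym_diff Y' (w Y')) = sym_diff Y Y'"
        unfolding Y(3) by auto
      ultimately have "sym_diff Y Y' \<in> K" by simp
      moreover have "sym_diff Y Y' \<subseteq> J" using Y by auto
      ultimately have "sym_diff Y Y' = {}" using J(2) unfolding indep_in_def by blast
      then show "Y = Y'" by auto
    qed
    moreover have "w ` Pow J \<subseteq> Pow I" using w by auto
    ultimately have "card (Pow J) \<le> card (Pow I)" using fin by (meson card_inj_on_le finite_Pow_iff)
    then show False using lt by (simp add: card_Pow fin)
  qed
  then show ?thesis
    using bspaceD(1,2)[OF K] unfolding matroid_def space_matroid_def
    by (auto simp: indep_in_def)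
qed

text \<open>A dependency of the projection lifts to \<open>K\<close>, and its part inside
  \<open>C\<close> can be rewritten within the basis \<open>J\<close>. Conversely a nonempty member
  inside \<open>I \<union> J\<close> keeps a nonempty projection because \<open>J\<close> is
  independent. In particular the choice of \<open>J\<close> does not matter.\<close>

lemma indep_in_minor_space:
  assumes K: "bspace E K" and J: "basis_of (space_matroid E K) C J" and "C \<subseteq> E"
    and CS: "C \<inter> S = {}" "S \<subseteq> E" and I: "I \<subseteq> S"
  shows "indep_in K (I \<union> J) \<longleftrightarrow> indep_in (minor_space K C S) I"
proof
  have J': "J \<subseteq> C" "indep_in K J" and max: "\<And>x. x \<in> C - J \<Longrightarrow> \<not> indep_in K (insert x J)"
    using J \<open>C \<subseteq> E\<close> by (auto simp: basis_of_def indeps_space_matroid)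
  have finE: "finite E" by (rule bspaceD(1)[OF K])
  {
    assume IJ: "indep_in K (I \<union> J)"
    show "indep_in (minor_space K C S) I" unfolding indep_in_def
    proof (intro ballI impI)
      fix Y assume "Y \<in> minor_space K C S" "Y \<subseteq> I"
      then obtain Z where Z: "Z \<in> K" "Z \<subseteq> C \<union> S" "Y = Z - C" by (auto simp: minor_space_def)
      have "finite (Z \<inter> C)" using \<open>C \<subseteq> E\<close> finE finite_subset by blast
      from reduce_into_basis[OF K J'(2) max this]
      obtain W where W: "W \<subseteq> J" "sym_diff (Z \<inter> C) W \<in> K" by blast
      have "sym_diff Z (sym_diff (Z \<inter> C) W) \<in> K" by (rule bspaceD(4)[OF K Z(1) W(2)])
      moreover have "sym_diff Z (sym_diff (Z \<inter> C) W) = Y \<union> W"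
        using W(1) J'(1) Z(3) by auto
      ultimately have "Y \<union> W = {}" using IJ W(1) \<open>Y \<subseteq> I\<close> unfolding indep_in_def
        by (metis sup.mono)
      then show "Y = {}" by auto
    qed
  next
    assume M: "indep_in (minor_space K C S) I"
    show "indep_in K (I \<union> J)" unfolding indep_in_def
    proof (intro ballI impI)
      fix Z assume Z: "Z \<in> K" "Z \<subseteq> I \<union> J"
      then have "Z - C \<in> minor_space K C S" using I J'(1) by (auto simp: minor_space_def)
      moreover have "Z - C \<subseteq> I" using Z J'(1) by auto
      ultimately have "Z - C = {}" using M by (auto simp: indep_in_def)
      then have "Z \<subseteq> J" using Z I CS by auto
      then show "Z = {}" using J'(2) Z(1) by (auto simp: indep_in_def)
    qed
  }
qed

lemma ex_basis_of:
  assumes K: "bspace E K" and C: "C \<subseteq> E"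
  shows "\<exists>J. basis_of (space_matroid E K) C J"
proof -
  define F where "F = {J. J \<subseteq> C \<and> indep_in K J}"
  have "finite C" using K C by (meson bspaceD(1) finite_subset)
  then have "finite F" unfolding F_def by auto
  moreover have "{} \<in> F" by (auto simp: F_def indep_in_def)
  ultimately obtain J where J: "J \<in> F" "\<And>J'. J' \<in> F \<Longrightarrow> J \<subseteq> J' \<Longrightarrow> J' = J"
    using finite_has_maximal[of F] by (metis empty_iff)
  have "basis_of (space_matroid E K) C J"
    unfolding basis_of_def indeps_space_matroid
  proof (intro conjI ballI notI)
    fix x assume x: "x \<in> C - J" "insert x J \<subseteq> E \<and> indep_in K (insert x J)"
    then have "insert x J \<in> F" using J(1) by (auto simp: F_def)
    then show False using J(2)[of "insert x J"] x by auto
  qed (use J(1) C in \<open>auto simp: F_def\<close>)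
  then show ?thesis ..
qed

section \<open>Minors of space matroids\<close>

lemma delete_contract_space_matroid:
  assumes K: "bspace E K" and CD: "C \<subseteq> E" "C \<inter> S = {}" "S \<subseteq> E" "D \<inter> S = {}" "E - C - D = S"
  shows "delete (contract (space_matroid E K) C) D = space_matroid S (minor_space K C S)"
proof -
  have "I \<subseteq> E - C \<and> (\<exists>J. basis_of (space_matroid E K) C J \<and> I \<union> J \<in> indeps (space_matroid E K)) \<and> I \<subseteq> E - C - D
     \<longleftrightarrow> I \<subseteq> S \<and> indep_in (minor_space K C S) I" for I
  proof (cases "I \<subseteq> S")
    case True
    have "I \<union> J \<in> indeps (space_matroid E K) \<longleftrightarrow> indep_in (minor_space K C S) I"
      if J: "basis_of (space_matroid E K) C J" for J
      using indep_in_minor_space[OF K J CD(1,2,3) True] J CD True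
      by (auto simp: indeps_space_matroid basis_of_def)
    then show ?thesis using ex_basis_of[OF K CD(1)] CD True by blast
  qed (use CD in auto)
  then show ?thesis using CD(5)
    unfolding delete_def contract_def by (auto simp: space_matroid_def)
qed

lemma minor_space_matroid_iff:
  assumes K: "bspace E K"
  shows "minor N (space_matroid E K) \<longleftrightarrow>
    (\<exists>C S. C \<subseteq> E \<and> S \<subseteq> E \<and> C \<inter> S = {} \<and> N = space_matroid S (minor_space K C S))"
proof
  assume "minor N (space_matroid E K)"
  then obtain C D where CD: "C \<subseteq> E" "D \<subseteq> E" "C \<inter> D = {}"
    "N = delete (contract (space_matroid E K) C) D"
    by (auto simp: minor_def)
  then have "N = space_matroid (E - C - D) (minor_space K C (E - C - D))"
    using delete_contract_space_matroid[OF K, of C "E - C - D" D] by auto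
  then show "\<exists>C S. C \<subseteq> E \<and> S \<subseteq> E \<and> C \<inter> S = {} \<and> N = space_matroid S (minor_space K C S)"
    using CD by (intro exI[of _ C] exI[of _ "E - C - D"]) auto
next
  assume "\<exists>C S. C \<subseteq> E \<and> S \<subseteq> E \<and> C \<inter> S = {} \<and> N = space_matroid S (minor_space K C S)"
  then obtain C S where CS: "C \<subseteq> E" "S \<subseteq> E" "C \<inter> S = {}" "N = space_matroid S (minor_space K C S)"
    by blast
  have "E - C - (E - C - S) = S" "(E - C - S) \<inter> S = {}" using CS by auto
  then have "N = delete (contract (space_matroid E K) C) (E - C - S)"
    using delete_contract_space_matroid[OF K, of C S "E - C - S"] CS by auto
  then show "minor N (space_matroid E K)"
    unfolding minor_def using CS by (intro exI[of _ C] exI[of _ "E - C - S"]) auto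
qed

lemma bspace_minor_space:
  assumes K: "bspace E K" and "S \<subseteq> E"
  shows "bspace S (minor_space K C S)"
proof -
  have "sym_diff Y Z \<in> minor_space K C S" if "Y \<in> minor_space K C S" "Z \<in> minor_space K C S" for Y Z
  proof -
    from that obtain Y' Z' where Y': "Y' \<in> K" "Y' \<subseteq> C \<union> S" "Y = Y' - C"
      and Z': "Z' \<in> K" "Z' \<subseteq> C \<union> S" "Z = Z' - C" by (auto simp: minor_space_def)
    have "sym_diff Y Z = sym_diff Y' Z' - C" using Y'(3) Z'(3) by auto
    moreover have "sym_diff Y' Z' \<in> K" by (rule bspaceD(4)[OF K Y'(1) Z'(1)])
    moreover have "sym_diff Y' Z' \<subseteq> C \<union> S" using Y'(2) Z'(2) by auto
    ultimately show ?thesis unfolding minor_space_def by blast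
  qed
  moreover have "{} \<in> minor_space K C S"
    using bspaceD(2)[OF K] unfolding minor_space_def by blast
  moreover have "finite S" using assms by (meson bspaceD(1) finite_subset)
  moreover have "minor_space K C S \<subseteq> Pow S" by (auto simp: minor_space_def)
  ultimately show ?thesis unfolding bspace_def by blast
qed

text \<open>A binary space is determined by its independent sets. The minimal dependent sets are
  members of both spaces, and subtracting one that lies inside \<open>Z\<close> makes
  \<open>Z\<close> smaller.\<close>

lemma bspace_subset_if_indep_in:
  assumes K: "bspace E K" and K': "bspace E K'"
    and eq: "\<And>I. I \<subseteq> E \<Longrightarrow> indep_in K I \<longleftrightarrow> indep_in K' I"
    and "Z \<in> K"
  shows "Z \<in> K'"
  using assms(4)
proof (induction "card Z" arbitrary: Z rule: less_induct)
  case less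
  show ?case
  proof (cases "Z = {}")
    case True
    then show ?thesis using bspaceD(2)[OF K'] by simp
  next
    case False
    have ZE: "Z \<subseteq> E" using bspaceD(3)[OF K less.prems] .
    then have finZ: "finite Z" using bspaceD(1)[OF K] finite_subset by blast
    define F where "F = {C. C \<subseteq> Z \<and> \<not> indep_in K C}"
    have "Z \<in> F" using False less.prems by (auto simp: F_def indep_in_def)
    moreover have "finite F" using finZ by (auto simp: F_def)
    ultimately obtain C where C: "C \<in> F" and min: "\<And>C'. C' \<in> F \<Longrightarrow> C' \<subseteq> C \<Longrightarrow> C' = C"
      using finite_has_minimal[of F] by (metis empty_iff)
    have CE: "C \<subseteq> E" "C \<subseteq> Z" using C ZE by (auto simp: F_def)
    have circ: "C \<in> L" if L: "L = K \<or> L = K'" for L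
    proof -
      have "\<not> indep_in L C" using C CE eq L by (auto simp: F_def)
      then obtain Y where Y: "Y \<in> L" "Y \<subseteq> C" "Y \<noteq> {}" by (auto simp: indep_in_def)
      then have "\<not> indep_in L Y" by (auto simp: indep_in_def)
      then have "Y \<in> F" using Y CE eq L by (auto simp: F_def)
      then show ?thesis using min Y by blast
    qed
    have "C \<noteq> {}" using C by (auto simp: F_def indep_in_def)
    have CC: "C \<in> K" "C \<in> K'" using circ by auto
    have "card (sym_diff Z C) < card Z"
      using CE(2) finZ \<open>C \<noteq> {}\<close> by (intro psubset_card_mono) auto
    then have "sym_diff Z C \<in> K'" using less.hyps bspaceD(4)[OF K less.prems CC(1)] by blast
    then have "sym_diff (sym_diff Z C) C \<in> K'" by (rule bspaceD(4)[OF K' _ CC(2)])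
    moreover have "sym_diff (sym_diff Z C) C = Z" by auto
    ultimately show ?thesis by simp
  qed
qed

lemma indep_in_preimage:
  assumes "I \<subseteq> S"
  shows "indep_in {Z. Z \<subseteq> S \<and> f ` Z \<in> K} I \<longleftrightarrow> indep_in K (f ` I)"
proof
  assume L: "indep_in {Z. Z \<subseteq> S \<and> f ` Z \<in> K} I"
  show "indep_in K (f ` I)" unfolding indep_in_def
  proof (intro ballI impI)
    fix Y assume Y: "Y \<in> K" "Y \<subseteq> f ` I"
    then obtain Z where "Z \<subseteq> I" "Y = f ` Z" by (meson subset_imageE)
    then show "Y = {}" using L Y assms unfolding indep_in_def by auto
  qed
next
  assume "indep_in K (f ` I)"
  then show "indep_in {Z. Z \<subseteq> S \<and> f ` Z \<in> K} I"
    unfolding indep_in_def by (auto dest!: bspec[of _ _ "f ` _"])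
qed

text \<open>The preimage of \<open>K'\<close> under \<open>f\<close> is again a space on
  \<open>S\<close>, and its independent sets are those that \<open>f\<close> sends to independent
  sets. Since a space is determined by its independent sets, \<open>f\<close> is an isomorphism
  exactly if this preimage is \<open>K\<close>.\<close>

lemma isomorphic_space_matroid_iff:
  assumes K: "bspace S K" and K': "bspace S' K'"
  shows "isomorphic (space_matroid S K) (space_matroid S' K') \<longleftrightarrow>
    (\<exists>f. bij_betw f S S' \<and> K = {Z. Z \<subseteq> S \<and> f ` Z \<in> K'})"
proof -
  have "(\<forall>I\<subseteq>S. I \<in> indeps (space_matroid S K) \<longleftrightarrow> f ` I \<in> indeps (space_matroid S' K')) \<longleftrightarrow>
     K = {Z. Z \<subseteq> S \<and> f ` Z \<in> K'}" if f: "bij_betw f S S'" for f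
  proof -
    define L where "L = {Z. Z \<subseteq> S \<and> f ` Z \<in> K'}"
    have inj: "inj_on f S" and im: "f ` S = S'" using f by (auto simp: bij_betw_def)
    have sd: "f ` sym_diff Y Z = sym_diff (f ` Y) (f ` Z)" if "Y \<subseteq> S" "Z \<subseteq> S" for Y Z
    proof -
      have "f ` (Y - Z) = f ` Y - f ` Z" "f ` (Z - Y) = f ` Z - f ` Y"
        using inj_on_image_set_diff[OF inj] that by auto
      then show ?thesis by (simp add: image_Un)
    qed
    have L: "bspace S L"
      using K K' sd unfolding bspace_def L_def by auto
    have ind: "indep_in L I \<longleftrightarrow> indep_in K' (f ` I)" if "I \<subseteq> S" for I
      unfolding L_def by (rule indep_in_preimage[OF that])
    have "(\<forall>I\<subseteq>S. I \<in> indeps (space_matroid S K) \<longleftrightarrow> f ` I \<in> indeps (space_matroid S' K')) \<longleftrightarrow>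
      (\<forall>I\<subseteq>S. indep_in K I \<longleftrightarrow> indep_in L I)"
      using ind im by (auto simp: indeps_space_matroid)
    also have "\<dots> \<longleftrightarrow> K = L"
      using bspace_subset_if_indep_in[OF K L] bspace_subset_if_indep_in[OF L K] by blast
    finally show ?thesis unfolding L_def .
  qed
  then show ?thesis unfolding isomorphic_def by auto
qed

section \<open>Matrices and splitting\<close>

definition mat_space :: "'a set \<Rightarrow> nat \<Rightarrow> (nat \<Rightarrow> 'a \<Rightarrow> bit) \<Rightarrow> 'a set set" where
  "mat_space E m A = {Z. Z \<subseteq> E \<and> (\<forall>i<m. (\<Sum>e\<in>Z. A i e) = 0)}"

definition even_on :: "'a set \<Rightarrow> 'a set set \<Rightarrow> 'a set set" where
  "even_on X K = {Z \<in> K. even (card (Z \<inter> X))}"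

lemma sum_bit_sym_diff:
  fixes f :: "'a \<Rightarrow> bit"
  assumes "finite A" "finite B"
  shows "sum f (sym_diff A B) = sum f A + sum f B"
proof -
  have "sum f A = sum f (A \<inter> B) + sum f (A - B)" "sum f B = sum f (A \<inter> B) + sum f (B - A)"
    using sum.Int_Diff[OF assms(1), of f B] sum.Int_Diff[OF assms(2), of f A]
    by (simp_all only: Int_commute)
  moreover have "sum f (sym_diff A B) = sum f (A - B) + sum f (B - A)"
    using assms by (intro sum.union_disjoint) auto
  moreover have "b + c = (a + b) + (a + c)" for a b c :: bit by (cases a; cases b; cases c) auto
  ultimately show ?thesis by metis
qed

lemma sum_bit_indicator: "finite Z \<Longrightarrow> (\<Sum>e\<in>Z. if e \<in> X then 1 else (0::bit)) = 0 \<longleftrightarrow> even (card (Z \<inter> X))"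
proof -
  assume Z: "finite Z"
  have "(of_nat n = (0::bit)) = even n" for n :: nat by (induction n) auto
  then show ?thesis using Z by (simp add: sum.If_cases)
qed

lemma even_card_sym_diff:
  assumes "finite A" "finite B"
  shows "even (card (sym_diff A B \<inter> X)) \<longleftrightarrow> (even (card (A \<inter> X)) \<longleftrightarrow> even (card (B \<inter> X)))"
proof -
  have b: "a + b = 0 \<longleftrightarrow> (a = 0 \<longleftrightarrow> b = 0)" for a b :: bit by (cases a; cases b) auto
  have "finite (sym_diff A B)" using assms by auto
  then show ?thesis
    using assms by (simp only: sum_bit_indicator[symmetric] sum_bit_sym_diff b)
qed

lemma bspace_mat_space:
  assumes "finite E"
  shows "bspace E (mat_space E m A)"
proof -
  have "sym_diff Y Z \<in> mat_space E m A" if "Y \<in> mat_space E m A" "Z \<in> mat_space E m A" for Y Z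
  proof -
    have "finite Y" "finite Z" using that assms finite_subset by (auto simp: mat_space_def)
    then show ?thesis using that by (auto simp: mat_space_def sum_bit_sym_diff)
  qed
  then show ?thesis using assms unfolding bspace_def by (auto simp: mat_space_def)
qed

lemma vector_matroid_eq_space_matroid:
  assumes "finite E"
  shows "vector_matroid E m A = space_matroid E (mat_space E m A)"
proof -
  have "I \<in> indeps (vector_matroid E m A) \<longleftrightarrow> I \<in> indeps (space_matroid E (mat_space E m A))" for I
  proof (cases "I \<subseteq> E")
    case True
    then have "(\<forall>Z\<subseteq>I. P Z \<longrightarrow> Z = {}) \<longleftrightarrow> (\<forall>Z\<in>{Z. Z \<subseteq> E \<and> P Z}. Z \<subseteq> I \<longrightarrow> Z = {})" for P
      by auto
    then show ?thesis
      unfolding vector_matroid_bit_indep_iff[OF assms] indeps_space_matroid indep_in_def mat_space_def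
      by (rule arg_cong)
  qed (simp add: vector_matroid_bit_indep_iff[OF assms] indeps_space_matroid)
  then have "indeps (vector_matroid E m A) = indeps (space_matroid E (mat_space E m A))" by blast
  then show ?thesis by (simp add: vector_matroid_def space_matroid_def)
qed

lemma mat_space_append_row:
  assumes "finite E"
  shows "mat_space E (Suc m) (append_row m A X) = even_on X (mat_space E m A)"
proof -
  have "(\<forall>i<Suc m. (\<Sum>e\<in>Z. append_row m A X i e) = 0) \<longleftrightarrow>
    (\<forall>i<m. (\<Sum>e\<in>Z. A i e) = 0) \<and> even (card (Z \<inter> X))" if "Z \<subseteq> E" for Z
    using sum_bit_indicator[of Z X] finite_subset[OF that assms]
    by (auto simp: append_row_def less_Suc_eq)
  then show ?thesis by (auto simp: mat_space_def even_on_def)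
qed

section \<open>The cycle space of a graph\<close>

text \<open>A loop gets the zero column, as if its single end were counted twice modulo two.\<close>

definition inc :: "('v, 'e) mgraph \<Rightarrow> 'v \<Rightarrow> 'e \<Rightarrow> bit" where
  "inc G v e = (if v \<in> mends G e \<and> card (mends G e) = 2 then 1 else 0)"

definition graph_space :: "('v, 'e) mgraph \<Rightarrow> 'e set set" where
  "graph_space G = {Z. Z \<subseteq> medges G \<and> (\<forall>v. (\<Sum>e\<in>Z. inc G v e) = 0)}"

lemma bspace_graph_space:
  assumes "finite_mgraph G"
  shows "bspace (medges G) (graph_space G)"
proof -
  have fin: "finite (medges G)" using assms by (simp add: finite_mgraph_def)
  have "sym_diff Y Z \<in> graph_space G" if "Y \<in> graph_space G" "Z \<in> graph_space G" for Y Z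
  proof -
    have "finite Y" "finite Z" using that fin finite_subset by (auto simp: graph_space_def)
    then show ?thesis using that by (auto simp: graph_space_def sum_bit_sym_diff)
  qed
  then show ?thesis using fin unfolding bspace_def by (auto simp: graph_space_def)
qed

text \<open>Every edge of the cycle contributes its start and its end, and the ends are a cyclic
  shift of the starts. Both contributions have the same sum, so they cancel modulo two.\<close>

lemma cycle_edges_in_graph_space:
  assumes "cycle_edges G C"
  shows "C \<in> graph_space G \<and> C \<noteq> {}"
proof -
  obtain vs es where c: "es \<noteq> []" "length vs = length es" "distinct vs" "distinct es"
    "set es \<subseteq> medges G" "C = set es"
    "\<And>i. i < length es \<Longrightarrow> mends G (es ! i) = {vs ! i, vs ! (Suc i mod length vs)}"
    using assms unfolding cycle_edges_def by blast
  let ?n = "length es"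
  have "(\<Sum>e\<in>C. inc G v e) = 0" for v
  proof -
    define h :: "nat \<Rightarrow> bit" where "h i = (if v = vs ! i then 1 else 0)" for i
    have "bij_betw (\<lambda>i. es ! i) {..<?n} C"
      using bij_betw_nth[OF c(4), of "{..<?n}" C] c(6) by simp
    then have "(\<Sum>e\<in>C. inc G v e) = (\<Sum>i<?n. inc G v (es ! i))"
      by (simp add: sum.reindex_bij_betw[symmetric])
    also have "\<dots> = (\<Sum>i<?n. h i + h (Suc i mod ?n))"
    proof (rule sum.cong)
      fix i assume "i \<in> {..<?n}"
      then have "mends G (es ! i) = {vs ! i, vs ! (Suc i mod ?n)}" using c by auto
      \<comment> \<open>The two vertices coincide only in a cycle of length one; then both terms
        agree and cancel, as \<open>inc\<close> of a loop requires.\<close>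
      then show "inc G v (es ! i) = h i + h (Suc i mod ?n)"
        by (cases "vs ! i = vs ! (Suc i mod ?n)") (auto simp: inc_def h_def)
    qed simp
    also have "\<dots> = (\<Sum>i<?n. h i) + (\<Sum>i<?n. h (Suc i mod ?n))" by (rule sum.distrib)
    also have "(\<Sum>i<?n. h (Suc i mod ?n)) = (\<Sum>i<?n. h i)"
    proof (rule sum.reindex_bij_betw)
      have "inj_on (\<lambda>i. Suc i mod ?n) {..<?n}"
      proof (rule inj_onI)
        fix i j assume "i \<in> {..<?n}" "j \<in> {..<?n}" "Suc i mod ?n = Suc j mod ?n"
        then show "i = j" by (cases "Suc i = ?n"; cases "Suc j = ?n") auto
      qed
      moreover have "(\<lambda>i. Suc i mod ?n) ` {..<?n} \<subseteq> {..<?n}" using c(1) by auto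
      ultimately show "bij_betw (\<lambda>i. Suc i mod ?n) {..<?n} {..<?n}"
        by (simp add: bij_betw_def endo_inj_surj)
    qed
    also have "(\<Sum>i<?n. h i) + (\<Sum>i<?n. h i) = 0"
      by (cases "\<Sum>i<?n. h i") auto
    finally show ?thesis .
  qed
  then show ?thesis using c by (auto simp: graph_space_def)
qed

section \<open>Cycles inside even edge sets\<close>

definition gpath :: "('v, 'e) mgraph \<Rightarrow> 'e set \<Rightarrow> 'v list \<Rightarrow> 'e list \<Rightarrow> bool" where
  "gpath G Z vs es \<longleftrightarrow> length vs = Suc (length es) \<and> distinct vs \<and> distinct es \<and> set es \<subseteq> Z \<and>
     (\<forall>i<length es. mends G (es ! i) = {vs ! i, vs ! Suc i})"

lemma gpath_Cons:
  assumes p: "gpath G Z vs es" and e: "e \<in> Z" "mends G e = {w, vs ! 0}" and w: "w \<notin> set vs"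
  shows "gpath G Z (w # vs) (e # es)"
proof -
  have "e \<notin> set es"
  proof
    assume "e \<in> set es"
    then obtain i where "i < length es" "es ! i = e" by (meson in_set_conv_nth)
    then show False using p e(2) w unfolding gpath_def
      by (metis Suc_less_eq doubleton_eq_iff less_SucI nth_mem)
  qed
  moreover have "mends G ((e # es) ! i) = {(w # vs) ! i, (w # vs) ! Suc i}" if "i < Suc (length es)" for i
    using p e(2) that unfolding gpath_def by (cases i) auto
  ultimately show ?thesis using p e(1) w by (auto simp: gpath_def)
qed

text \<open>The only edge of the path at its first vertex is \<open>es ! 0\<close>. As
  \<open>e\<close> differs from it, \<open>e\<close> is new to the path and closes a proper cycle,
  which for \<open>j = 1\<close> is a pair of parallel edges.\<close>

lemma gpath_close:
  assumes p: "gpath G Z vs es" and e: "e \<in> Z" "mends G e = {vs ! j, vs ! 0}" and j: "0 < j" "j \<le> length es"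
    and ne: "e \<noteq> es ! 0" and Z: "Z \<subseteq> medges G" "\<And>e. e \<in> Z \<Longrightarrow> mends G e \<subseteq> mverts G"
  shows "\<exists>C\<subseteq>Z. cycle_edges G C"
proof -
  let ?vs = "take (Suc j) vs" and ?es = "take j es @ [e]"
  have P: "length vs = Suc (length es)" "distinct vs" "distinct es" "set es \<subseteq> Z"
    "\<And>i. i < length es \<Longrightarrow> mends G (es ! i) = {vs ! i, vs ! Suc i}"
    using p by (auto simp: gpath_def)
  have "e \<notin> set es"
  proof
    assume "e \<in> set es"
    then obtain i where i: "i < length es" "es ! i = e" by (meson in_set_conv_nth)
    then have "vs ! 0 = vs ! i \<or> vs ! 0 = vs ! Suc i" using P(5)[OF i(1)] e(2) by auto
    then have "i = 0" using P(1,2) i(1) by (auto simp: nth_eq_iff_index_eq)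
    then show False using i ne by simp
  qed
  then have d: "distinct ?es" using P(3) by (auto dest: in_set_takeD)
  have "set vs \<subseteq> mverts G"
  proof
    fix v assume "v \<in> set vs"
    then obtain i where i: "i < Suc (length es)" "v = vs ! i" using P(1) by (metis in_set_conv_nth)
    show "v \<in> mverts G"
    proof (cases "i < length es")
      case True
      then have "es ! i \<in> Z" using P(4) by auto
      then show ?thesis using P(5)[OF True] Z(2)[of "es ! i"] i(2) by auto
    next
      case False
      then have "i = Suc (i - 1)" "i - 1 < length es" using i(1) j by auto
      then have "es ! (i - 1) \<in> Z" "v \<in> mends G (es ! (i - 1))"
        using P(4) P(5)[of "i - 1"] i(2) by auto
      then show ?thesis using Z(2) by auto
    qed
  qed
  then have "set ?vs \<subseteq> mverts G" using set_take_subset by fast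
  moreover have "set ?es \<subseteq> Z" using P(4) e(1) by (auto dest: in_set_takeD)
  moreover have "mends G (?es ! i) = {?vs ! i, ?vs ! (Suc i mod length ?vs)}" if "i < length ?es" for i
  proof (cases "i = j")
    case True
    then show ?thesis using e(2) j P(1) by (simp add: nth_append)
  next
    case False
    then show ?thesis using that j P(1) P(5)[of i] by (simp add: nth_append)
  qed
  moreover have "length ?vs = length ?es" "distinct ?vs" "?es \<noteq> []" using P j by auto
  ultimately have "cycle_edges G (set ?es)" unfolding cycle_edges_def
    using d Z(1) by (intro exI[of _ ?vs] exI[of _ ?es]) blast
  then show ?thesis using \<open>set ?es \<subseteq> Z\<close> by blast
qed

text \<open>A longest path in an even edge set can be closed to a cycle at its first vertex.\<close>

lemma graph_space_contains_cycle:
  assumes G: "finite_mgraph G" and Z: "Z \<in> graph_space G" "Z \<noteq> {}"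
  shows "\<exists>C\<subseteq>Z. cycle_edges G C"
proof (cases "\<exists>e\<in>Z. card (mends G e) \<noteq> 2")
  have ZE: "Z \<subseteq> medges G" using Z by (auto simp: graph_space_def)
  have sub: "mends G e \<subseteq> mverts G" "card (mends G e) \<in> {1, 2}" if "e \<in> Z" for e
    using G ZE that by (auto simp: finite_mgraph_def)
  {
    case True
    then obtain e where e: "e \<in> Z" "card (mends G e) = 1" using sub by blast
    then obtain v where "mends G e = {v}" by (meson card_1_singletonE)
    then have "cycle_edges G {e}" unfolding cycle_edges_def
      using e ZE sub(1)[OF e(1)] by (intro exI[of _ "[v]"] exI[of _ "[e]"]) auto
    then show ?thesis using e by blast
  next
    case False
    then have two: "card (mends G e) = 2" if "e \<in> Z" for e using that by blast
    obtain e0 where e0: "e0 \<in> Z" using Z(2) by blast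
    then obtain a b where ab: "mends G e0 = {a, b}" "a \<noteq> b" using two by (meson card_2_iff)
    \<comment> \<open>Paths without edges are excluded so that the longest path has a first edge.
      Their lengths are bounded by \<open>card Z\<close> since the edges are distinct.\<close>
    define Q where "Q = (\<lambda>(vs, es). gpath G Z vs es \<and> es \<noteq> [])"
    have "Q ([a, b], [e0])" using ab e0 by (auto simp: Q_def gpath_def)
    moreover have "\<forall>p. Q p \<longrightarrow> length (snd p) < Suc (card Z)"
    proof (intro allI impI)
      fix p assume "Q p"
      moreover have "finite Z" using G ZE finite_subset by (auto simp: finite_mgraph_def)
      ultimately show "length (snd p) < Suc (card Z)"
        unfolding Q_def gpath_def by (auto simp: less_Suc_eq_le distinct_card[symmetric] intro: card_mono)
    qed
    ultimately obtain p where p: "Q p" "\<And>q. Q q \<Longrightarrow> length (snd q) \<le> length (snd p)"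
      using ex_has_greatest_nat[of Q _ "\<lambda>p. length (snd p)"] by blast
    obtain vs es where "p = (vs, es)" by (cases p)
    with p have P: "gpath G Z vs es" "es \<noteq> []"
      and max: "\<And>vs' es'. gpath G Z vs' es' \<Longrightarrow> es' \<noteq> [] \<Longrightarrow> length es' \<le> length es"
      by (auto simp: Q_def)
    let ?v = "vs ! 0" and ?e = "es ! 0"
    have e: "?e \<in> Z" "?v \<in> mends G ?e" using P by (auto simp: gpath_def)
    \<comment> \<open>Otherwise \<open>?v\<close> would have degree one in \<open>Z\<close>: loops
      are ruled out in this case.\<close>
    have "\<exists>e'\<in>Z. e' \<noteq> ?e \<and> ?v \<in> mends G e'"
    proof (rule ccontr)
      assume "\<not> ?thesis"
      then have "(\<Sum>x\<in>Z. inc G ?v x) = (\<Sum>x\<in>Z. if x = ?e then 1 else 0)"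
        using e two by (intro sum.cong) (auto simp: inc_def)
      also have "\<dots> = 1"
        using e(1) finite_subset[OF ZE] G by (auto simp: finite_mgraph_def)
      finally show False using Z(1) by (auto simp: graph_space_def)
    qed
    then obtain e' where e': "e' \<in> Z" "e' \<noteq> ?e" "?v \<in> mends G e'" by blast
    then obtain w where w: "mends G e' = {w, ?v}" "w \<noteq> ?v"
      using two[OF e'(1)] by (auto simp: card_2_iff doubleton_eq_iff)
    show ?thesis
    proof (cases "w \<in> set vs")
      case False
      have "gpath G Z (w # vs) (e' # es)" by (rule gpath_Cons[OF P(1) e'(1) w(1) False])
      then show ?thesis using max by fastforce
    next
      case True
      then obtain j where j: "j < length vs" "w = vs ! j" by (metis in_set_conv_nth)
      then have "0 < j" "j \<le> length es" using w(2) P(1) by (auto simp: gpath_def intro: gr0I)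
      then show ?thesis
        using gpath_close[OF P(1) e'(1) _ _ _ e'(2) ZE sub(1)] w(1) j(2) by blast
    qed
  }
qed

lemma cycle_matroid_eq_space_matroid:
  assumes "finite_mgraph G"
  shows "cycle_matroid G = space_matroid (medges G) (graph_space G)"
proof -
  have "(\<forall>C. cycle_edges G C \<longrightarrow> \<not> C \<subseteq> I) \<longleftrightarrow> indep_in (graph_space G) I" for I
    unfolding indep_in_def
    using cycle_edges_in_graph_space graph_space_contains_cycle[OF assms] by (metis subset_trans)
  then show ?thesis by (simp add: cycle_matroid_def space_matroid_def)
qed

lemma graphic_eq_mat_space:
  assumes "graphic B"
  obtains m A where "finite (ground B)" "represented_by B m A"
    "B = space_matroid (ground B) (mat_space (ground B) m A)"
proof -
  obtain G :: "(nat, nat) mgraph" and f where G: "finite_mgraph G" and B: "matroid B"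
    and f: "bij_betw f (ground B) (medges G)"
      "\<And>I. I \<subseteq> ground B \<Longrightarrow> I \<in> indeps B \<longleftrightarrow> f ` I \<in> indeps (cycle_matroid G)"
    using assms unfolding graphic_def isomorphic_def by (auto simp: cycle_matroid_def)
  let ?E = "ground B"
  have fin: "finite ?E" "indeps B \<subseteq> Pow ?E" using B by (auto simp: matroid_def)
  \<comment> \<open>Vertices are natural numbers and serve directly as row indices of the incidence
    matrix; an index that is no vertex gives a zero row.\<close>
  obtain m where m: "mverts G \<subseteq> {..<m}"
    using G by (auto simp: finite_mgraph_def finite_nat_iff_bounded)
  define A where "A = (\<lambda>v e. inc G v (f e))"
  have inj: "inj_on f ?E" using f(1) by (simp add: bij_betw_def)
  have mat: "mat_space ?E m A = {Z. Z \<subseteq> ?E \<and> f ` Z \<in> graph_space G}"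
  proof -
    have "(\<forall>i<m. (\<Sum>e\<in>Z. A i e) = 0) \<longleftrightarrow> f ` Z \<in> graph_space G" if "Z \<subseteq> ?E" for Z
    proof -
      have fZ: "f ` Z \<subseteq> medges G" using that f(1) by (auto simp: bij_betw_def)
      have s: "(\<Sum>e\<in>f ` Z. inc G v e) = (\<Sum>e\<in>Z. A v e)" for v
        unfolding A_def using inj_on_subset[OF inj that] by (simp add: sum.reindex)
      have "(\<Sum>e\<in>f ` Z. inc G v e) = 0" if "\<not> v < m" for v
      proof (rule sum.neutral, rule ballI)
        fix e assume "e \<in> f ` Z"
        then have "mends G e \<subseteq> mverts G" using fZ G by (auto simp: finite_mgraph_def)
        then show "inc G v e = 0" using m that by (auto simp: inc_def)
      qed
      then show ?thesis unfolding graph_space_def using fZ s by (auto) metis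
    qed
    then show ?thesis by (auto simp: mat_space_def)
  qed
  have "I \<in> indeps B \<longleftrightarrow> I \<in> indeps (space_matroid ?E (mat_space ?E m A))" for I
  proof (cases "I \<subseteq> ?E")
    case True
    have fI: "f ` I \<subseteq> medges G" using True f(1) by (auto simp: bij_betw_def)
    have "indep_in (mat_space ?E m A) I \<longleftrightarrow> indep_in (graph_space G) (f ` I)"
      unfolding mat by (rule indep_in_preimage[OF True])
    then show ?thesis
      using f(2)[OF True] fI True
      by (simp add: cycle_matroid_eq_space_matroid[OF G] indeps_space_matroid)
  qed (use fin(2) in \<open>auto simp: indeps_space_matroid\<close>)
  then have eq: "B = space_matroid ?E (mat_space ?E m A)"
    by (intro matroid.equality) (auto simp: space_matroid_def)
  moreover have "represented_by B m A"
    using eq unfolding represented_by_def vector_matroid_eq_space_matroid[OF fin(1)] .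
  ultimately show ?thesis using that fin(1) by blast
qed

section \<open>Spaces on six elements\<close>

type_synonym six_pred = "bool \<Rightarrow> bool \<Rightarrow> bool \<Rightarrow> bool \<Rightarrow> bool \<Rightarrow> bool \<Rightarrow> bool"

text \<open>Isomorphism with a fixed space on six elements, expressed by naming the elements.
  Comparisons with the concrete graphs thereby become propositional checks on six truth
  values.\<close>

definition six_form :: "six_pred \<Rightarrow> 'a set \<Rightarrow> 'a set set \<Rightarrow> bool" where
  "six_form P S K \<longleftrightarrow> (\<exists>a b c d e f. distinct [a, b, c, d, e, f] \<and> S = {a, b, c, d, e, f} \<and>
     K = {Z. Z \<subseteq> S \<and> P (a \<in> Z) (b \<in> Z) (c \<in> Z) (d \<in> Z) (e \<in> Z) (f \<in> Z)})"

text \<open>The cycle spaces of \<open>G3\<close>, of \<open>G4\<close> and \<open>G5\<close>, and of \<open>G6\<close>: even degree at all but one vertex.\<close>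

definition k4_pred :: six_pred where
  "k4_pred a b c d e f \<longleftrightarrow> ((a \<noteq> b) = c) \<and> ((a \<noteq> d) = e) \<and> ((b \<noteq> d) = f)"

definition g4_pred :: six_pred where
  "g4_pred a b c d e f \<longleftrightarrow> ((a \<noteq> b) = (c \<noteq> d)) \<and> ((a \<noteq> b) = e)"

definition g6_pred :: six_pred where
  "g6_pred a b c d e f \<longleftrightarrow> ((a \<noteq> b) = (c \<noteq> d)) \<and> ((a \<noteq> b) = (e \<noteq> f))"

lemma lessThan_6: "{..<6::nat} = {0, 1, 2, 3, 4, 5}"
  by (simp add: eval_nat_numeral lessThan_Suc insert_commute)

text \<open>The six names are the preimages of the edge numbers 0 to 5 under the
  isomorphism.\<close>

lemma isomorphic_cycle_matroid_iff_six_form: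
  fixes G :: "('v, nat) mgraph"
  assumes K: "bspace S K" and G: "finite_mgraph G" "medges G = {..<6}"
    and P: "graph_space G = {Z. Z \<subseteq> {..<6} \<and> P (0 \<in> Z) (1 \<in> Z) (2 \<in> Z) (3 \<in> Z) (4 \<in> Z) (5 \<in> Z)}"
  shows "isomorphic (space_matroid S K) (cycle_matroid G) \<longleftrightarrow> six_form P S K"
proof -
  have "isomorphic (space_matroid S K) (cycle_matroid G) \<longleftrightarrow>
    (\<exists>f. bij_betw f S {..<6} \<and> K = {Z. Z \<subseteq> S \<and> f ` Z \<in> graph_space G})"
    using isomorphic_space_matroid_iff[OF K bspace_graph_space[OF G(1)]]
    by (simp add: cycle_matroid_eq_space_matroid[OF G(1)] G(2))
  also have "\<dots> \<longleftrightarrow> six_form P S K"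
  proof
    assume "\<exists>f. bij_betw f S {..<6} \<and> K = {Z. Z \<subseteq> S \<and> f ` Z \<in> graph_space G}"
    then obtain f where f: "bij_betw f S {..<6}" and Keq: "K = {Z. Z \<subseteq> S \<and> f ` Z \<in> graph_space G}"
      by blast
    define g where "g = inv_into S f"
    have g: "bij_betw g {..<6} S" unfolding g_def by (rule bij_betw_inv_into[OF f])
    then have "g ` {..<6} = S" "inj_on g {..<6}" by (auto simp: bij_betw_def)
    then have S: "S = {g 0, g 1, g 2, g 3, g 4, g 5}" and d: "distinct [g 0, g 1, g 2, g 3, g 4, g 5]"
      by (auto simp: lessThan_6 inj_on_def)
    have mem: "i \<in> f ` Z \<longleftrightarrow> g i \<in> Z" if "Z \<subseteq> S" "i < 6" for Z i
    proof -
      have "f (g i) = i" "g i \<in> S"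
        using bij_betw_inv_into_right[OF f] bij_betwE[OF g] that(2) by (auto simp: g_def)
      moreover have "inj_on f S" using f by (simp add: bij_betw_def)
      ultimately show ?thesis using inj_on_image_mem_iff[OF \<open>inj_on f S\<close> _ that(1), of "g i"] by simp
    qed
    have sub: "f ` Z \<subseteq> {..<6}" if "Z \<subseteq> S" for Z using f that by (auto simp: bij_betw_def)
    have "K = {Z. Z \<subseteq> S \<and> P (g 0 \<in> Z) (g 1 \<in> Z) (g 2 \<in> Z) (g 3 \<in> Z) (g 4 \<in> Z) (g 5 \<in> Z)}"
      unfolding Keq P using mem sub by (intro Collect_cong) (simp cong: conj_cong)
    then show "six_form P S K" unfolding six_form_def using S d by blast
  next
    assume "six_form P S K"
    then obtain a b c d e f where D: "distinct [a, b, c, d, e, f]" and S: "S = {a, b, c, d, e, f}"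
      and Keq: "K = {Z. Z \<subseteq> S \<and> P (a \<in> Z) (b \<in> Z) (c \<in> Z) (d \<in> Z) (e \<in> Z) (f \<in> Z)}"
      unfolding six_form_def by blast
    define h :: "'a \<Rightarrow> nat" where "h = (\<lambda>x. if x = a then 0 else if x = b then 1 else if x = c then 2
      else if x = d then 3 else if x = e then 4 else 5)"
    have h: "h a = 0" "h b = 1" "h c = 2" "h d = 3" "h e = 4" "h f = 5"
      using D by (auto simp: h_def)
    have inj: "inj_on h S" unfolding S inj_on_def by (auto simp: h)
    moreover have im: "h ` S = {..<6}" unfolding S lessThan_6 by (simp add: h)
    moreover have "h x \<in> h ` Z \<longleftrightarrow> x \<in> Z" if "Z \<subseteq> S" "x \<in> S" for x Z
      using inj_on_image_mem_iff[OF inj that(2,1)] .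
    from this[where x = a] this[where x = b] this[where x = c] this[where x = d] this[where x = e]
      this[where x = f]
    have mem: "0 \<in> h ` Z \<longleftrightarrow> a \<in> Z" "1 \<in> h ` Z \<longleftrightarrow> b \<in> Z" "2 \<in> h ` Z \<longleftrightarrow> c \<in> Z" "3 \<in> h ` Z \<longleftrightarrow> d \<in> Z"
      "4 \<in> h ` Z \<longleftrightarrow> e \<in> Z" "5 \<in> h ` Z \<longleftrightarrow> f \<in> Z" if "Z \<subseteq> S" for Z
      using that unfolding S h by simp_all
    have "K = {Z. Z \<subseteq> S \<and> h ` Z \<in> graph_space G}"
      unfolding Keq P using mem im image_mono[of _ S h]
      by (intro Collect_cong) (simp cong: conj_cong)
    ultimately show "\<exists>f. bij_betw f S {..<6} \<and> K = {Z. Z \<subseteq> S \<and> f ` Z \<in> graph_space G}"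
      unfolding bij_betw_def by blast
  qed
  finally show ?thesis .
qed

section \<open>The cycle spaces of the four graphs\<close>

lemma medges_G: "medges G3 = {..<6}" "medges G4 = {..<6}" "medges G5 = {..<6}" "medges G6 = {..<6}"
  by (simp_all add: G3_def G4_def G5_def G6_def mgraph_of_def)

lemma finite_mgraph_G: "finite_mgraph G3" "finite_mgraph G4" "finite_mgraph G5" "finite_mgraph G6"
  unfolding finite_mgraph_def medges_G lessThan_6
  by (simp_all add: G3_def G4_def G5_def G6_def mgraph_of_def)

lemma sum_subset_lessThan_6:
  fixes h :: "nat \<Rightarrow> bit"
  assumes "Z \<subseteq> {..<6}"
  shows "sum h Z = of_bool (0 \<in> Z) * h 0 + of_bool (1 \<in> Z) * h 1 + of_bool (2 \<in> Z) * h 2 +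
    of_bool (3 \<in> Z) * h 3 + of_bool (4 \<in> Z) * h 4 + of_bool (5 \<in> Z) * h 5"
proof -
  have "sum h Z = (\<Sum>i\<in>{..<6}. of_bool (i \<in> Z) * h i)"
    using assms by (intro sum.mono_neutral_cong_left) auto
  then show ?thesis
    by (simp only: eval_nat_numeral BitM.simps One_nat_def sum.lessThan_Suc lessThan_0 sum.empty add_0)
qed

lemma graph_space_six:
  assumes G: "G = mgraph_of n es" "length es = 6"
    and P: "\<And>a b c d e f. (\<forall>v. of_bool a * inc G v 0 + of_bool b * inc G v 1 + of_bool c * inc G v 2 +
      of_bool d * inc G v 3 + of_bool e * inc G v 4 + of_bool f * inc G v 5 = 0) \<longleftrightarrow> P a b c d e f"
  shows "graph_space G = {Z. Z \<subseteq> {..<6} \<and> P (0 \<in> Z) (1 \<in> Z) (2 \<in> Z) (3 \<in> Z) (4 \<in> Z) (5 \<in> Z)}"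
proof -
  have "medges G = {..<6}" using G by (simp add: mgraph_of_def)
  moreover have "(\<forall>v. sum (inc G v) Z = 0) \<longleftrightarrow>
    P (0 \<in> Z) (1 \<in> Z) (2 \<in> Z) (3 \<in> Z) (4 \<in> Z) (5 \<in> Z)" if "Z \<subseteq> {..<6}" for Z
    unfolding P[symmetric] sum_subset_lessThan_6[OF that] by (rule refl)
  ultimately show ?thesis unfolding graph_space_def by auto
qed

text \<open>Splits off the at most four vertices of the graphs; for larger \<open>v\<close> all
  incidences vanish.\<close>

lemma all_nat_4: "(\<forall>v::nat. Q v) \<longleftrightarrow> Q 0 \<and> Q 1 \<and> Q 2 \<and> Q 3 \<and> (\<forall>v\<ge>4. Q v)"
proof -
  have "v = 0 \<or> v = 1 \<or> v = 2 \<or> v = 3 \<or> 4 \<le> v" for v :: nat by linarith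
  then show ?thesis by metis
qed

lemma graph_space_G3:
  "graph_space G3 = {Z. Z \<subseteq> {..<6} \<and> k4_pred (0 \<in> Z) (1 \<in> Z) (2 \<in> Z) (3 \<in> Z) (4 \<in> Z) (5 \<in> Z)}"
proof (rule graph_space_six[OF G3_def])
  fix a b c d e f
  show "(\<forall>v. of_bool a * inc G3 v 0 + of_bool b * inc G3 v 1 + of_bool c * inc G3 v 2 +
    of_bool d * inc G3 v 3 + of_bool e * inc G3 v 4 + of_bool f * inc G3 v 5 = 0) \<longleftrightarrow> k4_pred a b c d e f"
    by (cases a; cases b; cases c; cases d; cases e; cases f)
      (simp_all add: all_nat_4 inc_def G3_def mgraph_of_def k4_pred_def)
qed simp

lemma graph_space_G4:
  "graph_space G4 = {Z. Z \<subseteq> {..<6} \<and> g4_pred (0 \<in> Z) (1 \<in> Z) (2 \<in> Z) (3 \<in> Z) (4 \<in> Z) (5 \<in> Z)}"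
proof (rule graph_space_six[OF G4_def])
  fix a b c d e f
  show "(\<forall>v. of_bool a * inc G4 v 0 + of_bool b * inc G4 v 1 + of_bool c * inc G4 v 2 +
    of_bool d * inc G4 v 3 + of_bool e * inc G4 v 4 + of_bool f * inc G4 v 5 = 0) \<longleftrightarrow> g4_pred a b c d e f"
    by (cases a; cases b; cases c; cases d; cases e; cases f)
      (simp_all add: all_nat_4 inc_def G4_def mgraph_of_def g4_pred_def)
qed simp

lemma graph_space_G5:
  "graph_space G5 = {Z. Z \<subseteq> {..<6} \<and> g4_pred (0 \<in> Z) (1 \<in> Z) (2 \<in> Z) (3 \<in> Z) (4 \<in> Z) (5 \<in> Z)}"
proof (rule graph_space_six[OF G5_def])
  fix a b c d e f
  show "(\<forall>v. of_bool a * inc G5 v 0 + of_bool b * inc G5 v 1 + of_bool c * inc G5 v 2 +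
    of_bool d * inc G5 v 3 + of_bool e * inc G5 v 4 + of_bool f * inc G5 v 5 = 0) \<longleftrightarrow> g4_pred a b c d e f"
    by (cases a; cases b; cases c; cases d; cases e; cases f)
      (simp_all add: all_nat_4 inc_def G5_def mgraph_of_def g4_pred_def)
qed simp

lemma graph_space_G6:
  "graph_space G6 = {Z. Z \<subseteq> {..<6} \<and> g6_pred (0 \<in> Z) (1 \<in> Z) (2 \<in> Z) (3 \<in> Z) (4 \<in> Z) (5 \<in> Z)}"
proof (rule graph_space_six[OF G6_def])
  fix a b c d e f
  show "(\<forall>v. of_bool a * inc G6 v 0 + of_bool b * inc G6 v 1 + of_bool c * inc G6 v 2 +
    of_bool d * inc G6 v 3 + of_bool e * inc G6 v 4 + of_bool f * inc G6 v 5 = 0) \<longleftrightarrow> g6_pred a b c d e f"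
    by (cases a; cases b; cases c; cases d; cases e; cases f)
      (simp_all add: all_nat_4 inc_def G6_def mgraph_of_def g6_pred_def)
qed simp

lemmas isomorphic_G =
  isomorphic_cycle_matroid_iff_six_form[OF _ finite_mgraph_G(1) medges_G(1) graph_space_G3]
  isomorphic_cycle_matroid_iff_six_form[OF _ finite_mgraph_G(2) medges_G(2) graph_space_G4]
  isomorphic_cycle_matroid_iff_six_form[OF _ finite_mgraph_G(3) medges_G(3) graph_space_G5]
  isomorphic_cycle_matroid_iff_six_form[OF _ finite_mgraph_G(4) medges_G(4) graph_space_G6]

text \<open>Removing \<open>C\<close> does not change the intersection with a set disjoint from
  \<open>C\<close>, so splitting commutes with such minors. If \<open>X\<close> meets
  \<open>C\<close>, the even and the odd lifts of one projected set may both occur.\<close>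

lemma minor_space_even_on:
  assumes "X \<inter> C = {}"
  shows "minor_space (even_on X K) C S = even_on X (minor_space K C S)"
proof -
  have "(Z - C) \<inter> X = Z \<inter> X" for Z using assms by auto
  then show ?thesis unfolding minor_space_def even_on_def by auto
qed

lemma even_card_Int_triple:
  assumes "distinct [a, b, c]"
  shows "even (card (Z \<inter> {a, b, c})) \<longleftrightarrow> (((a \<in> Z) \<noteq> (b \<in> Z)) = (c \<in> Z))"
  using assms by (cases "a \<in> Z"; cases "b \<in> Z"; cases "c \<in> Z") (simp_all add: Int_insert_right)

text \<open>The cycle space of a minor of \<open>B\<close> contains that of the corresponding minor of \<open>B\<^sub>X\<close> with index
  at most two. The seven nontrivial cosets of the cycle space of \<open>K\<^sub>4\<close> are the sets of \<open>T\<close>-joins: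
  \<open>|T| = 2\<close> turns an edge of \<open>K\<^sub>4\<close> into a loop, \<open>|T| = 4\<close> makes opposite edges parallel.\<close>

lemma six_form_of_splitting:
  assumes K: "bspace E K" and S: "S \<subseteq> E" and F: "six_form k4_pred S (minor_space (even_on X K) C S)"
  shows "\<exists>P\<in>{k4_pred, g4_pred, g6_pred}. six_form P S (minor_space K C S)"
proof (cases "minor_space K C S = minor_space (even_on X K) C S")
  case True
  then show ?thesis using F by auto
next
  case False
  let ?N = "minor_space K C S" and ?L = "minor_space (even_on X K) C S"
  have M: "bspace S ?N" by (rule bspace_minor_space[OF K S])
  have sub: "?L \<subseteq> ?N" by (auto simp: minor_space_def even_on_def)
  \<comment> \<open>Two members of \<open>K\<close> that meet \<open>X\<close> oddly have a sum that
    meets it evenly; hence the index is at most two.\<close>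
  have sum: "sym_diff Y Z \<in> ?L" if "Y \<in> ?N - ?L" "Z \<in> ?N - ?L" for Y Z
  proof -
    from that obtain Y' Z' where Y': "Y' \<in> K" "Y' \<subseteq> C \<union> S" "Y = Y' - C"
      and Z': "Z' \<in> K" "Z' \<subseteq> C \<union> S" "Z = Z' - C" by (auto simp: minor_space_def)
    have odd: "odd (card (Y' \<inter> X))" "odd (card (Z' \<inter> X))"
      using that Y' Z' by (auto simp: minor_space_def even_on_def)
    have "finite Y'" "finite Z'"
      using Y'(1) Z'(1) K by (meson bspaceD(1,3) finite_subset)+
    then have "even (card (sym_diff Y' Z' \<inter> X))" using odd by (simp add: even_card_sym_diff)
    moreover have "sym_diff Y' Z' \<in> K" by (rule bspaceD(4)[OF K Y'(1) Z'(1)])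
    ultimately have "sym_diff Y' Z' \<in> even_on X K" by (simp add: even_on_def)
    moreover have "sym_diff Y' Z' \<subseteq> C \<union> S" using Y'(2) Z'(2) by auto
    ultimately have "sym_diff Y' Z' - C \<in> ?L" unfolding minor_space_def by blast
    moreover have "sym_diff Y' Z' - C = sym_diff Y Z" using Y'(3) Z'(3) by auto
    ultimately show ?thesis by simp
  qed
  obtain W where W: "W \<in> ?N - ?L" using False sub by blast
  have WS: "W \<subseteq> S" using bspaceD(3)[OF M] W by blast
  have Meq: "Z \<in> ?N \<longleftrightarrow> Z \<in> ?L \<or> sym_diff Z W \<in> ?L" for Z
  proof
    assume "Z \<in> ?N"
    then show "Z \<in> ?L \<or> sym_diff Z W \<in> ?L" using sum[OF _ W] by blast
  next
    assume "Z \<in> ?L \<or> sym_diff Z W \<in> ?L"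
    then show "Z \<in> ?N"
    proof
      assume "sym_diff Z W \<in> ?L"
      then have "sym_diff (sym_diff Z W) W \<in> ?N" using sub W by (intro bspaceD(4)[OF M, of "sym_diff Z W"]) auto
      moreover have "sym_diff (sym_diff Z W) W = Z" by auto
      ultimately show ?thesis by simp
    qed (use sub in auto)
  qed
  obtain a b c d e f where D: "distinct [a, b, c, d, e, f]" and Seq: "S = {a, b, c, d, e, f}"
    and M0: "?L = {Z. Z \<subseteq> S \<and> k4_pred (a \<in> Z) (b \<in> Z) (c \<in> Z) (d \<in> Z) (e \<in> Z) (f \<in> Z)}"
    using F unfolding six_form_def by blast
  \<comment> \<open>\<open>R\<close> records which of the three parity checks in
    \<open>k4_pred\<close> a set passes. The eight triples label the cosets of the cycle space of
    K4, and \<open>True True True\<close> is the space itself.\<close>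
  define R where "R Z s1 s2 s3 \<longleftrightarrow> (((a \<in> Z) \<noteq> (b \<in> Z)) = (c \<in> Z)) = s1 \<and>
    (((a \<in> Z) \<noteq> (d \<in> Z)) = (e \<in> Z)) = s2 \<and> (((b \<in> Z) \<noteq> (d \<in> Z)) = (f \<in> Z)) = s3" for Z s1 s2 s3
  obtain s1 s2 s3 where s: "R W s1 s2 s3" unfolding R_def by blast
  have M1: "?N = {Z. Z \<subseteq> S \<and> (R Z True True True \<or> R Z s1 s2 s3)}"
  proof (rule set_eqI)
    fix Z
    have "k4_pred (a \<in> sym_diff Z W) (b \<in> sym_diff Z W) (c \<in> sym_diff Z W) (d \<in> sym_diff Z W)
       (e \<in> sym_diff Z W) (f \<in> sym_diff Z W) \<longleftrightarrow> R Z s1 s2 s3"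
      using s unfolding k4_pred_def R_def by (simp only: Un_iff Diff_iff) argo
    moreover have "sym_diff Z W \<subseteq> S \<longleftrightarrow> Z \<subseteq> S" using WS by auto
    moreover have "k4_pred (a \<in> Z) (b \<in> Z) (c \<in> Z) (d \<in> Z) (e \<in> Z) (f \<in> Z) \<longleftrightarrow> R Z True True True"
      unfolding k4_pred_def R_def by simp
    ultimately show "Z \<in> ?N \<longleftrightarrow> Z \<in> {Z. Z \<subseteq> S \<and> (R Z True True True \<or> R Z s1 s2 s3)}"
      unfolding Meq unfolding M0 by blast
  qed
  have ns: "\<not> (s1 \<and> s2 \<and> s3)" using W s WS unfolding M0 R_def k4_pred_def by auto
  have form: "six_form P S ?N"
    if "distinct [a', b', c', d', e', f']" "{a', b', c', d', e', f'} = S"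
      "\<And>Z. P (a' \<in> Z) (b' \<in> Z) (c' \<in> Z) (d' \<in> Z) (e' \<in> Z) (f' \<in> Z) \<longleftrightarrow> R Z True True True \<or> R Z s1 s2 s3"
    for P a' b' c' d' e' f'
    unfolding six_form_def M1
    by (rule exI[of _ a'], rule exI[of _ b'], rule exI[of _ c'], rule exI[of _ d'], rule exI[of _ e'],
      rule exI[of _ f']) (use that in simp)
  note defs = g4_pred_def g6_pred_def R_def
  \<comment> \<open>The triads of K4 are abc, ade, bdf and cef; the last check fails if an odd
    number of the others fail. If exactly two fail, the edge common to both triads becomes the loop
    and stands last in the list. If all four fail, the opposite pairs af, be and cd become
    parallel.\<close>
  consider "\<not> s1" "\<not> s2" "s3" | "\<not> s1" "s2" "\<not> s3" | "\<not> s1" "s2" "s3" | "s1" "\<not> s2" "\<not> s3"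
    | "s1" "\<not> s2" "s3" | "s1" "s2" "\<not> s3" | "\<not> s1" "\<not> s2" "\<not> s3"
    using ns by blast
  then show ?thesis
  proof cases
    case 1
    have "six_form g4_pred S ?N" by (rule form[of b d c e f a]) (use D Seq 1 in \<open>auto simp: defs\<close>)
    then show ?thesis by simp
  next
    case 2
    have "six_form g4_pred S ?N" by (rule form[of a d c f e b]) (use D Seq 2 in \<open>auto simp: defs\<close>)
    then show ?thesis by simp
  next
    case 3
    have "six_form g4_pred S ?N" by (rule form[of a e b f d c]) (use D Seq 3 in \<open>auto simp: defs\<close>)
    then show ?thesis by simp
  next
    case 4
    have "six_form g4_pred S ?N" by (rule form[of a b e f c d]) (use D Seq 4 in \<open>auto simp: defs\<close>)
    then show ?thesis by simp
  next
    case 5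
    have "six_form g4_pred S ?N" by (rule form[of a c d f b e]) (use D Seq 5 in \<open>auto simp: defs\<close>)
    then show ?thesis by simp
  next
    case 6
    have "six_form g4_pred S ?N" by (rule form[of b c d e a f]) (use D Seq 6 in \<open>auto simp: defs\<close>)
    then show ?thesis by simp
  next
    case 7
    have "six_form g6_pred S ?N" by (rule form[of a f b e c d]) (use D Seq 7 in \<open>auto simp: defs\<close>)
    then show ?thesis by simp
  qed
qed

lemma six_form_even_on:
  assumes P: "P \<in> {k4_pred, g4_pred, g6_pred}" and F: "six_form P S M"
  shows "\<exists>X\<subseteq>S. card X = 3 \<and> six_form k4_pred S (even_on X M)"
proof -
  obtain a b c d e f where D: "distinct [a, b, c, d, e, f]" and S: "S = {a, b, c, d, e, f}"
    and M: "M = {Z. Z \<subseteq> S \<and> P (a \<in> Z) (b \<in> Z) (c \<in> Z) (d \<in> Z) (e \<in> Z) (f \<in> Z)}"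
    using F unfolding six_form_def by blast
  have form: ?thesis
    if "distinct [a', b', c', d', e', f']" "{a', b', c', d', e', f'} = S"
      "distinct [x, y, z]" "{x, y, z} \<subseteq> S"
      "\<And>Z. k4_pred (a' \<in> Z) (b' \<in> Z) (c' \<in> Z) (d' \<in> Z) (e' \<in> Z) (f' \<in> Z) \<longleftrightarrow>
        P (a \<in> Z) (b \<in> Z) (c \<in> Z) (d \<in> Z) (e \<in> Z) (f \<in> Z) \<and> (((x \<in> Z) \<noteq> (y \<in> Z)) = (z \<in> Z))"
    for a' b' c' d' e' f' x y z
  proof (intro exI conjI)
    show "{x, y, z} \<subseteq> S" by fact
    show "card {x, y, z} = 3" using that(3) by simp
    have eq: "even_on {x, y, z} M =
      {Z. Z \<subseteq> S \<and> k4_pred (a' \<in> Z) (b' \<in> Z) (c' \<in> Z) (d' \<in> Z) (e' \<in> Z) (f' \<in> Z)}"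
      unfolding even_on_def M even_card_Int_triple[OF that(3)] that(5) by auto
    show "six_form k4_pred S (even_on {x, y, z} M)" unfolding six_form_def
      by (rule exI[of _ a'], rule exI[of _ b'], rule exI[of _ c'], rule exI[of _ d'], rule exI[of _ e'],
        rule exI[of _ f']) (use that(1,2) eq in simp)
  qed
  from P consider "P = k4_pred" | "P = g4_pred" | "P = g6_pred" by blast
  then show ?thesis
  proof cases
    case 1
    show ?thesis by (rule form[of a b c d e f a b c]) (use D S in \<open>auto simp: 1 k4_pred_def\<close>)
  next
    case 2
    \<comment> \<open>In \<open>G4\<close> this choice of \<open>X\<close> splits the vertex
      \<open>t\<close>: one edge of each parallel pair moves to a new vertex, and the loop becomes
      the edge between the two halves.\<close>
    show ?thesis by (rule form[of a e b c f d a c f]) (use D S in \<open>auto simp: 2 k4_pred_def g4_pred_def\<close>)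
  next
    case 3
    \<comment> \<open>\<open>X\<close> takes one edge from each parallel pair of \<open>G6\<close>.
      Its sums with the vertex stars are the other three triads, and the former parallel pairs are
      the opposite edges.\<close>
    show ?thesis by (rule form[of a c e f d b a c e]) (use D S in \<open>auto simp: 3 k4_pred_def g6_pred_def\<close>)
  qed
qed

section \<open>Series-parallel reductions\<close>

text \<open>Cycle space and cocycle space, each the orthogonal complement of the other. Carrying
  both makes contraction the dual of deletion, so that one proof serves both operations and both
  kinds of small sets.\<close>

definition dual_pair :: "'a set \<Rightarrow> 'a set set \<Rightarrow> 'a set set \<Rightarrow> bool" where
  "dual_pair E K L \<longleftrightarrow> finite E \<and> K \<subseteq> Pow E \<and> L \<subseteq> Pow E \<and>
     (\<forall>Z\<in>K. \<forall>Y\<in>L. even (card (Z \<inter> Y))) \<and>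
     (\<forall>Z\<subseteq>E. (\<forall>Y\<in>L. even (card (Z \<inter> Y))) \<longrightarrow> Z \<in> K) \<and>
     (\<forall>Y\<subseteq>E. (\<forall>Z\<in>K. even (card (Z \<inter> Y))) \<longrightarrow> Y \<in> L)"

text \<open>On the cycle space \<open>avoiding\<close> is deletion of \<open>f\<close> and
  \<open>removing\<close> is contraction; on the cocycle space the roles are exchanged.\<close>

definition avoiding :: "'a \<Rightarrow> 'a set set \<Rightarrow> 'a set set" where
  "avoiding f K = {Z \<in> K. f \<notin> Z}"

definition removing :: "'a \<Rightarrow> 'a set set \<Rightarrow> 'a set set" where
  "removing f K = (\<lambda>Z. Z - {f}) ` K"

lemma dual_pairD:
  assumes "dual_pair E K L"
  shows "finite E" "Z \<in> K \<Longrightarrow> Z \<subseteq> E" "Y \<in> L \<Longrightarrow> Y \<subseteq> E" "Z \<in> K \<Longrightarrow> Y \<in> L \<Longrightarrow> even (card (Z \<inter> Y))"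
    "Z \<subseteq> E \<Longrightarrow> (\<And>Y. Y \<in> L \<Longrightarrow> even (card (Z \<inter> Y))) \<Longrightarrow> Z \<in> K"
    "Y \<subseteq> E \<Longrightarrow> (\<And>Z. Z \<in> K \<Longrightarrow> even (card (Z \<inter> Y))) \<Longrightarrow> Y \<in> L"
proof -
  note D = assms[unfolded dual_pair_def]
  show "finite E" using D by (rule conjunct1)
  show "Z \<in> K \<Longrightarrow> Z \<subseteq> E" using D[THEN conjunct2, THEN conjunct1] by auto
  show "Y \<in> L \<Longrightarrow> Y \<subseteq> E" using D[THEN conjunct2, THEN conjunct2, THEN conjunct1] by auto
  show "Z \<in> K \<Longrightarrow> Y \<in> L \<Longrightarrow> even (card (Z \<inter> Y))"
    using D[THEN conjunct2, THEN conjunct2, THEN conjunct2, THEN conjunct1] by simp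
  show "Z \<subseteq> E \<Longrightarrow> (\<And>Y. Y \<in> L \<Longrightarrow> even (card (Z \<inter> Y))) \<Longrightarrow> Z \<in> K"
    using D[THEN conjunct2, THEN conjunct2, THEN conjunct2, THEN conjunct2, THEN conjunct1] by simp
  show "Y \<subseteq> E \<Longrightarrow> (\<And>Z. Z \<in> K \<Longrightarrow> even (card (Z \<inter> Y))) \<Longrightarrow> Y \<in> L"
    using D[THEN conjunct2, THEN conjunct2, THEN conjunct2, THEN conjunct2, THEN conjunct2] by simp
qed

lemma dual_pair_sym:
  assumes D: "dual_pair E K L"
  shows "dual_pair E L K"
  unfolding dual_pair_def
proof (intro conjI allI ballI impI)
  show "even (card (Z \<inter> Y))" if "Z \<in> L" "Y \<in> K" for Z Y
    using dual_pairD(4)[OF D that(2,1)] by (simp add: Int_commute)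
  show "Z \<in> L" if "Z \<subseteq> E" "\<forall>Y\<in>K. even (card (Z \<inter> Y))" for Z
    by (rule dual_pairD(6)[OF D that(1)]) (use that(2) in \<open>simp add: Int_commute\<close>)
  show "Y \<in> K" if "Y \<subseteq> E" "\<forall>Z\<in>L. even (card (Z \<inter> Y))" for Y
    by (rule dual_pairD(5)[OF D that(1)]) (use that(2) in \<open>simp add: Int_commute\<close>)
  show "finite E" by (rule dual_pairD(1)[OF D])
  show "L \<subseteq> Pow E" "K \<subseteq> Pow E" using dual_pairD(2,3)[OF D] by blast+
qed

lemma dual_pair_bspace:
  assumes D: "dual_pair E K L"
  shows "bspace E K"
proof -
  have "sym_diff Y Z \<in> K" if YZ: "Y \<in> K" "Z \<in> K" for Y Z
  proof (rule dual_pairD(5)[OF D])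
    have sub: "Y \<subseteq> E" "Z \<subseteq> E" using YZ dual_pairD(2)[OF D] by blast+
    then show "sym_diff Y Z \<subseteq> E" by auto
    have fin: "finite Y" "finite Z" using sub dual_pairD(1)[OF D] finite_subset by blast+
    show "even (card (sym_diff Y Z \<inter> X))" if "X \<in> L" for X
      unfolding even_card_sym_diff[OF fin] using dual_pairD(4)[OF D] YZ that by simp
  qed
  moreover have "{} \<in> K" by (rule dual_pairD(5)[OF D]) auto
  moreover have "K \<subseteq> Pow E" using dual_pairD(2)[OF D] by auto
  ultimately show ?thesis using dual_pairD(1)[OF D] unfolding bspace_def by blast
qed

text \<open>The point is that a set \<open>Y\<close> orthogonal to all members avoiding
  \<open>f\<close> comes from \<open>L\<close>. If \<open>Y\<close> itself fails on some member,
  that member contains \<open>f\<close>; any two members through \<open>f\<close> differ by one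
  avoiding \<open>f\<close>, so \<open>Y\<close> fails on all of them and \<open>insert f Y\<close>
  on none.\<close>

lemma dual_pair_delete:
  assumes D: "dual_pair E K L" and "f \<in> E"
  shows "dual_pair (E - {f}) (avoiding f K) (removing f L)"
  unfolding dual_pair_def
proof (intro conjI allI ballI impI)
  show "finite (E - {f})" using dual_pairD(1)[OF D] by simp
  show "avoiding f K \<subseteq> Pow (E - {f})" "removing f L \<subseteq> Pow (E - {f})"
    using dual_pairD(2,3)[OF D] unfolding avoiding_def removing_def by blast+
  have Int: "Z \<inter> (Y - {f}) = Z \<inter> Y" if "f \<notin> Z" for Z Y using that by auto
  show "even (card (Z \<inter> Y))" if "Z \<in> avoiding f K" "Y \<in> removing f L" for Z Y
    using that dual_pairD(4)[OF D] Int unfolding avoiding_def removing_def by auto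
  show "Z \<in> avoiding f K" if Z: "Z \<subseteq> E - {f}" "\<forall>Y\<in>removing f L. even (card (Z \<inter> Y))" for Z
  proof -
    have "f \<notin> Z" using Z(1) by auto
    then have "even (card (Z \<inter> Y))" if "Y \<in> L" for Y using Z(2) Int[of Z Y] that by (auto simp: removing_def)
    then have "Z \<in> K" using Z(1) by (intro dual_pairD(5)[OF D]) auto
    then show ?thesis using \<open>f \<notin> Z\<close> by (simp add: avoiding_def)
  qed
  show "Y \<in> removing f L" if Y': "Y \<subseteq> E - {f}" "\<forall>Z\<in>avoiding f K. even (card (Z \<inter> Y))" for Y
  proof (cases "Y \<in> L")
    case True
    then show ?thesis using Y'(1) unfolding removing_def by (intro image_eqI[of _ _ Y]) auto
  next
    case False
    have Y: "Y \<subseteq> E" "f \<notin> Y" and ev: "\<And>Z. Z \<in> K \<Longrightarrow> f \<notin> Z \<Longrightarrow> even (card (Z \<inter> Y))"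
      using Y' by (auto simp: avoiding_def)
    obtain Z0 where Z0: "Z0 \<in> K" "odd (card (Z0 \<inter> Y))" using dual_pairD(6)[OF D Y(1)] False by blast
    then have fZ0: "f \<in> Z0" using ev by blast
    have "even (card (Z \<inter> insert f Y))" if Z: "Z \<in> K" for Z
    proof (cases "f \<in> Z")
      case True
      have fins: "finite Z" "finite Z0" using Z Z0(1) dual_pairD(1,2)[OF D] finite_subset by blast+
      have "sym_diff Z Z0 \<in> K" by (rule bspaceD(4)[OF dual_pair_bspace[OF D] Z Z0(1)])
      then have "even (card (sym_diff Z Z0 \<inter> Y))" by (rule ev) (use True fZ0 in auto)
      then have "odd (card (Z \<inter> Y))" using Z0(2) even_card_sym_diff[OF fins] by blast
      moreover have "Z \<inter> insert f Y = insert f (Z \<inter> Y)" using True by auto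
      ultimately show ?thesis using Y(2) fins by simp
    next
      case False
      then show ?thesis using ev[OF Z] by simp
    qed
    then have "insert f Y \<in> L" using Y(1) \<open>f \<in> E\<close> by (intro dual_pairD(6)[OF D]) auto
    then show ?thesis using Y(2) unfolding removing_def by (intro image_eqI[of _ _ "insert f Y"]) auto
  qed
qed

lemma dual_pair_contract:
  assumes "dual_pair E K L" and "f \<in> E"
  shows "dual_pair (E - {f}) (removing f K) (avoiding f L)"
  using dual_pair_sym[OF dual_pair_delete[OF dual_pair_sym[OF assms(1)] assms(2)]] .

section \<open>Minors M(K4) and cycles or cocycles of size at most two\<close>

definition has_k4 :: "'a set \<Rightarrow> 'a set set \<Rightarrow> bool" where
  "has_k4 E K \<longleftrightarrow> (\<exists>C S. C \<subseteq> E \<and> S \<subseteq> E \<and> C \<inter> S = {} \<and> six_form k4_pred S (minor_space K C S))"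

lemma has_k4_avoiding:
  assumes "has_k4 (E - {f}) (avoiding f K)"
  shows "has_k4 E K"
proof -
  obtain C S where CS: "C \<subseteq> E - {f}" "S \<subseteq> E - {f}" "C \<inter> S = {}"
    "six_form k4_pred S (minor_space (avoiding f K) C S)"
    using assms unfolding has_k4_def by (elim exE conjE) (rule that)
  have "minor_space (avoiding f K) C S = minor_space K C S"
    using CS(1,2) by (auto simp: minor_space_def avoiding_def)
  then show ?thesis using CS unfolding has_k4_def by (intro exI[of _ C] exI[of _ S]) auto
qed

lemma has_k4_removing:
  assumes "f \<in> E" "has_k4 (E - {f}) (removing f K)"
  shows "has_k4 E K"
proof -
  obtain C S where CS: "C \<subseteq> E - {f}" "S \<subseteq> E - {f}" "C \<inter> S = {}"
    "six_form k4_pred S (minor_space (removing f K) C S)"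
    using assms(2) unfolding has_k4_def by (elim exE conjE) (rule that)
  have "Z - {f} - C = Z - insert f C" "Z - {f} \<subseteq> C \<union> S \<longleftrightarrow> Z \<subseteq> insert f C \<union> S" for Z by auto
  moreover have "minor_space (removing f K) C S = {Z - {f} - C |Z. Z \<in> K \<and> Z - {f} \<subseteq> C \<union> S}"
    unfolding minor_space_def removing_def by blast
  ultimately have "minor_space (removing f K) C S = minor_space K (insert f C) S"
    unfolding minor_space_def by simp
  then show ?thesis
    using CS assms(1) unfolding has_k4_def by (intro exI[of _ "insert f C"] exI[of _ S]) auto
qed

text \<open>A loop, coloop, parallel pair or series pair away from \<open>e\<close>. The prescribed
  element gives control over the triads and triangles that appear when a deleted or contracted
  element is restored.\<close>

definition small_avoiding :: "'a set set \<Rightarrow> 'a set set \<Rightarrow> 'a \<Rightarrow> bool" where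
  "small_avoiding K L e \<longleftrightarrow> (\<exists>R. R \<noteq> {} \<and> finite R \<and> card R \<le> 2 \<and> e \<notin> R \<and> (R \<in> K \<or> R \<in> L))"

lemma small_avoiding_sym: "small_avoiding K L e \<longleftrightarrow> small_avoiding L K e"
  unfolding small_avoiding_def by metis

lemma small_avoidingI: "R \<in> K \<or> R \<in> L \<Longrightarrow> R \<noteq> {} \<Longrightarrow> finite R \<Longrightarrow> card R \<le> 2 \<Longrightarrow> e \<notin> R \<Longrightarrow> small_avoiding K L e"
  unfolding small_avoiding_def by (intro exI[of _ R]) simp

text \<open>Restoring \<open>f\<close> leaves the cycles that avoid it untouched and enlarges a
  cocycle at most by \<open>f\<close>. A small cocycle that stops being small has therefore become a
  triad through \<open>f\<close>.\<close>

lemma small_avoiding_delete_imp: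
  assumes "small_avoiding (avoiding f K) (removing f L) g" "g \<noteq> f"
  shows "small_avoiding K L g \<or> (\<exists>T\<in>L. f \<in> T \<and> g \<notin> T \<and> card T = 3)"
proof -
  obtain R where R: "R \<noteq> {}" "finite R" "card R \<le> 2" "g \<notin> R" "R \<in> avoiding f K \<or> R \<in> removing f L"
    using assms(1) unfolding small_avoiding_def by (elim exE conjE) (rule that)
  show ?thesis
  proof (cases "R \<in> K \<or> R \<in> L")
    case True
    then show ?thesis using small_avoidingI[OF True R(1-4)] by simp
  next
    case False
    then obtain Y where Y: "Y \<in> L" "R = Y - {f}" using R(5) by (auto simp: removing_def avoiding_def)
    then have fY: "f \<in> Y" using False by auto
    then have Yeq: "Y = insert f R" and "f \<notin> R" using Y(2) by auto
    then have c: "finite Y" "card Y = Suc (card R)" "g \<notin> Y" using R(2,4) assms(2) by auto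
    show ?thesis
    proof (cases "card R = 2")
      case True
      then show ?thesis using Y(1) fY c by auto
    next
      case False
      then have "card Y \<le> 2" using c(2) R(3) by simp
      then have "small_avoiding K L g" using Y(1) fY c by (intro small_avoidingI[of Y]) auto
      then show ?thesis ..
    qed
  qed
qed

text \<open>A cocycle through \<open>e\<close> that misses \<open>x\<close> would meet the cycle
  \<open>R\<close> in \<open>e\<close> alone, against orthogonality. So deleting \<open>e\<close>
  creates no new small cocycle away from \<open>x\<close>.\<close>

lemma small_avoiding_delete_loop_imp:
  assumes D: "dual_pair E K L" and R: "R \<in> K" "e \<in> R" "R \<subseteq> {e, x}"
    and sm: "small_avoiding (avoiding e K) (removing e L) x"
  shows "small_avoiding K L e"
proof -
  obtain Q where Q: "Q \<noteq> {}" "finite Q" "card Q \<le> 2" "x \<notin> Q" "Q \<in> avoiding e K \<or> Q \<in> removing e L"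
    using sm unfolding small_avoiding_def by (elim exE conjE) (rule that)
  from Q(5) show ?thesis
  proof
    assume "Q \<in> avoiding e K"
    then show ?thesis using Q(1-4) by (intro small_avoidingI[of Q]) (auto simp: avoiding_def)
  next
    assume "Q \<in> removing e L"
    then obtain Y where Y: "Y \<in> L" "Q = Y - {e}" by (auto simp: removing_def)
    have "e \<notin> Y"
    proof
      assume "e \<in> Y"
      then have "R \<inter> Y = {e}" using R Q(4) Y(2) by auto
      then show False using dual_pairD(4)[OF D R(1) Y(1)] by simp
    qed
    then have "Q = Y" "e \<notin> Q" using Y by auto
    then show ?thesis using Q(1-4) Y(1) by (intro small_avoidingI[of Q]) auto
  qed
qed

text \<open>If no nonempty subset of \<open>{a, b}\<close> lies in \<open>K\<close> or
  \<open>L\<close>, each such subset is met oddly by a cocycle through \<open>e\<close>. Two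
  cocycles through \<open>e\<close> differ by a subset of \<open>{a, b}\<close>, so there is just
  one. It must contain both \<open>a\<close> and \<open>b\<close> and yet meet \<open>{a, b}\<close>
  oddly.\<close>

lemma small_avoiding_three:
  assumes D: "dual_pair {e, a, b} K L" and ne: "a \<noteq> e" "b \<noteq> e" "a \<noteq> b"
  shows "small_avoiding K L e"
proof (rule ccontr)
  assume no: "\<not> small_avoiding K L e"
  have ex: "\<exists>Y\<in>L. odd (card (R \<inter> Y)) \<and> e \<in> Y" if R: "R \<subseteq> {a, b}" "R \<noteq> {}" for R
  proof -
    have fin: "finite R" "card R \<le> 2" using R finite_subset card_mono[of "{a, b}" R] ne by auto
    have "e \<notin> R" using R(1) ne by auto
    then have "R \<notin> K" using no R fin small_avoidingI[of R K L e] by auto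
    then obtain Y where Y: "Y \<in> L" "odd (card (R \<inter> Y))" using dual_pairD(5)[OF D, of R] R by blast
    have "e \<in> Y"
    proof (rule ccontr)
      assume "e \<notin> Y"
      moreover have "Y \<subseteq> {e, a, b}" using dual_pairD(3)[OF D Y(1)] .
      ultimately have "Y \<subseteq> {a, b}" by auto
      moreover have "Y \<noteq> {}" using Y(2) by auto
      moreover have "finite Y" "card Y \<le> 2"
        using \<open>Y \<subseteq> {a, b}\<close> finite_subset card_mono[of "{a, b}" Y] ne by auto
      ultimately show False using no Y(1) \<open>e \<notin> Y\<close> small_avoidingI[of Y K L e] by auto
    qed
    then show ?thesis using Y by blast
  qed
  have uniq: "Y = Y'" if "Y \<in> L" "Y' \<in> L" "e \<in> Y" "e \<in> Y'" for Y Y'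
  proof (rule ccontr)
    assume "Y \<noteq> Y'"
    have s: "Y \<subseteq> {e, a, b}" "Y' \<subseteq> {e, a, b}" using dual_pairD(3)[OF D] that by blast+
    have "sym_diff Y Y' \<in> L"
      using that by (intro bspaceD(4)[OF dual_pair_bspace[OF dual_pair_sym[OF D]]])
    moreover have "sym_diff Y Y' \<subseteq> {a, b}" using s that by auto
    then have "finite (sym_diff Y Y')" "card (sym_diff Y Y') \<le> 2"
      using card_mono[of "{a, b}" "sym_diff Y Y'"] ne finite_subset[of _ "{a, b}"] by auto
    moreover have "sym_diff Y Y' \<noteq> {}" using \<open>Y \<noteq> Y'\<close> by auto
    moreover have "e \<notin> sym_diff Y Y'" using that by auto
    ultimately show False using no small_avoidingI[of "sym_diff Y Y'" K L e] by blast
  qed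
  obtain Y where Y: "Y \<in> L" "odd (card ({a, b} \<inter> Y))" "e \<in> Y" using ex[of "{a, b}"] by blast
  have "x \<in> Y" if xab: "x \<in> {a, b}" for x
  proof -
    obtain Y' where "Y' \<in> L" "odd (card ({x} \<inter> Y'))" "e \<in> Y'" using ex[of "{x}"] xab by blast
    moreover from this have "x \<in> Y'" by (cases "x \<in> Y'") auto
    ultimately show ?thesis using uniq[of Y' Y] Y by blast
  qed
  then have "{a, b} \<inter> Y = {a, b}" by auto
  then show False using Y(2) ne by simp
qed

text \<open>The restriction consists of two triads through \<open>f\<close>, the two triangles through \<open>f\<close> that meet them
  in pairs, and the third element of a triad that avoids \<open>f\<close>.\<close>

lemma k4_restriction:
  assumes D: "dual_pair E K L" and E: "f \<in> E" "g0 \<in> E" "f \<noteq> g0"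
    and big: "\<And>R. R \<in> K \<or> R \<in> L \<Longrightarrow> R \<noteq> {} \<Longrightarrow> 3 \<le> card R"
    and tri: "\<And>f g. f \<in> E \<Longrightarrow> g \<in> E \<Longrightarrow> f \<noteq> g \<Longrightarrow> \<exists>T\<in>K. f \<in> T \<and> g \<notin> T \<and> card T = 3"
    and trd: "\<And>f g. f \<in> E \<Longrightarrow> g \<in> E \<Longrightarrow> f \<noteq> g \<Longrightarrow> \<exists>T\<in>L. f \<in> T \<and> g \<notin> T \<and> card T = 3"
  shows "\<exists>S\<subseteq>E. six_form k4_pred S (minor_space K {} S)"
proof -
  have KE: "Z \<subseteq> E" if "Z \<in> K \<or> Z \<in> L" for Z
    using that dual_pairD(2)[OF D] dual_pairD(3)[OF D] by blast
  have orth: "((x \<in> Z) \<noteq> (y \<in> Z)) = (z \<in> Z)" if "Z \<in> K" "{x, y, z} \<in> L" "distinct [x, y, z]" for x y z Z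
    using dual_pairD(4)[OF D that(1,2)] even_card_Int_triple[OF that(3)] by blast
  have orth': "((x \<in> Z) \<noteq> (y \<in> Z)) = (z \<in> Z)" if "Z \<in> L" "{x, y, z} \<in> K" "distinct [x, y, z]" for x y z Z
    using dual_pairD(4)[OF dual_pair_sym[OF D] that(1,2)] even_card_Int_triple[OF that(3)] by blast
  have three: "\<exists>x y. T = {f, x, y} \<and> distinct [f, x, y]" if "f \<in> T" "card T = 3" for f and T :: "'a set"
  proof -
    have "card (T - {f}) = 2" using that by (simp add: card_Diff_singleton)
    then obtain x y where xy: "T - {f} = {x, y}" "x \<noteq> y" by (meson card_2_iff)
    then have "T = {f, x, y}" using insert_Diff[OF that(1)] by simp
    moreover have "f \<notin> {x, y}" using xy(1) by blast
    ultimately show ?thesis using xy(2) by (intro exI[of _ x] exI[of _ y]) simp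
  qed
  have pick: "\<exists>x. {u, v, x} \<in> M \<and> distinct [u, v, x] \<and> x \<in> {p, q}"
    if "{u, p, q} \<in> M" "distinct [u, p, q]" "v \<in> {p, q}" for u v p q and M :: "'a set set"
  proof (cases "v = p")
    case True
    then show ?thesis using that by (intro exI[of _ q]) simp
  next
    case False
    then have "v = q" using that(3) by simp
    moreover have "{u, q, p} = {u, p, q}" by auto
    ultimately show ?thesis using that(1,2) False by (intro exI[of _ p]) simp
  qed
  have tri': "\<exists>x y. {f, x, y} \<in> K \<and> distinct [f, x, y] \<and> g \<notin> {x, y}" if "f \<in> E" "g \<in> E" "f \<noteq> g" for f g
    using tri[OF that] three by (metis insertCI)
  have trd': "\<exists>x y. {f, x, y} \<in> L \<and> distinct [f, x, y] \<and> g \<notin> {x, y}" if "f \<in> E" "g \<in> E" "f \<noteq> g" for f g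
    using trd[OF that] three by (metis insertCI)
  \<comment> \<open>Two triples of the same kind that share two elements would sum to a member of
    size two.\<close>
  have uniq: "y = z" if "bspace E M" "M = K \<or> M = L" "{u, x, y} \<in> M" "{u, x, z} \<in> M"
    "distinct [u, x, y]" "distinct [u, x, z]" for M u x y z
  proof (rule ccontr)
    assume "y \<noteq> z"
    have "sym_diff {u, x, y} {u, x, z} \<in> M" by (rule bspaceD(4)[OF that(1,3,4)])
    moreover have "sym_diff {u, x, y} {u, x, z} = {y, z}" using that(5,6) \<open>y \<noteq> z\<close> by auto
    ultimately have "3 \<le> card {y, z}" using big that(2) by auto
    then show False using \<open>y \<noteq> z\<close> by simp
  qed
  have bK: "bspace E K" and bL: "bspace E L"
    using dual_pair_bspace[OF D] dual_pair_bspace[OF dual_pair_sym[OF D]] by blast+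
  obtain a b where ab: "{f, a, b} \<in> L" "distinct [f, a, b]" using trd'[OF E] by blast
  have abE: "a \<in> E" "b \<in> E" using KE[of "{f, a, b}"] ab(1) by auto
  obtain c0 d0 where cd0: "{f, c0, d0} \<in> L" "distinct [f, c0, d0]" "a \<notin> {c0, d0}"
    using trd'[of f a] E abE ab(2) by auto
  have bcd0: "b \<notin> {c0, d0}"
  proof
    assume "b \<in> {c0, d0}"
    from pick[OF cd0(1,2) this] obtain d'
      where "{f, b, d'} \<in> L" "distinct [f, b, d']" "d' \<in> {c0, d0}" by blast
    moreover have "{f, b, a} \<in> L" using ab(1) by (simp add: insert_commute[of b a])
    ultimately have "d' = a" using uniq[OF bL, of f b d' a] ab(2) by auto
    then show False using cd0(3) \<open>d' \<in> {c0, d0}\<close> by blast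
  qed
  obtain p q where pq: "{f, p, q} \<in> K" "distinct [f, p, q]" "a \<notin> {p, q}"
    using tri'[of f a] E abE ab(2) by auto
  \<comment> \<open>A triangle through \<open>f\<close> meets the triad \<open>{f, a, b}\<close>
    evenly; missing \<open>a\<close>, it has to contain \<open>b\<close>. The same parity argument
    places every further element.\<close>
  have "b \<in> {f, p, q}" using orth[OF pq(1) ab] pq(3) ab(2) by auto
  then have "b \<in> {p, q}" using ab(2) by auto
  from pick[OF pq(1,2) this] obtain d where d: "{f, b, d} \<in> K" "distinct [f, b, d]" by blast
  have "(c0 \<in> {f, b, d}) \<noteq> (d0 \<in> {f, b, d})" using orth[OF d(1) cd0(1,2)] by auto
  then have dcd: "d \<in> {c0, d0}" using cd0(2) bcd0 by auto
  from pick[OF cd0(1,2) this] obtain c where "{f, d, c} \<in> L" "distinct [f, d, c]" "c \<in> {c0, d0}"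
    by blast
  then have c: "{f, c, d} \<in> L" "distinct [f, a, b, c, d]"
    using dcd cd0(3) bcd0 ab(2) by (auto simp: insert_commute[of d c])
  have cdE: "c \<in> E" "d \<in> E" using KE[of "{f, c, d}"] c(1) by auto
  have ac: "{f, a, c} \<in> K"
  proof -
    obtain p q where pq: "{f, p, q} \<in> K" "distinct [f, p, q]" "b \<notin> {p, q}"
      using tri'[of f b] E abE ab(2) by auto
    have "a \<in> {f, p, q}" using orth[OF pq(1) ab] pq(3) ab(2) by auto
    then have "a \<in> {p, q}" using ab(2) by auto
    from pick[OF pq(1,2) this] obtain x where x: "{f, a, x} \<in> K" "distinct [f, a, x]"
      by blast
    have "(c \<in> {f, a, x}) \<noteq> (d \<in> {f, a, x})" using orth[OF x(1) c(1)] c(2) by auto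
    then have "x = c \<or> x = d" using c(2) by auto
    moreover have "x \<noteq> d"
    proof
      assume "x = d"
      then have "{f, d, a} \<in> K" "{f, d, b} \<in> K"
        using x(1) d(1) by (simp_all add: insert_commute[of d])
      then show False using uniq[OF bK, of f d a b] c(2) by auto
    qed
    ultimately show ?thesis using x(1) by blast
  qed
  \<comment> \<open>A triad through \<open>a\<close> without \<open>f\<close> contains
    \<open>c\<close>, because it meets the triangle \<open>{f, a, c}\<close> evenly. Its third
    element is neither \<open>b\<close> nor \<open>d\<close>, because it meets
    \<open>{f, b, d}\<close> evenly as well.\<close>
  obtain g where g: "{a, c, g} \<in> L" "distinct [f, a, b, c, d, g]"
  proof -
    obtain p q where pq: "{a, p, q} \<in> L" "distinct [a, p, q]" "f \<notin> {p, q}"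
      using trd'[of a f] E abE ab(2) by auto
    have "c \<in> {a, p, q}" using orth'[OF pq(1) ac] pq(3) c(2) by auto
    then have "c \<in> {p, q}" using c(2) by auto
    from pick[OF pq(1,2) this] obtain x where x: "{a, c, x} \<in> L" "distinct [a, c, x]" "x \<in> {p, q}"
      by blast
    have xf: "x \<noteq> f" using x(3) pq(3) by auto
    have "b \<in> {a, c, x} \<longleftrightarrow> d \<in> {a, c, x}" using orth'[OF x(1) d(1)] c(2) xf by auto
    then have "x \<noteq> b" "x \<noteq> d" using c(2) by auto
    then show ?thesis using that[OF x(1)] x(2) xf c(2) by auto
  qed
  have abg: "{a, b, g} \<in> K"
  proof -
    obtain p q where pq: "{a, p, q} \<in> K" "distinct [a, p, q]" "f \<notin> {p, q}"
      using tri'[of a f] E abE ab(2) by auto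
    have "b \<in> {a, p, q}" using orth[OF pq(1) ab] pq(3) ab(2) by auto
    then have "b \<in> {p, q}" using ab(2) by auto
    from pick[OF pq(1,2) this] obtain x where x: "{a, b, x} \<in> K" "distinct [a, b, x]" "x \<in> {p, q}"
      by blast
    have xf: "x \<noteq> f" using x(3) pq(3) by auto
    have "c \<in> {a, b, x} \<longleftrightarrow> d \<in> {a, b, x}" using orth[OF x(1) c(1)] c(2) xf by auto
    moreover have "(c \<in> {a, b, x}) \<noteq> (g \<in> {a, b, x})" using orth[OF x(1) g(1)] g(2) by auto
    ultimately have "x = g" using g(2) by auto
    then show ?thesis using x(1) by blast
  qed
  define S where "S = {f, a, b, c, d, g}"
  have SE: "S \<subseteq> E" unfolding S_def using E abE cdE KE[of "{a, c, g}"] g(1) by auto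
  note sums = bspaceD(4)[OF bK]
  have m: "{f, b, d} \<in> K" "{f, a, c} \<in> K" "{a, b, g} \<in> K" "{} \<in> K"
    using d(1) ac abg bspaceD(2)[OF bK] by auto
  have s1: "sym_diff {f, b, d} {f, a, c} = {a, b, c, d}" using g(2) by auto
  have s2: "sym_diff {f, b, d} {a, b, g} = {f, d, a, g}" using g(2) by auto
  have s3: "sym_diff {f, a, c} {a, b, g} = {f, c, b, g}" using g(2) by auto
  have s4: "sym_diff {a, b, c, d} {a, b, g} = {c, d, g}" using g(2) by auto
  have m': "{a, b, c, d} \<in> K" "{f, d, a, g} \<in> K" "{f, c, b, g} \<in> K" "{c, d, g} \<in> K"
    using sums[OF m(1,2)] sums[OF m(1,3)] sums[OF m(2,3)] sums[OF _ m(3), of "{a, b, c, d}"]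
    unfolding s1 s2 s3 s4 by blast+
  \<comment> \<open>The triads \<open>{f, a, b}\<close>, \<open>{f, c, d}\<close> and
    \<open>{a, c, g}\<close> supply the three parity checks; the three triangles generate the eight
    members.\<close>
  have "minor_space K {} S =
    {Z. Z \<subseteq> S \<and> k4_pred (f \<in> Z) (a \<in> Z) (b \<in> Z) (c \<in> Z) (d \<in> Z) (g \<in> Z)}"
  proof (intro set_eqI iffI)
    fix Z assume "Z \<in> minor_space K {} S"
    then have Z: "Z \<in> K" "Z \<subseteq> S" by (auto simp: minor_space_def)
    then show "Z \<in> {Z. Z \<subseteq> S \<and> k4_pred (f \<in> Z) (a \<in> Z) (b \<in> Z) (c \<in> Z) (d \<in> Z) (g \<in> Z)}"
      using orth[OF Z(1) ab] orth[OF Z(1) c(1)] orth[OF Z(1) g(1)] g(2) by (simp add: k4_pred_def)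
  next
    fix Z assume "Z \<in> {Z. Z \<subseteq> S \<and> k4_pred (f \<in> Z) (a \<in> Z) (b \<in> Z) (c \<in> Z) (d \<in> Z) (g \<in> Z)}"
    then have Z: "Z \<subseteq> S" "((f \<in> Z) \<noteq> (a \<in> Z)) = (b \<in> Z)" "((f \<in> Z) \<noteq> (c \<in> Z)) = (d \<in> Z)"
      "((a \<in> Z) \<noteq> (c \<in> Z)) = (g \<in> Z)" by (auto simp: k4_pred_def)
    have eq: "Z = T" if "T \<subseteq> S" "f \<in> Z \<longleftrightarrow> f \<in> T" "a \<in> Z \<longleftrightarrow> a \<in> T" "b \<in> Z \<longleftrightarrow> b \<in> T"
      "c \<in> Z \<longleftrightarrow> c \<in> T" "d \<in> Z \<longleftrightarrow> d \<in> T" "g \<in> Z \<longleftrightarrow> g \<in> T" for T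
      using Z(1) that unfolding S_def by blast
    have "Z \<in> K"
    \<comment> \<open>The memberships of \<open>f\<close>, \<open>a\<close> and \<open>c\<close> are
      free coordinates: the checks determine \<open>b\<close>, \<open>d\<close> and \<open>g\<close>
      from them.\<close>
    proof (cases "f \<in> Z"; cases "a \<in> Z"; cases "c \<in> Z")
      assume *: "f \<in> Z" "a \<in> Z" "c \<in> Z"
      have "Z = {f, a, c}" by (rule eq) (use Z(2-) * g(2) in \<open>auto simp: S_def\<close>)
      then show ?thesis using m m' by (simp only:)
    next
      assume *: "f \<in> Z" "a \<in> Z" "c \<notin> Z"
      have "Z = {f, d, a, g}" by (rule eq) (use Z(2-) * g(2) in \<open>auto simp: S_def\<close>)
      then show ?thesis using m m' by (simp only:)
    next
      assume *: "f \<in> Z" "a \<notin> Z" "c \<in> Z"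
      have "Z = {f, c, b, g}" by (rule eq) (use Z(2-) * g(2) in \<open>auto simp: S_def\<close>)
      then show ?thesis using m m' by (simp only:)
    next
      assume *: "f \<in> Z" "a \<notin> Z" "c \<notin> Z"
      have "Z = {f, b, d}" by (rule eq) (use Z(2-) * g(2) in \<open>auto simp: S_def\<close>)
      then show ?thesis using m m' by (simp only:)
    next
      assume *: "f \<notin> Z" "a \<in> Z" "c \<in> Z"
      have "Z = {a, b, c, d}" by (rule eq) (use Z(2-) * g(2) in \<open>auto simp: S_def\<close>)
      then show ?thesis using m m' by (simp only:)
    next
      assume *: "f \<notin> Z" "a \<in> Z" "c \<notin> Z"
      have "Z = {a, b, g}" by (rule eq) (use Z(2-) * g(2) in \<open>auto simp: S_def\<close>)
      then show ?thesis using m m' by (simp only:)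
    next
      assume *: "f \<notin> Z" "a \<notin> Z" "c \<in> Z"
      have "Z = {c, d, g}" by (rule eq) (use Z(2-) * g(2) in \<open>auto simp: S_def\<close>)
      then show ?thesis using m m' by (simp only:)
    next
      assume *: "f \<notin> Z" "a \<notin> Z" "c \<notin> Z"
      have "Z = {}" by (rule eq) (use Z(2-) * g(2) in \<open>auto simp: S_def\<close>)
      then show ?thesis using m m' by (simp only:)
    qed
    then show "Z \<in> minor_space K {} S" using Z(1) by (auto simp: minor_space_def)
  qed
  then have "six_form k4_pred S (minor_space K {} S)"
    unfolding six_form_def
    by (rule_tac exI[of _ f], rule_tac exI[of _ a], rule_tac exI[of _ b], rule_tac exI[of _ c],
      rule_tac exI[of _ d], rule_tac exI[of _ g]) (use g(2) in \<open>simp add: S_def\<close>)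
  then show ?thesis using SE by blast
qed

text \<open>If every small set contains \<open>e\<close>, there is none at all: removing
  \<open>e\<close> and applying the induction hypothesis to a partner of \<open>e\<close> would
  yield one without \<open>e\<close>. Deleting or contracting any \<open>f\<close> with prescribed
  element \<open>g\<close> then gives a triad and a triangle through \<open>f\<close> without
  \<open>g\<close>, which forces M(K4).\<close>

lemma no_k4_imp_small_avoiding:
  assumes "dual_pair E K L" "\<not> has_k4 E K" "3 \<le> card E" "e \<in> E"
  shows "small_avoiding K L e"
  using assms
proof (induction "card E" arbitrary: E K L e rule: less_induct)
  case less
  note D = less.prems(1) and e = less.prems(4)
  have finE: "finite E" by (rule dual_pairD(1)[OF D])
  show ?case
  proof (cases "card E = 3")
    case True
    have "card (E - {e}) = 2" using True e finE by simp
    then obtain a b where ab: "E - {e} = {a, b}" "a \<noteq> b" by (meson card_2_iff)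
    then have "E = {e, a, b}" using insert_Diff[OF e] by simp
    moreover have "a \<noteq> e" "b \<noteq> e" using ab(1) by blast+
    ultimately show ?thesis using small_avoiding_three[of e a b K L] D ab(2) by simp
  next
    case False
    then have card: "card (E - {f}) < card E" "3 \<le> card (E - {f})" if "f \<in> E" for f
      using that finE less.prems(3) by auto
    have del: "small_avoiding (avoiding f K) (removing f L) g" if "f \<in> E" "g \<in> E" "f \<noteq> g" for f g
    proof (rule less.hyps[OF card(1)[OF that(1)] dual_pair_delete[OF D that(1)] _ card(2)[OF that(1)]])
      show "\<not> has_k4 (E - {f}) (avoiding f K)" by (rule contrapos_nn[OF less.prems(2) has_k4_avoiding])
    qed (use that in simp)
    have con: "small_avoiding (avoiding f L) (removing f K) g" if "f \<in> E" "g \<in> E" "f \<noteq> g" for f g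
      unfolding small_avoiding_sym[of "avoiding f L"]
    proof (rule less.hyps[OF card(1)[OF that(1)] dual_pair_contract[OF D that(1)] _ card(2)[OF that(1)]])
      show "\<not> has_k4 (E - {f}) (removing f K)" by (rule contrapos_nn[OF less.prems(2) has_k4_removing[OF that(1)]])
    qed (use that in simp)
    show ?thesis
    proof (rule ccontr)
      assume no: "\<not> small_avoiding K L e"
      have big: "3 \<le> card R" if R: "R \<in> K \<or> R \<in> L" "R \<noteq> {}" for R
      proof (rule ccontr)
        assume "\<not> 3 \<le> card R"
        then have c2: "card R \<le> 2" by simp
        have RE: "R \<subseteq> E" using R(1) dual_pairD(2,3)[OF D] by blast
        then have finR: "finite R" using finE finite_subset by blast
        have eR: "e \<in> R" using small_avoidingI[OF R finR c2, of e] no by blast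
        \<comment> \<open>\<open>x\<close> is the partner of \<open>e\<close> in a pair, and any
          other element if \<open>R\<close> is a singleton.\<close>
        obtain x where x: "x \<in> E" "x \<noteq> e" "R \<subseteq> {e, x}"
        proof (cases "R = {e}")
          case True
          have "card E \<noteq> card {e}" using less.prems(3) by simp
          then have "E \<noteq> {e}" by blast
          then obtain x where "x \<in> E" "x \<noteq> e" using e by blast
          then show ?thesis using that True by simp
        next
          case False
          then obtain x where x: "x \<in> R" "x \<noteq> e" using eR by blast
          have "card {e, x} = 2" using x(2) by simp
          then have "{e, x} = R" using card_seteq[OF finR, of "{e, x}"] x eR c2 by simp
          then show ?thesis using that x RE by blast
        qed
        show False
        proof (cases "R \<in> K")
          case True
          show ?thesis
            using small_avoiding_delete_loop_imp[OF D True eR x(3) del[OF e x(1) x(2)[symmetric]]] no by simp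
        next
          case False
          then have "R \<in> L" using R(1) by simp
          from small_avoiding_delete_loop_imp[OF dual_pair_sym[OF D] this eR x(3) con[OF e x(1) x(2)[symmetric]]]
          show ?thesis using no unfolding small_avoiding_sym[of L] by simp
        qed
      qed
      have nosmall: "\<not> small_avoiding K L g" for g
      proof
        assume "small_avoiding K L g"
        then obtain R where "R \<noteq> {}" "card R \<le> 2" "R \<in> K \<or> R \<in> L"
          unfolding small_avoiding_def by (elim exE conjE) (rule that)
        then show False using big[of R] by simp
      qed
      have trd: "\<exists>T\<in>L. f \<in> T \<and> g \<notin> T \<and> card T = 3" if "f \<in> E" "g \<in> E" "f \<noteq> g" for f g
        using small_avoiding_delete_imp[OF del[OF that] that(3)[symmetric]] nosmall by simp
      have tri: "\<exists>T\<in>K. f \<in> T \<and> g \<notin> T \<and> card T = 3" if "f \<in> E" "g \<in> E" "f \<noteq> g" for f g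
        using small_avoiding_delete_imp[OF con[OF that] that(3)[symmetric]] nosmall
        unfolding small_avoiding_sym[of L] by simp
      have "E \<noteq> {e}" using less.prems(3) by auto
      then obtain g where g: "g \<in> E" "e \<noteq> g" using e by blast
      obtain S where "S \<subseteq> E" "six_form k4_pred S (minor_space K {} S)"
        using k4_restriction[OF D e g big tri trd] by blast
      then have "has_k4 E K" unfolding has_k4_def by (intro exI[of _ "{}"] exI[of _ S]) simp
      then show False using less.prems(2) by blast
    qed
  qed
qed

lemma no_k4_ex_small:
  assumes D: "dual_pair E K L" and "\<not> has_k4 E K" and "E \<noteq> {}"
  obtains R where "R \<noteq> {}" "R \<subseteq> E" "card R \<le> 2" "R \<in> K \<or> R \<in> L"
proof -
  obtain e where e: "e \<in> E" using assms(3) by blast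
  have finE: "finite E" by (rule dual_pairD(1)[OF D])
  show ?thesis
  proof (cases "3 \<le> card E")
    case True
    obtain R where "R \<noteq> {}" "card R \<le> 2" "R \<in> K \<or> R \<in> L"
      using no_k4_imp_small_avoiding[OF D assms(2) True e] unfolding small_avoiding_def by (elim exE conjE) (rule that)
    then show ?thesis using that dual_pairD(2,3)[OF D] by blast
  next
    case False
    \<comment> \<open>On at most two elements every subset is small, so any nonempty member will do.
      If \<open>{e}\<close> is no cocycle, some cycle passes through \<open>e\<close>.\<close>
    have c2: "card R \<le> 2" if "R \<subseteq> E" for R using card_mono[OF finE that] False by simp
    show ?thesis
    proof (cases "{e} \<in> L")
      case True
      then show ?thesis using that[of "{e}"] e by simp
    next
      case False
      then obtain Z where Z: "Z \<in> K" "odd (card (Z \<inter> {e}))" using dual_pairD(6)[OF D, of "{e}"] e by blast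
      then have "Z \<noteq> {}" by auto
      then show ?thesis using that[of Z] Z(1) dual_pairD(2)[OF D Z(1)] c2 by blast
    qed
  qed
qed

section \<open>Linkings as matchings\<close>

text \<open>Linkings in the form of Ingleton and Piff, which underlies the duality of strict
  gammoids and transversal matroids. \<open>m\<close> sends a vertex on a path to its successor and
  fixes the vertices off the paths; the starting vertices \<open>I\<close> are the ones that must
  stay unmatched.\<close>

definition matchable :: "'v set \<Rightarrow> ('v \<times> 'v) set \<Rightarrow> 'v set \<Rightarrow> 'v set \<Rightarrow> bool" where
  "matchable V A T I \<longleftrightarrow>
     (\<exists>m. inj_on m (V - T) \<and> m ` (V - T) \<subseteq> V - I \<and> (\<forall>v\<in>V - T. m v = v \<or> (v, m v) \<in> A))"

lemma (in wf_digraph) awalk_verts_arcs: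
  assumes "awalk u p v" "Suc i < length (awalk_verts u p)"
  shows "(awalk_verts u p ! i, awalk_verts u p ! Suc i) \<in> arcs_ends G"
  using assms
proof (induction p arbitrary: u i)
  case (Cons e p)
  then have e: "e \<in> arcs G" "awalk (head G e) p v" by (auto simp: awalk_Cons_iff)
  show ?case
  proof (cases i)
    case 0
    have "awalk_verts (head G e) p ! 0 = head G e"
      using awhd_of_awalk[OF e(2)] by (metis awalk_verts_non_Nil hd_conv_nth)
    then show ?thesis using 0 e(1) by (auto simp: arcs_ends_conv)
  next
    case (Suc j)
    then show ?thesis using Cons.IH[OF e(2), of j] Cons.prems(2) by simp
  qed
qed simp

text \<open>Each vertex occurs at most once on the disjoint paths, so successors and predecessors
  are unique and the successor map is injective. The start of a path has no predecessor, hence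
  \<open>I\<close> is avoided.\<close>

lemma (in fin_digraph) matchable_if_linked_into:
  assumes IT: "I \<subseteq> verts G" and L: "linked_into G I T"
  shows "matchable (verts G) (arcs_ends G) T I"
proof -
  obtain p t where pt: "\<And>x. x \<in> I \<Longrightarrow> t x \<in> T \<and> apath x (p x) (t x)"
    and disj: "\<And>x y. x \<in> I \<Longrightarrow> y \<in> I \<Longrightarrow> x \<noteq> y \<Longrightarrow>
      set (awalk_verts x (p x)) \<inter> set (awalk_verts y (p y)) = {}"
    using L unfolding linked_into_def by blast
  define w where "w x = awalk_verts x (p x)" for x
  have w: "w x \<noteq> []" "w x ! 0 = x" "last (w x) \<in> T" "distinct (w x)" "set (w x) \<subseteq> verts G"
    "\<And>i. Suc i < length (w x) \<Longrightarrow> (w x ! i, w x ! Suc i) \<in> arcs_ends G" if "x \<in> I" for x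
  proof -
    have a: "awalk x (p x) (t x)" "distinct (w x)" using pt[OF that] by (auto simp: apath_def w_def)
    show "w x \<noteq> []" by (simp add: w_def)
    then show "w x ! 0 = x" using awhd_of_awalk[OF a(1)] by (metis hd_conv_nth w_def)
    show "last (w x) \<in> T" using awlast_of_awalk[OF a(1)] pt[OF that] by (simp add: w_def)
    show "set (w x) \<subseteq> verts G" using awalk_verts_in_verts[of x "p x"] a(1) unfolding w_def
      by (auto simp: awalk_def)
    show "distinct (w x)" by (rule a(2))
    show "(w x ! i, w x ! Suc i) \<in> arcs_ends G" if i: "Suc i < length (w x)" for i
      using awalk_verts_arcs[OF a(1)] i unfolding w_def .
  qed
  have same: "x = y \<and> i = j"
    if "x \<in> I" "y \<in> I" "i < length (w x)" "j < length (w y)" "w x ! i = w y ! j" for x y i j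
  proof -
    have "w x ! i \<in> set (w x)" "w x ! i \<in> set (w y)"
      using nth_mem[OF that(3)] nth_mem[OF that(4)] that(5) by simp_all
    then have "x = y" using disj[OF that(1,2)] unfolding w_def by blast
    then show ?thesis using that w(4) by (simp add: nth_eq_iff_index_eq)
  qed
  define S where "S v u \<longleftrightarrow> (\<exists>x\<in>I. \<exists>i. Suc i < length (w x) \<and> w x ! i = v \<and> w x ! Suc i = u)" for v u
  define m where "m v = (if \<exists>u. S v u then SOME u. S v u else v)" for v
  have S: "S v (m v) \<or> (m v = v \<and> (\<forall>u. \<not> S v u))" for v
    unfolding m_def using someI_ex[of "S v"] by auto
  \<comment> \<open>A path vertex without a successor is the last one of its path and lies in
    \<open>T\<close>.\<close>
  have on: "S v (m v)" if h: "v \<notin> T" "x \<in> I" "v \<in> set (w x)" for v x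
  proof -
    obtain i where i: "i < length (w x)" "w x ! i = v" using h(3) by (meson in_set_conv_nth)
    have "i \<noteq> length (w x) - 1" using i(2) h(1) w(1,3)[OF h(2)] by (auto simp: last_conv_nth)
    then have "Suc i < length (w x)" using i(1) by simp
    then have "S v (w x ! Suc i)" using i(2) h(2) unfolding S_def by blast
    then show ?thesis using S by blast
  qed
  have Sfun: "v = v'" if h: "S v u" "S v' u" for v v' u
  proof -
    obtain x i where x: "x \<in> I" "Suc i < length (w x)" "w x ! i = v" "w x ! Suc i = u"
      using h(1) unfolding S_def by blast
    obtain y j where y: "y \<in> I" "Suc j < length (w y)" "w y ! j = v'" "w y ! Suc j = u"
      using h(2) unfolding S_def by blast
    have "x = y \<and> Suc i = Suc j" using same x y by metis
    then show ?thesis using x y by auto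
  qed
  have Starget: "\<exists>x\<in>I. u \<in> set (w x)" if "S v u" for v u
    using that unfolding S_def by (metis nth_mem)
  have SI: "u \<notin> I" if "S v u" for v u
  proof
    assume u: "u \<in> I"
    obtain x i where x: "x \<in> I" "Suc i < length (w x)" "w x ! Suc i = u"
      using \<open>S v u\<close> unfolding S_def by blast
    have "0 < length (w u)" "w u ! 0 = u" using w(1,2)[OF u] by auto
    then have "x = u \<and> Suc i = 0" by (intro same[OF x(1) u x(2)]) (simp_all add: x(3))
    then show False by simp
  qed
  have off: "x \<notin> I \<or> v \<notin> set (w x)" if "v \<notin> T" "\<not> S v (m v)" for v x
    using on[OF that(1)] that(2) by blast
  show ?thesis unfolding matchable_def
  proof (intro exI[of _ m] conjI ballI)
    show "inj_on m (verts G - T)"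
    proof (rule inj_onI)
      fix v v' assume v: "v \<in> verts G - T" "v' \<in> verts G - T" "m v = m v'"
      show "v = v'"
      proof (cases "S v (m v)")
        case True
        show ?thesis
        proof (cases "S v' (m v')")
          case True
          then show ?thesis using Sfun \<open>S v (m v)\<close> v(3) by metis
        next
          case False
          then have "m v' = v'" using S by blast
          then show ?thesis using Starget[OF \<open>S v (m v)\<close>] off[OF _ False] v by auto
        qed
      next
        case nS: False
        then have mv: "m v = v" using S by blast
        show ?thesis
        proof (cases "S v' (m v')")
          case True
          then show ?thesis using Starget[OF True] off[OF _ nS] v mv by auto
        next
          case False
          then have "m v' = v'" using S by blast
          then show ?thesis using mv v(3) by simp
        qed
      qed
    qed
    show "m ` (verts G - T) \<subseteq> verts G - I"
    proof (rule image_subsetI)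
      fix v assume v: "v \<in> verts G - T"
      show "m v \<in> verts G - I"
      proof (cases "S v (m v)")
        case True
        then show ?thesis using Starget[OF True] SI[OF True] w(5) by blast
      next
        case False
        have "v \<notin> I"
        proof
          assume "v \<in> I"
          then have "v \<in> set (w v)" using w(1,2) by (metis length_greater_0_conv nth_mem)
          then show False using off[OF _ False, of v] v \<open>v \<in> I\<close> by blast
        qed
        moreover have "m v = v" using False S by blast
        ultimately show ?thesis using v by simp
      qed
    qed
    fix v
    show "m v = v \<or> (v, m v) \<in> arcs_ends G"
    proof (cases "S v (m v)")
      case True
      then obtain x i where "x \<in> I" "Suc i < length (w x)" "w x ! i = v" "w x ! Suc i = m v"
        unfolding S_def by blast
      then show ?thesis using w(6)[of x i] by simp
    next
      case False
      then show ?thesis using S by blast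
    qed
  qed
qed

lemma (in wf_digraph) awalk_funpow:
  assumes "x \<in> verts G" "\<And>i. i < n \<Longrightarrow> ((m ^^ i) x, (m ^^ Suc i) x) \<in> arcs_ends G"
  shows "\<exists>p. awalk x p ((m ^^ n) x) \<and> awalk_verts x p = map (\<lambda>i. (m ^^ i) x) [0..<Suc n]"
  using assms
proof (induction n arbitrary: x)
  case 0
  then show ?case by (intro exI[of _ "[]"]) (simp add: awalk_Nil_iff)
next
  case (Suc n)
  obtain e where e: "e \<in> arcs G" "tail G e = x" "head G e = m x"
    using Suc.prems(2)[of 0] by (auto simp: arcs_ends_conv)
  have "m x \<in> verts G" using e head_in_verts by metis
  moreover have "((m ^^ i) (m x), (m ^^ Suc i) (m x)) \<in> arcs_ends G" if "i < n" for i
    using Suc.prems(2)[of "Suc i"] that by (simp add: funpow_swap1)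
  ultimately obtain p where p: "awalk (m x) p ((m ^^ n) (m x))"
    "awalk_verts (m x) p = map (\<lambda>i. (m ^^ i) (m x)) [0..<Suc n]"
    using Suc.IH by blast
  have "awalk x (e # p) ((m ^^ Suc n) x)" using p(1) e by (simp add: awalk_Cons_iff funpow_swap1)
  moreover have "awalk_verts x (e # p) = map (\<lambda>i. (m ^^ i) x) [0..<Suc (Suc n)]"
  proof -
    have "map (\<lambda>i. (m ^^ i) x) [0..<Suc (Suc n)] = x # map (\<lambda>i. (m ^^ Suc i) x) [0..<Suc n]"
      by (simp only: map_upt_Suc funpow_0)
    then show ?thesis using p(2) e by (simp add: funpow_swap1)
  qed
  ultimately show ?case by blast
qed

lemma funpow_cancel:
  assumes "inj_on m W" "\<And>k. k < i \<Longrightarrow> (m ^^ k) x \<in> W" "\<And>k. k < i \<Longrightarrow> (m ^^ k) y \<in> W"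
    "(m ^^ i) x = (m ^^ i) y"
  shows "x = y"
  using assms(2-4)
proof (induction i)
  case (Suc i)
  have "(m ^^ i) x = (m ^^ i) y"
    using Suc.prems inj_onD[OF assms(1)] by simp
  then show ?case using Suc by simp
qed simp

text \<open>Iterate \<open>m\<close> from each \<open>x \<in> I\<close> until the orbit leaves
  \<open>V - T\<close>. If two orbits met, injectivity would cancel their common steps until one of
  the starting points is reached. As \<open>I\<close> lies outside the range of \<open>m\<close>,
  both must then be at their starts. So orbits neither merge nor return.\<close>

lemma (in fin_digraph) linked_into_if_matchable:
  assumes I: "I \<subseteq> verts G" and M: "matchable (verts G) (arcs_ends G) T I"
  shows "linked_into G I T"
proof -
  define W where "W = verts G - T"
  obtain m where m: "inj_on m W" "m ` W \<subseteq> verts G - I" "\<And>v. v \<in> W \<Longrightarrow> m v = v \<or> (v, m v) \<in> arcs_ends G"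
    using M unfolding matchable_def W_def by blast
  have chain: "x = y \<and> i = j" if xy: "x \<in> I" "y \<in> I"
    and W: "\<And>k. k < i \<Longrightarrow> (m ^^ k) x \<in> W" "\<And>k. k < j \<Longrightarrow> (m ^^ k) y \<in> W"
    and eq: "(m ^^ i) x = (m ^^ j) y" for x y i j
  proof -
    have aux: "x = y \<and> i = j" if ij: "i \<le> j" and xy: "x \<in> I" "y \<in> I"
      and W: "\<And>k. k < i \<Longrightarrow> (m ^^ k) x \<in> W" "\<And>k. k < j \<Longrightarrow> (m ^^ k) y \<in> W"
      and eq: "(m ^^ i) x = (m ^^ j) y" for x y i j
    proof -
      have "(m ^^ i) x = (m ^^ i) ((m ^^ (j - i)) y)" using eq ij by (simp add: funpow_add[symmetric, THEN fun_cong, unfolded o_def])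
      moreover have "(m ^^ k) ((m ^^ (j - i)) y) \<in> W" if "k < i" for k
      proof -
        have "k + (j - i) < j" using that ij by simp
        from W(2)[OF this] show ?thesis by (simp only: funpow_add o_apply)
      qed
      ultimately have x: "x = (m ^^ (j - i)) y" using funpow_cancel[OF m(1), of i x] W(1) by blast
      show ?thesis
      proof (cases "i = j")
        case True
        then show ?thesis using x by simp
      next
        case False
        then obtain k where k: "j - i = Suc k" using ij by (metis Suc_diff_Suc le_neq_implies_less)
        then have "(m ^^ k) y \<in> W" using W(2) by simp
        then have "x \<in> m ` W" using x k by simp
        then show ?thesis using m(2) xy(1) by blast
      qed
    qed
    show ?thesis
    proof (cases "i \<le> j")
      case True
      show ?thesis by (rule aux[OF True xy W eq])
    next
      case False
      then have "j \<le> i" by simp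
      from aux[OF this xy(2,1) W(2,1) eq[symmetric]] show ?thesis by simp
    qed
  qed
  \<comment> \<open>An orbit that never leaves the finite set \<open>W\<close> would consist of
    infinitely many distinct vertices.\<close>
  have ex: "\<exists>n. (m ^^ n) x \<notin> W" if x: "x \<in> I" for x
  proof (rule ccontr)
    assume "\<not> ?thesis"
    then have inW: "(m ^^ n) x \<in> W" for n by blast
    have "inj (\<lambda>n. (m ^^ n) x)" using chain[OF x x] inW by (auto intro: injI)
    moreover have "range (\<lambda>n. (m ^^ n) x) \<subseteq> W" using inW by blast
    then have "finite (range (\<lambda>n. (m ^^ n) x))" using finite_subset[of _ W] finite_verts by (simp add: W_def)
    ultimately show False using finite_imageD by blast
  qed
  define N where "N x = (LEAST n. (m ^^ n) x \<notin> W)" for x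
  have N: "(m ^^ N x) x \<notin> W" "\<And>k. k < N x \<Longrightarrow> (m ^^ k) x \<in> W" if "x \<in> I" for x
    using LeastI_ex[OF ex[OF that]] not_less_Least unfolding N_def by blast+
  have NV: "(m ^^ k) x \<in> verts G" if "x \<in> I" "k \<le> N x" for x k
  proof (cases k)
    case 0
    then show ?thesis using that I by auto
  next
    case (Suc l)
    then have "(m ^^ l) x \<in> W" using N(2) that by simp
    then show ?thesis using m(2) Suc by auto
  qed
  have step: "((m ^^ i) x, (m ^^ Suc i) x) \<in> arcs_ends G" if "x \<in> I" "i < N x" for x i
  proof -
    \<comment> \<open>A fixed point of \<open>m\<close> on the orbit would be a repetition, so each
      step follows an arc.\<close>
    have "(m ^^ i) x \<noteq> (m ^^ Suc i) x" using chain[OF that(1) that(1), of i "Suc i"] N(2) that by fastforce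
    then show ?thesis using m(3)[OF N(2)[OF that]] by simp
  qed
  have "\<exists>p. awalk x p ((m ^^ N x) x) \<and> awalk_verts x p = map (\<lambda>i. (m ^^ i) x) [0..<Suc (N x)]" if "x \<in> I" for x
    by (rule awalk_funpow) (use I that step in auto)
  then obtain p where p: "\<And>x. x \<in> I \<Longrightarrow> awalk x (p x) ((m ^^ N x) x)"
    "\<And>x. x \<in> I \<Longrightarrow> awalk_verts x (p x) = map (\<lambda>i. (m ^^ i) x) [0..<Suc (N x)]"
    by metis
  show ?thesis unfolding linked_into_def
  proof (intro exI[of _ p] exI[of _ "\<lambda>x. (m ^^ N x) x"] conjI ballI impI)
    fix x assume x: "x \<in> I"
    show "(m ^^ N x) x \<in> T" using N(1)[OF x] NV[OF x, of "N x"] by (simp add: W_def)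
    have "inj_on (\<lambda>i. (m ^^ i) x) {0..<Suc (N x)}"
    proof (rule inj_onI)
      fix i j assume "i \<in> {0..<Suc (N x)}" "j \<in> {0..<Suc (N x)}" "(m ^^ i) x = (m ^^ j) x"
      then show "i = j" using chain[OF x x, of i j] N(2)[OF x] by simp
    qed
    then have "distinct (awalk_verts x (p x))" unfolding p(2)[OF x]
      by (simp only: distinct_map distinct_upt set_upt simp_thms)
    then show "apath x (p x) ((m ^^ N x) x)" using p(1)[OF x] by (simp add: apath_def)
  next
    fix x y assume xy: "x \<in> I" "y \<in> I" "x \<noteq> y"
    show "set (awalk_verts x (p x)) \<inter> set (awalk_verts y (p y)) = {}"
    proof (rule ccontr)
      assume "\<not> ?thesis"
      then obtain i j where "i < Suc (N x)" "j < Suc (N y)" "(m ^^ i) x = (m ^^ j) y"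
        unfolding p(2)[OF xy(1)] p(2)[OF xy(2)] by (auto simp del: upt_Suc)
      then show False using chain[OF xy(1,2), of i j] N(2)[OF xy(1)] N(2)[OF xy(2)] xy(3) by simp
    qed
  qed
qed

lemma (in fin_digraph) linked_into_iff_matchable:
  "I \<subseteq> verts G \<Longrightarrow> linked_into G I T \<longleftrightarrow> matchable (verts G) (arcs_ends G) T I"
  using matchable_if_linked_into linked_into_if_matchable by blast

section \<open>Adding sources and sinks to the digraph\<close>

lemma matchable_mono:
  assumes "matchable V A T J" "I \<subseteq> J"
  shows "matchable V A T I"
proof -
  have "V - J \<subseteq> V - I" using assms(2) by auto
  then show ?thesis using assms(1) unfolding matchable_def by (blast intro: subset_trans)
qed

text \<open>No arc reaches the new vertex and it need not be matched, so its membership in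
  \<open>I\<close> imposes nothing: it is a coloop.\<close>

lemma matchable_insert_sink:
  assumes "n \<notin> V" "A \<subseteq> V \<times> V" "T \<subseteq> V"
  shows "matchable (insert n V) A (insert n T) I \<longleftrightarrow> matchable V A T (I - {n})"
proof -
  have VT: "insert n V - insert n T = V - T" using assms by auto
  have "m ` (V - T) \<subseteq> insert n V - I \<longleftrightarrow> m ` (V - T) \<subseteq> V - (I - {n})"
    if "\<forall>v\<in>V - T. m v = v \<or> (v, m v) \<in> A" for m
  proof -
    have "m v \<in> V" if "v \<in> V - T" for v using bspec[OF \<open>\<forall>v\<in>V - T. m v = v \<or> (v, m v) \<in> A\<close> that] that assms(2) by auto
    then show ?thesis using assms(1) by (auto simp: image_subset_iff)
  qed
  then show ?thesis unfolding matchable_def VT by (intro ex_cong1) blast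
qed

lemma matchable_insert_source:
  assumes n: "n \<notin> V" and A: "A \<subseteq> V \<times> V" and T: "T \<subseteq> V" and U: "U \<subseteq> V"
  shows "matchable (insert n V) (A \<union> {n} \<times> U) T I \<longleftrightarrow>
    (if n \<in> I then \<exists>u\<in>U. u \<notin> I \<and> matchable V A T (insert u (I - {n})) else matchable V A T I)"
proof -
  have VT: "insert n V - T = insert n (V - T)" and nVT: "n \<notin> V - T" using n T by auto
  have restrict: "m v \<in> V \<and> (m v = v \<or> (v, m v) \<in> A)"
    if "\<forall>v\<in>insert n V - T. m v = v \<or> (v, m v) \<in> A \<union> {n} \<times> U" "v \<in> V - T" for m v
  proof -
    have "m v = v \<or> (v, m v) \<in> A" using that n by auto
    then show ?thesis using that(2) A by auto
  qed
  \<comment> \<open>Serves both cases: \<open>J\<close> is \<open>insert u (I - {n})\<close> if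
    \<open>n\<close> moves to \<open>u\<close>, and \<open>J\<close> is \<open>I\<close> with
    \<open>u = n\<close> if \<open>n\<close> stays.\<close>
  have extend: "matchable (insert n V) (A \<union> {n} \<times> U) T I"
    if m: "inj_on m (V - T)" "m ` (V - T) \<subseteq> V - J" "\<forall>v\<in>V - T. m v = v \<or> (v, m v) \<in> A"
      and u: "u \<in> insert n U" "u \<notin> I" "u \<notin> m ` (V - T)" and J: "I - {n} \<subseteq> J" for m u J
    unfolding matchable_def VT
  proof (intro exI[of _ "m(n := u)"] conjI ballI)
    have eq: "(m(n := u)) ` (V - T) = m ` (V - T)" using nVT by (intro image_cong) auto
    have "inj_on (m(n := u)) (V - T)" using m(1) nVT by (subst inj_on_cong[of _ _ m]) auto
    then show "inj_on (m(n := u)) (insert n (V - T))"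
      using u(3) nVT unfolding inj_on_insert 
      by (simp only: eq Diff_insert0[OF nVT] Diff_empty fun_upd_same simp_thms)
    show "(m(n := u)) ` insert n (V - T) \<subseteq> insert n V - I"
      unfolding image_insert eq using m(2) u(1,2) U J n by auto
    show "(m(n := u)) v = v \<or> (v, (m(n := u)) v) \<in> A \<union> {n} \<times> U" if "v \<in> insert n (V - T)" for v
      using that m(3) u(1) by auto
  qed
  show ?thesis
  proof (cases "n \<in> I")
    case True
    have "matchable (insert n V) (A \<union> {n} \<times> U) T I \<longleftrightarrow>
      (\<exists>u\<in>U. u \<notin> I \<and> matchable V A T (insert u (I - {n})))"
    proof
      assume "matchable (insert n V) (A \<union> {n} \<times> U) T I"
      then obtain m where m: "inj_on m (insert n V - T)" "m ` (insert n V - T) \<subseteq> insert n V - I"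
        "\<forall>v\<in>insert n V - T. m v = v \<or> (v, m v) \<in> A \<union> {n} \<times> U"
        unfolding matchable_def by blast
      have nin: "n \<in> insert n V - T" using VT by simp
      then have "m n \<notin> I" using m(2) by blast
      moreover from this have "m n \<noteq> n" using True by metis
      ultimately have u: "m n \<in> U" "m n \<notin> I" using m(3) nin A n by auto
      have "matchable V A T (insert (m n) (I - {n}))" unfolding matchable_def
      proof (intro exI[of _ m] conjI ballI)
        show "inj_on m (V - T)" using m(1) by (rule inj_on_subset) auto
        show "m ` (V - T) \<subseteq> V - insert (m n) (I - {n})"
        proof (rule image_subsetI)
          fix v assume v: "v \<in> V - T"
          have "m v \<noteq> m n" using inj_onD[OF m(1), of v n] v nin n by auto
          moreover have "m v \<notin> I" using m(2) v by blast
          ultimately show "m v \<in> V - insert (m n) (I - {n})" using restrict[OF m(3) v] by simp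
        qed
        show "m v = v \<or> (v, m v) \<in> A" if "v \<in> V - T" for v using restrict[OF m(3) that] by simp
      qed
      then show "\<exists>u\<in>U. u \<notin> I \<and> matchable V A T (insert u (I - {n}))" using u by blast
    next
      assume "\<exists>u\<in>U. u \<notin> I \<and> matchable V A T (insert u (I - {n}))"
      then obtain u m where u: "u \<in> U" "u \<notin> I" and m: "inj_on m (V - T)"
        "m ` (V - T) \<subseteq> V - insert u (I - {n})" "\<forall>v\<in>V - T. m v = v \<or> (v, m v) \<in> A"
        unfolding matchable_def by blast
      show "matchable (insert n V) (A \<union> {n} \<times> U) T I"
        by (rule extend[OF m, of u]) (use u m(2) in auto)
    qed
    then show ?thesis using True by simp
  next
    case False
    have "matchable (insert n V) (A \<union> {n} \<times> U) T I \<longleftrightarrow> matchable V A T I"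
    proof
      assume "matchable (insert n V) (A \<union> {n} \<times> U) T I"
      then obtain m where m: "inj_on m (insert n V - T)" "m ` (insert n V - T) \<subseteq> insert n V - I"
        "\<forall>v\<in>insert n V - T. m v = v \<or> (v, m v) \<in> A \<union> {n} \<times> U"
        unfolding matchable_def by blast
      show "matchable V A T I" unfolding matchable_def
      proof (intro exI[of _ m] conjI ballI)
        show "inj_on m (V - T)" using m(1) by (rule inj_on_subset) auto
        show "m ` (V - T) \<subseteq> V - I"
        proof (rule image_subsetI)
          fix v assume v: "v \<in> V - T"
          then have "m v \<notin> I" using m(2) by blast
          then show "m v \<in> V - I" using restrict[OF m(3) v] by simp
        qed
        show "m v = v \<or> (v, m v) \<in> A" if "v \<in> V - T" for v using restrict[OF m(3) that] by simp
      qed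
    next
      assume "matchable V A T I"
      then obtain m where m: "inj_on m (V - T)" "m ` (V - T) \<subseteq> V - I"
        "\<forall>v\<in>V - T. m v = v \<or> (v, m v) \<in> A"
        unfolding matchable_def by blast
      show "matchable (insert n V) (A \<union> {n} \<times> U) T I"
        by (rule extend[OF m, of n]) (use False m(2) n in auto)
    qed
    then show ?thesis using False by simp
  qed
qed

section \<open>Binary matroids without \<open>M(K\<^sub>4)\<close> minors are gammoids\<close>

text \<open>A gammoid presentation with matchings in place of linkings. Vertices are natural
  numbers, so a fresh one is always at hand for an extension.\<close>

definition link_rep :: "'a set \<Rightarrow> 'a set set \<Rightarrow> bool" where
  "link_rep E K \<longleftrightarrow> (\<exists>(V :: nat set) A T \<phi>. finite V \<and> A \<subseteq> V \<times> V \<and> T \<subseteq> V \<and> inj_on \<phi> E \<and>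
     \<phi> ` E \<subseteq> V \<and> (\<forall>I\<subseteq>E. indep_in K I \<longleftrightarrow> matchable V A T (\<phi> ` I)))"

lemma gammoid_space_matroid_iff:
  assumes K: "bspace E K"
  shows "gammoid (space_matroid E K) \<longleftrightarrow> link_rep E K"
proof
  assume "gammoid (space_matroid E K)"
  then obtain G :: "(nat, nat) pre_digraph" and S T where G: "fin_digraph G"
    and ST: "S \<subseteq> verts G" "T \<subseteq> verts G" and iso: "isomorphic (space_matroid E K) (linkage_matroid G S T)"
    unfolding gammoid_def by blast
  obtain f where f: "bij_betw f E S"
    "\<And>I. I \<subseteq> E \<Longrightarrow> I \<in> indeps (space_matroid E K) \<longleftrightarrow> f ` I \<in> indeps (linkage_matroid G S T)"
    using iso unfolding isomorphic_def by (auto simp: linkage_matroid_def)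
  interpret fin_digraph G by (rule G)
  have "indep_in K I \<longleftrightarrow> matchable (verts G) (arcs_ends G) T (f ` I)" if I: "I \<subseteq> E" for I
  proof -
    have fI: "f ` I \<subseteq> S" using I f(1) by (auto simp: bij_betw_def)
    then show ?thesis using f(2)[OF I] I linked_into_iff_matchable[of "f ` I" T] ST(1)
      by (simp add: indeps_space_matroid linkage_matroid_def)
  qed
  moreover have "arcs_ends G \<subseteq> verts G \<times> verts G" by (auto simp: arcs_ends_conv)
  ultimately show "link_rep E K" unfolding link_rep_def
    using f(1) ST by (intro exI[of _ "verts G"] exI[of _ "arcs_ends G"] exI[of _ T] exI[of _ f])
      (auto simp: bij_betw_def)
next
  assume "link_rep E K"
  then obtain V :: "nat set" and A T \<phi> where V: "finite V" "A \<subseteq> V \<times> V" "T \<subseteq> V" "inj_on \<phi> E" "\<phi> ` E \<subseteq> V"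
    and ind: "\<forall>I\<subseteq>E. indep_in K I \<longleftrightarrow> matchable V A T (\<phi> ` I)"
    unfolding link_rep_def by (elim exE conjE) (rule that)
  \<comment> \<open>Arcs need names of type \<open>nat\<close>, and encoding the pair of ends
    supplies them.\<close>
  define G :: "(nat, nat) pre_digraph" where
    "G = \<lparr>verts = V, arcs = prod_encode ` A, tail = \<lambda>e. fst (prod_decode e), head = \<lambda>e. snd (prod_decode e)\<rparr>"
  have "finite A" using V(1,2) by (meson finite_SigmaI finite_subset)
  then have G: "fin_digraph G" using V(1,2) by unfold_locales (auto simp: G_def)
  then interpret fin_digraph G .
  have Gs: "verts G = V" "arcs_ends G = A" by (auto simp: arcs_ends_conv G_def image_image)
  have "isomorphic (space_matroid E K) (linkage_matroid G (\<phi> ` E) T)"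
    unfolding isomorphic_def
  proof (intro exI[of _ \<phi>] conjI allI impI)
    show "bij_betw \<phi> (ground (space_matroid E K)) (ground (linkage_matroid G (\<phi> ` E) T))"
      using V(4) by (simp add: bij_betw_def linkage_matroid_def)
    fix I assume "I \<subseteq> ground (space_matroid E K)"
    then have I: "I \<subseteq> E" by simp
    then have "\<phi> ` I \<subseteq> V" "\<phi> ` I \<subseteq> \<phi> ` E" using V(5) by auto
    then show "I \<in> indeps (space_matroid E K) \<longleftrightarrow> \<phi> ` I \<in> indeps (linkage_matroid G (\<phi> ` E) T)"
      using ind[rule_format, OF I] I linked_into_iff_matchable[of "\<phi> ` I" T]
      by (simp add: indeps_space_matroid linkage_matroid_def Gs)
  qed
  then show "gammoid (space_matroid E K)"
    unfolding gammoid_def using matroid_space_matroid[OF K] G V(3,5) Gs(1)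
    by (intro conjI exI[of _ G] exI[of _ "\<phi> ` E"] exI[of _ T]) simp_all
qed

section \<open>Extending a presentation by one element\<close>

lemma link_repI:
  fixes V :: "nat set"
  assumes "finite V" "A \<subseteq> V \<times> V" "T \<subseteq> V" "inj_on \<phi> E" "\<phi> ` E \<subseteq> V"
    "\<And>I. I \<subseteq> E \<Longrightarrow> indep_in K I \<longleftrightarrow> matchable V A T (\<phi> ` I)"
  shows "link_rep E K"
  unfolding link_rep_def
  by (rule exI[of _ V], rule exI[of _ A], rule exI[of _ T], rule exI[of _ \<phi>]) (use assms in simp)

lemma link_repE:
  assumes "link_rep E K"
  obtains V :: "nat set" and A T \<phi> where "finite V" "A \<subseteq> V \<times> V" "T \<subseteq> V" "inj_on \<phi> E" "\<phi> ` E \<subseteq> V"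
    "\<And>I. I \<subseteq> E \<Longrightarrow> indep_in K I \<longleftrightarrow> matchable V A T (\<phi> ` I)"
  using assms unfolding link_rep_def by (elim exE conjE) (rule that, simp_all)

lemma fun_upd_inj_on_new:
  assumes "inj_on \<phi> (E - {x})" "\<phi> ` (E - {x}) \<subseteq> V" "n \<notin> V"
  shows "inj_on (\<phi>(x := n)) E" "(\<phi>(x := n)) ` E \<subseteq> insert n V"
    "I \<subseteq> E \<Longrightarrow> (\<phi>(x := n)) ` I = (if x \<in> I then insert n (\<phi> ` (I - {x})) else \<phi> ` I)"
    "I \<subseteq> E \<Longrightarrow> n \<notin> \<phi> ` (I - {x})"
proof -
  have ne: "\<phi> y \<noteq> n" if "y \<in> E" "y \<noteq> x" for y using assms(2,3) that by auto
  show "inj_on (\<phi>(x := n)) E"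
  proof (rule inj_onI)
    fix y z assume "y \<in> E" "z \<in> E" "(\<phi>(x := n)) y = (\<phi>(x := n)) z"
    then show "y = z" using ne inj_onD[OF assms(1), of y z] by (auto split: if_splits)
  qed
  show "(\<phi>(x := n)) ` E \<subseteq> insert n V" using assms(2) by auto
  show "I \<subseteq> E \<Longrightarrow> (\<phi>(x := n)) ` I = (if x \<in> I then insert n (\<phi> ` (I - {x})) else \<phi> ` I)" by auto
  show "I \<subseteq> E \<Longrightarrow> n \<notin> \<phi> ` (I - {x})" using ne by auto
qed

text \<open>A new source without arcs is a loop, and a new source with a single arc to the place of
  \<open>y\<close> is parallel to \<open>y\<close>.\<close>

lemma link_rep_source:
  assumes R: "link_rep (E - {x}) K'" and U: "U = {} \<or> (y \<in> E \<and> y \<noteq> x \<and> U = {y})"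
    and ind: "\<And>I. I \<subseteq> E \<Longrightarrow> indep_in K I \<longleftrightarrow>
      (if x \<in> I then \<exists>u\<in>U. u \<notin> I \<and> indep_in K' (insert u (I - {x})) else indep_in K' I)"
  shows "link_rep E K"
proof -
  obtain V A T \<phi> where V: "finite (V :: nat set)" "A \<subseteq> V \<times> V" "T \<subseteq> V"
    and \<phi>: "inj_on \<phi> (E - {x})" "\<phi> ` (E - {x}) \<subseteq> V"
    and rep: "\<And>I. I \<subseteq> E - {x} \<Longrightarrow> indep_in K' I \<longleftrightarrow> matchable V A T (\<phi> ` I)"
    using R by (rule link_repE) (rule that)
  obtain n where n: "n \<notin> V" using V(1) ex_new_if_finite infinite_UNIV_nat by blast
  note new = fun_upd_inj_on_new[OF \<phi> n]
  have UE: "U \<subseteq> E - {x}" using U by auto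
  then have UV: "\<phi> ` U \<subseteq> V" using \<phi>(2) by auto
  show ?thesis
  proof (rule link_repI[of "insert n V" "A \<union> {n} \<times> \<phi> ` U" T "\<phi>(x := n)"])
    fix I assume I: "I \<subseteq> E"
    show "indep_in K I \<longleftrightarrow> matchable (insert n V) (A \<union> {n} \<times> \<phi> ` U) T ((\<phi>(x := n)) ` I)"
    proof (cases "x \<in> I")
      case True
      have nI: "n \<notin> \<phi> ` (I - {x})" by (rule new(4)[OF I])
      have mem: "\<phi> u \<in> insert n (\<phi> ` (I - {x})) \<longleftrightarrow> u \<in> I" if "u \<in> U" for u
      proof -
        have "\<phi> u \<noteq> n" using UV n that by auto
        moreover have "\<phi> u \<in> \<phi> ` (I - {x}) \<longleftrightarrow> u \<in> I - {x}"
          using inj_on_image_mem_iff[OF \<phi>(1), of u "I - {x}"] that UE I by auto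
        ultimately show ?thesis using that UE by auto
      qed
      have "matchable V A T (insert (\<phi> u) (\<phi> ` (I - {x}))) \<longleftrightarrow> indep_in K' (insert u (I - {x}))" if "u \<in> U" for u
        using rep[of "insert u (I - {x})"] that UE I by auto
      then show ?thesis
        unfolding new(3)[OF I] matchable_insert_source[OF n V(2,3) UV] ind[OF I]
        using True mem nI by auto
    next
      case False
      have "n \<notin> \<phi> ` I" using new(4)[OF I] False by simp
      moreover have "I \<subseteq> E - {x}" using I False by auto
      ultimately show ?thesis
        unfolding new(3)[OF I] matchable_insert_source[OF n V(2,3) UV] ind[OF I]
        using False rep[of I] by simp
    qed
  next
    show "A \<union> {n} \<times> \<phi> ` U \<subseteq> insert n V \<times> insert n V" using V(2) UV by auto
  qed (use V new(1,2) in auto)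
qed

lemma link_rep_sink:
  assumes R: "link_rep (E - {x}) K'"
    and ind: "\<And>I. I \<subseteq> E \<Longrightarrow> indep_in K I \<longleftrightarrow> indep_in K' (I - {x})"
  shows "link_rep E K"
proof -
  obtain V A T \<phi> where V: "finite (V :: nat set)" "A \<subseteq> V \<times> V" "T \<subseteq> V"
    and \<phi>: "inj_on \<phi> (E - {x})" "\<phi> ` (E - {x}) \<subseteq> V"
    and rep: "\<And>I. I \<subseteq> E - {x} \<Longrightarrow> indep_in K' I \<longleftrightarrow> matchable V A T (\<phi> ` I)"
    using R by (rule link_repE) (rule that)
  obtain n where n: "n \<notin> V" using V(1) ex_new_if_finite infinite_UNIV_nat by blast
  note new = fun_upd_inj_on_new[OF \<phi> n]
  show ?thesis
  proof (rule link_repI[of "insert n V" A "insert n T" "\<phi>(x := n)"])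
    fix I assume I: "I \<subseteq> E"
    have "(\<phi>(x := n)) ` I - {n} = \<phi> ` (I - {x})"
      unfolding new(3)[OF I] using new(4)[OF I] by auto
    moreover have "I - {x} \<subseteq> E - {x}" using I by auto
    ultimately show "indep_in K I \<longleftrightarrow> matchable (insert n V) A (insert n T) ((\<phi>(x := n)) ` I)"
      using rep[of "I - {x}"] ind[OF I] matchable_insert_sink[OF n V(2,3)] by simp
  qed (use V new(1,2) in auto)
qed

text \<open>The series extension uses a new sink for \<open>x\<close> and moves \<open>y\<close> to a new vertex with arcs to that sink
  and to the old place of \<open>y\<close>.\<close>

lemma link_rep_series:
  assumes R: "link_rep (E - {x}) K'" and y: "y \<in> E" "y \<noteq> x"
    and ind: "\<And>I. I \<subseteq> E \<Longrightarrow> indep_in K I \<longleftrightarrow>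
      indep_in K' (if x \<in> I \<and> y \<in> I then I - {x} else I - {x, y})"
  shows "link_rep E K"
proof -
  obtain V A T \<phi> where V: "finite (V :: nat set)" "A \<subseteq> V \<times> V" "T \<subseteq> V"
    and \<phi>: "inj_on \<phi> (E - {x})" "\<phi> ` (E - {x}) \<subseteq> V"
    and rep: "\<And>I. I \<subseteq> E - {x} \<Longrightarrow> indep_in K' I \<longleftrightarrow> matchable V A T (\<phi> ` I)"
    using R by (rule link_repE) (rule that)
  obtain n where n: "n \<notin> V" using V(1) ex_new_if_finite infinite_UNIV_nat by blast
  obtain k where k: "k \<notin> insert n V"
    using V(1) ex_new_if_finite[of "insert n V"] infinite_UNIV_nat by blast
  define V' where "V' = insert n V"
  define T' where "T' = insert n T"
  define U where "U = {n, \<phi> y}"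
  have yV: "\<phi> y \<in> V" using \<phi>(2) y by auto
  have V': "A \<subseteq> V' \<times> V'" "T' \<subseteq> V'" "U \<subseteq> V'" "k \<notin> V'"
    using V yV k by (auto simp: V'_def T'_def U_def)
  define \<psi> where "\<psi> = (\<phi>(x := n))(y := k)"
  have inj: "inj_on (\<phi>(x := n)) (E - {y})"
    by (rule inj_on_subset[OF fun_upd_inj_on_new(1)[OF \<phi> n]]) auto
  have "(\<phi>(x := n)) ` (E - {y}) \<subseteq> (\<phi>(x := n)) ` E" by (rule image_mono) auto
  then have im: "(\<phi>(x := n)) ` (E - {y}) \<subseteq> V'"
    unfolding V'_def using fun_upd_inj_on_new(2)[OF \<phi> n] by (rule subset_trans)
  note new = fun_upd_inj_on_new[OF inj im V'(4), folded \<psi>_def]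
  show ?thesis
  proof (rule link_repI[of "insert k V'" "A \<union> {k} \<times> U" T' \<psi>])
    fix I assume I: "I \<subseteq> E"
    let ?J = "\<phi> ` (I - {x, y})"
    have JV: "?J \<subseteq> V" using I \<phi>(2) by auto
    have yJ: "\<phi> y \<notin> ?J" using inj_on_image_mem_iff[OF \<phi>(1), of y "I - {x, y}"] y I by auto
    have im: "\<psi> ` I = (if y \<in> I then {k} else {}) \<union> (if x \<in> I then {n} else {}) \<union> ?J"
      using y(2) by (auto simp: \<psi>_def)
    have sub: "I - {x, y} \<subseteq> E - {x}" using I by auto
    have kn: "k \<noteq> n" "n \<notin> ?J" "k \<notin> ?J" "\<phi> y \<noteq> n" "\<phi> y \<noteq> k" using k n JV yV by auto
    have sink: "matchable V' A T' J \<longleftrightarrow> matchable V A T (J - {n})" for J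
      unfolding V'_def T'_def by (rule matchable_insert_sink[OF n V(2,3)])
    show "indep_in K I \<longleftrightarrow> matchable (insert k V') (A \<union> {k} \<times> U) T' (\<psi> ` I)"
    proof (cases "y \<in> I")
      case False
      then have "\<psi> ` I - {n} = ?J" "k \<notin> \<psi> ` I" unfolding im using kn by auto
      then show ?thesis
        unfolding matchable_insert_source[OF V'(4,1,2,3)] ind[OF I] using False rep[OF sub] sink by simp
    next
      case True
      have 1: "n \<notin> \<psi> ` I \<longleftrightarrow> x \<notin> I" "\<phi> y \<notin> \<psi> ` I" "k \<in> \<psi> ` I" unfolding im using kn True yJ by auto
      have 2: "insert n (\<psi> ` I - {k}) - {n} = ?J" "insert (\<phi> y) (\<psi> ` I - {k}) - {n} = insert (\<phi> y) ?J"
        unfolding im using kn by auto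
      have "insert (\<phi> y) ?J = \<phi> ` (I - {x})" using True y(2) by auto
      moreover have "I - {x} \<subseteq> E - {x}" using I by auto
      ultimately have 3: "matchable V A T (insert (\<phi> y) ?J) \<longleftrightarrow> indep_in K' (I - {x})" using rep by simp
      \<comment> \<open>The vertex \<open>k\<close> of \<open>y\<close> moves to \<open>n\<close> or
        to \<open>\<phi> y\<close>. If \<open>x \<notin> I\<close>, the sink \<open>n\<close> is
        free, and by monotonicity the other option adds nothing; if \<open>x \<in> I\<close>, only
        the old place of \<open>y\<close> remains.\<close>
      have 4: "matchable V A T (insert (\<phi> y) ?J) \<Longrightarrow> matchable V A T ?J"
        by (erule matchable_mono) auto
      have "matchable (insert k V') (A \<union> {k} \<times> U) T' (\<psi> ` I) \<longleftrightarrow>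
        (x \<notin> I \<and> matchable V A T ?J) \<or> matchable V A T (insert (\<phi> y) ?J)"
        unfolding matchable_insert_source[OF V'(4,1,2,3)]
        unfolding sink unfolding U_def using 1 by (simp add: 2)
      then show ?thesis unfolding ind[OF I] using True 3 4 rep[OF sub] by (cases "x \<in> I") auto
    qed
  next
    show "A \<union> {k} \<times> U \<subseteq> insert k V' \<times> insert k V'" using V'(1,3) by auto
  qed (use V(1) V' new(1,2) in \<open>auto simp: V'_def\<close>)
qed

text \<open>One element of a small set is removed and restored by the matching digraph extension.
  Deletion serves loops, coloops and parallel pairs; a series pair calls for contraction.\<close>

lemma link_rep_if_no_k4:
  assumes "dual_pair E K L" "\<not> has_k4 E K"
  shows "link_rep E K"
  using assms
proof (induction "card E" arbitrary: E K L rule: less_induct)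
  case less
  note D = less.prems(1) and no = less.prems(2)
  have finE: "finite E" by (rule dual_pairD(1)[OF D])
  have bK: "bspace E K" by (rule dual_pair_bspace[OF D])
  have lt: "card (E - {x}) < card E" if "x \<in> E" for x using finE that by (meson card_Diff1_less)
  have del: "link_rep (E - {x}) (avoiding x K)" if "x \<in> E" for x
    by (rule less.hyps[OF lt[OF that] dual_pair_delete[OF D that] contrapos_nn[OF no has_k4_avoiding]])
  have con: "link_rep (E - {x}) (removing x K)" if "x \<in> E" for x
    by (rule less.hyps[OF lt[OF that] dual_pair_contract[OF D that] contrapos_nn[OF no has_k4_removing[OF that]]])
  have indep_avoiding: "indep_in (avoiding x K) I \<longleftrightarrow> indep_in K I" if "x \<notin> I" for x I
    using that unfolding indep_in_def avoiding_def by blast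
  show ?case
  proof (cases "E = {}")
    case True
    show ?thesis
      by (rule link_repI[of "{}" "{}" "{}"]) (auto simp: True indep_in_def matchable_def)
  next
    case False
    obtain R where R: "R \<noteq> {}" "R \<subseteq> E" "card R \<le> 2" "R \<in> K \<or> R \<in> L"
      using no_k4_ex_small[OF D no False] .
    have finR: "finite R" using R(2) finE finite_subset by blast
    obtain x where x: "x \<in> R" using R(1) by blast
    have xE: "x \<in> E" using x R(2) by blast
    consider (one) "R = {x}" | (two) y where "R = {x, y}" "y \<noteq> x"
    proof (cases "R = {x}")
      case False
      then obtain y where y: "y \<in> R" "y \<noteq> x" using x by blast
      have "card {x, y} = 2" using y(2) by simp
      then have "{x, y} = R" using card_seteq[OF finR, of "{x, y}"] x y(1) R(3) by simp
      then show ?thesis using two y(2) by blast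
    qed (use one in blast)
    then show ?thesis
    proof cases
      case one
      show ?thesis
      proof (cases "{x} \<in> K")
        case True
        show ?thesis
        proof (rule link_rep_source[OF del[OF xE], of "{}" x])
          fix I assume "I \<subseteq> E"
          have "\<not> indep_in K I" if "x \<in> I"
            using True that unfolding indep_in_def by (intro notI) (drule bspec[of _ _ "{x}"], auto)
          then show "indep_in K I \<longleftrightarrow> (if x \<in> I then \<exists>u\<in>{}. u \<notin> I \<and> indep_in (avoiding x K) (insert u (I - {x}))
             else indep_in (avoiding x K) I)"
            using indep_avoiding[of x I] by simp
        qed simp
      next
        case False
        then have "{x} \<in> L" using R(4) one by simp
        then have nx: "x \<notin> Z" if "Z \<in> K" for Z
          using dual_pairD(4)[OF D that, of "{x}"] by (cases "x \<in> Z") auto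
        show ?thesis
        proof (rule link_rep_sink[OF del[OF xE]])
          fix I
          have "Z \<subseteq> I \<longleftrightarrow> Z \<subseteq> I - {x}" if "Z \<in> K" for Z using nx[OF that] by auto
          then have "indep_in K I \<longleftrightarrow> indep_in K (I - {x})" unfolding indep_in_def by simp
          then show "indep_in K I \<longleftrightarrow> indep_in (avoiding x K) (I - {x})" using indep_avoiding[of x "I - {x}"] by simp
        qed
      qed
    next
      case (two y)
      have yE: "y \<in> E" using two R(2) by blast
      show ?thesis
      proof (cases "{x, y} \<in> K")
        case True
        show ?thesis
        proof (rule link_rep_source[OF del[OF xE], of "{y}" y])
          fix I assume "I \<subseteq> E"
          have dep: "\<not> indep_in K I" if "x \<in> I" "y \<in> I"
            using True that unfolding indep_in_def by (intro notI) (drule bspec[of _ _ "{x, y}"], auto)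
          have eq: "indep_in K I \<longleftrightarrow> indep_in K (insert y (I - {x}))" if "x \<in> I" "y \<notin> I"
          proof -
            \<comment> \<open>Adding the pair \<open>{u, v}\<close> turns a member through
              \<open>u\<close> into one through \<open>v\<close>, so parallel elements can be
              exchanged.\<close>
            have swap: "indep_in K J" if J: "indep_in K (insert v (J - {u}))" "u \<in> J" "v \<notin> J" "{u, v} \<in> K" "u \<noteq> v"
              for u v J
              unfolding indep_in_def
            proof (intro ballI impI)
              fix Z assume Z: "Z \<in> K" "Z \<subseteq> J"
              show "Z = {}"
              proof (cases "u \<in> Z")
                case True
                have "sym_diff Z {u, v} = insert v (Z - {u})" using True Z(2) J(3) by auto
                then have "insert v (Z - {u}) \<in> K" using bspaceD(4)[OF bK Z(1) J(4)] by (simp only:)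
                moreover have "insert v (Z - {u}) \<subseteq> insert v (J - {u})" using Z(2) by auto
                ultimately have "insert v (Z - {u}) = {}" using J(1) unfolding indep_in_def by blast
                then show ?thesis by simp
              next
                case False
                then have "Z \<subseteq> insert v (J - {u})" using Z(2) by auto
                then show ?thesis using J(1) Z(1) unfolding indep_in_def by simp
              qed
            qed
            have yx: "{y, x} \<in> K" using True by (simp add: insert_commute)
            have "insert x (insert y (I - {x}) - {y}) = I" using that by auto
            then show ?thesis
              using swap[of y I x] swap[of x "insert y (I - {x})" y] True yx that two(2) by auto
          qed
          have "indep_in (avoiding x K) (insert y (I - {x})) \<longleftrightarrow> indep_in K (insert y (I - {x}))"
            using two(2) by (intro indep_avoiding) auto
          then show "indep_in K I \<longleftrightarrow>
            (if x \<in> I then \<exists>u\<in>{y}. u \<notin> I \<and> indep_in (avoiding x K) (insert u (I - {x})) else indep_in (avoiding x K) I)"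
            using dep eq indep_avoiding[of x I] by auto
        qed (use yE two(2) in simp)
      next
        case False
        then have L: "{x, y} \<in> L" using R(4) two by simp
        have both: "x \<in> Z \<longleftrightarrow> y \<in> Z" if "Z \<in> K" for Z
        proof -
          have "even (card (Z \<inter> {x, y}))" by (rule dual_pairD(4)[OF D that L])
          then show ?thesis using two(2) by (cases "x \<in> Z"; cases "y \<in> Z") (auto simp: Int_insert_right)
        qed
        \<comment> \<open>Members contain both \<open>x\<close> and \<open>y\<close> or neither. A
          set that misses one of them therefore contains no member through the other, and a set with
          both behaves as after contracting \<open>x\<close>.\<close>
        show ?thesis
        proof (rule link_rep_series[OF con[OF xE] yE two(2)])
          fix I assume "I \<subseteq> E"
          show "indep_in K I \<longleftrightarrow> indep_in (removing x K) (if x \<in> I \<and> y \<in> I then I - {x} else I - {x, y})"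
          proof (cases "x \<in> I \<and> y \<in> I")
            case True
            have "Z \<subseteq> I \<longleftrightarrow> Z - {x} \<subseteq> I - {x}" "Z = {} \<longleftrightarrow> Z - {x} = {}" if "Z \<in> K" for Z
              using True both[OF that] two(2) by auto
            then show ?thesis using True unfolding indep_in_def removing_def by auto
          next
            case False
            have "Z \<subseteq> I \<longleftrightarrow> Z - {x} \<subseteq> I - {x, y}" "Z = {} \<longleftrightarrow> Z - {x} = {}" if "Z \<in> K" for Z
              using False both[OF that] two(2) by auto
            then show ?thesis using False unfolding indep_in_def removing_def by auto
          qed
        qed
      qed
    qed
  qed
qed

section \<open>Gammoids have no \<open>M(K\<^sub>4)\<close> minor\<close>

text \<open>The argument of Halmos and Vaughan. A proper nonempty tight set \<open>X\<close> is
  matched on its own and the rest into the remaining values; without a tight set any value for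
  \<open>w0\<close> can be spent, as all other subsets have one to spare.\<close>

lemma hall_marriage:
  fixes S :: "'a \<Rightarrow> 'b set"
  assumes "finite W" "\<And>w. w \<in> W \<Longrightarrow> finite (S w)"
    "\<And>X. X \<subseteq> W \<Longrightarrow> card X \<le> card (\<Union>w\<in>X. S w)"
  shows "\<exists>m. inj_on m W \<and> (\<forall>w\<in>W. m w \<in> S w)"
  using assms
proof (induction "card W" arbitrary: W S rule: less_induct)
  case less
  note fin = less.prems(1,2) and H = less.prems(3)
  have finX: "finite X" "finite (\<Union>w\<in>X. S w)" if "X \<subseteq> W" for X
    using that fin finite_subset by blast+
  show ?case
  proof (cases "\<exists>X. X \<subset> W \<and> X \<noteq> {} \<and> card X = card (\<Union>w\<in>X. S w)")
    case True
    then obtain X where X: "X \<subset> W" "X \<noteq> {}" "card X = card (\<Union>w\<in>X. S w)" by blast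
    let ?U = "\<Union>w\<in>X. S w"
    have XW: "X \<subseteq> W" using X(1) by auto
    have lt: "card X < card W" "card (W - X) < card W"
      using X(1,2) fin(1) by (auto intro!: psubset_card_mono)
    have "\<exists>m. inj_on m X \<and> (\<forall>w\<in>X. m w \<in> S w)"
    proof (rule less.hyps[OF lt(1) finX(1)[OF XW]])
      show "finite (S w)" if "w \<in> X" for w using fin(2) XW that by blast
      show "card Y \<le> card (\<Union>w\<in>Y. S w)" if "Y \<subseteq> X" for Y by (rule H) (use that XW in simp)
    qed
    then obtain m1 where m1: "inj_on m1 X" "\<And>w. w \<in> X \<Longrightarrow> m1 w \<in> S w" by blast
    \<comment> \<open>Hall's condition for \<open>X \<union> Y\<close>, with the tight contribution
      of \<open>X\<close> subtracted from both sides.\<close>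
    have le: "card Y \<le> card (\<Union>w\<in>Y. S w - ?U)" if Y: "Y \<subseteq> W - X" for Y
    proof -
      have YX: "X \<union> Y \<subseteq> W" "Y \<subseteq> W" using Y XW by auto
      have "card X + card Y = card (X \<union> Y)"
        using Y finX(1)[OF XW] finX(1)[OF YX(2)] by (subst card_Un_disjoint) auto
      also have "\<dots> \<le> card (\<Union>w\<in>X \<union> Y. S w)" by (rule H[OF YX(1)])
      also have "(\<Union>w\<in>X \<union> Y. S w) = ?U \<union> (\<Union>w\<in>Y. S w - ?U)" by auto
      also have "card \<dots> \<le> card ?U + card (\<Union>w\<in>Y. S w - ?U)" by (rule card_Un_le)
      finally show ?thesis using X(3) by simp
    qed
    have "\<exists>m. inj_on m (W - X) \<and> (\<forall>w\<in>W - X. m w \<in> S w - ?U)"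
      by (rule less.hyps[OF lt(2) _ _ le]) (use fin in auto)
    then obtain m2 where m2: "inj_on m2 (W - X)" "\<And>w. w \<in> W - X \<Longrightarrow> m2 w \<in> S w - ?U" by blast
    define m where "m w = (if w \<in> X then m1 w else m2 w)" for w
    have "inj_on m W"
    proof (rule inj_onI)
      fix v w assume vw: "v \<in> W" "w \<in> W" "m v = m w"
      have c: "m1 x \<noteq> m2 y" if "x \<in> X" "y \<in> W - X" for x y
      proof -
        have "m1 x \<in> ?U" using m1(2)[OF that(1)] that(1) by blast
        then show ?thesis using m2(2)[OF that(2)] by auto
      qed
      show "v = w"
      proof (cases "v \<in> X"; cases "w \<in> X")
        assume "v \<in> X" "w \<in> X"
        then show ?thesis using vw(3) inj_onD[OF m1(1)] by (simp add: m_def)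
      next
        assume "v \<in> X" "w \<notin> X"
        then show ?thesis using vw c[of v w] by (simp add: m_def)
      next
        assume "v \<notin> X" "w \<in> X"
        then show ?thesis using vw c[of w v] by (simp add: m_def)
      next
        assume "v \<notin> X" "w \<notin> X"
        then show ?thesis using vw inj_onD[OF m2(1), of v w] by (simp add: m_def)
      qed
    qed
    moreover have "\<forall>w\<in>W. m w \<in> S w" using m1(2) m2(2) by (simp add: m_def)
    ultimately show ?thesis by blast
  next
    case crit: False
    show ?thesis
    proof (cases "W = {}")
      case ne: False
      then obtain w0 where w0: "w0 \<in> W" by blast
      have "card {w0} \<le> card (\<Union>w\<in>{w0}. S w)" using w0 by (intro H) simp
      then have "S w0 \<noteq> {}" by auto
      then obtain s where s: "s \<in> S w0" by blast
      have lt: "card (W - {w0}) < card W" using w0 fin(1) by (meson card_Diff1_less)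
      have le: "card Y \<le> card (\<Union>w\<in>Y. S w - {s})" if Y: "Y \<subseteq> W - {w0}" for Y
      proof (cases "Y = {}")
        case False
        have YW: "Y \<subseteq> W" "Y \<subset> W" using Y w0 by auto
        have "card Y \<noteq> card (\<Union>w\<in>Y. S w)" using crit YW(2) False by blast
        then have "card Y < card (\<Union>w\<in>Y. S w)" using H[OF YW(1)] by simp
        moreover have "(\<Union>w\<in>Y. S w - {s}) = (\<Union>w\<in>Y. S w) - {s}" by auto
        moreover have "card (\<Union>w\<in>Y. S w) - 1 \<le> card ((\<Union>w\<in>Y. S w) - {s})"
          by (simp add: card_Diff_singleton_if)
        ultimately show ?thesis by simp 
      qed simp
      have "\<exists>m. inj_on m (W - {w0}) \<and> (\<forall>w\<in>W - {w0}. m w \<in> S w - {s})"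
        by (rule less.hyps[OF lt _ _ le]) (use fin in auto)
      then obtain m where m: "inj_on m (W - {w0})" "\<And>w. w \<in> W - {w0} \<Longrightarrow> m w \<in> S w - {s}" by blast
      have "inj_on (m(w0 := s)) W"
      proof (rule inj_onI)
        fix v w assume vw: "v \<in> W" "w \<in> W" "(m(w0 := s)) v = (m(w0 := s)) w"
        then show "v = w"
          using m(2)[of v] m(2)[of w] inj_onD[OF m(1), of v w] by (auto split: if_splits)
      qed
      moreover have "\<forall>w\<in>W. (m(w0 := s)) w \<in> S w" using m(2) s by auto
      ultimately show ?thesis by blast
    qed simp
  qed
qed

text \<open>The vertices that every matching is forced to place inside \<open>F\<close>.\<close>

definition enclosed :: "'v set \<Rightarrow> ('v \<times> 'v) set \<Rightarrow> 'v set \<Rightarrow> 'v set \<Rightarrow> 'v set" where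
  "enclosed V A T F = {v \<in> V - T. v \<in> F \<and> A `` {v} \<subseteq> F}"

lemma enclosed_Int: "enclosed V A T (F \<inter> F') = enclosed V A T F \<inter> enclosed V A T F'"
  by (auto simp: enclosed_def)

lemma enclosed_mono: "F \<subseteq> F' \<Longrightarrow> enclosed V A T F \<subseteq> enclosed V A T F'"
  by (auto simp: enclosed_def)

text \<open>The enclosed vertices are matched injectively into \<open>F - I\<close>.\<close>

lemma matchable_imp_card_le:
  assumes V: "finite V" and F: "F \<subseteq> V" and M: "matchable V A T I"
  shows "card (I \<inter> F) + card (enclosed V A T F) \<le> card F"
proof -
  obtain m where m: "inj_on m (V - T)" "m ` (V - T) \<subseteq> V - I"
    "\<forall>v\<in>V - T. m v = v \<or> (v, m v) \<in> A"
    using M unfolding matchable_def by blast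
  have finF: "finite F" using V F finite_subset by blast
  have sub: "enclosed V A T F \<subseteq> V - T" by (auto simp: enclosed_def)
  have "m ` enclosed V A T F \<subseteq> F - I"
  proof (rule image_subsetI)
    fix v assume v: "v \<in> enclosed V A T F"
    then have "v \<in> V - T" "v \<in> F" "A `` {v} \<subseteq> F" by (auto simp: enclosed_def)
    then have "m v \<in> F" using bspec[OF m(3), of v] by auto
    moreover have "m v \<notin> I" using m(2) v sub by blast
    ultimately show "m v \<in> F - I" by simp
  qed
  then have "card (enclosed V A T F) \<le> card (F - I)"
    using card_inj_on_le[OF inj_on_subset[OF m(1) sub]] finF by blast
  moreover have "card F = card (I \<inter> F) + card (F - I)"
    using card_Int_Diff[OF finF, of I] by (simp add: Int_commute)
  ultimately show ?thesis by simp
qed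

text \<open>A set \<open>X\<close> violating Hall's condition yields \<open>F\<close> as
  \<open>X\<close> together with its out-neighbours: then \<open>X\<close> is enclosed in
  \<open>F\<close> and \<open>F - I\<close> is too small for it. With the preceding bound this gives
  an exact criterion for independence.\<close>

lemma not_matchable_imp_card_less:
  assumes V: "finite V" "A \<subseteq> V \<times> V" and M: "\<not> matchable V A T I"
  shows "\<exists>F\<subseteq>V. card F < card (I \<inter> F) + card (enclosed V A T F)"
proof -
  define S where "S v = insert v (A `` {v}) - I" for v
  have SV: "insert v (A `` {v}) \<subseteq> V" if "v \<in> V - T" for v using that V(2) by auto
  have "\<not> (\<exists>m. inj_on m (V - T) \<and> (\<forall>w\<in>V - T. m w \<in> S w))"
  proof
    assume "\<exists>m. inj_on m (V - T) \<and> (\<forall>w\<in>V - T. m w \<in> S w)"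
    then obtain m where m: "inj_on m (V - T)" "\<And>w. w \<in> V - T \<Longrightarrow> m w \<in> S w" by blast
    have "m ` (V - T) \<subseteq> V - I" using m(2) SV unfolding S_def by blast
    moreover have "\<forall>v\<in>V - T. m v = v \<or> (v, m v) \<in> A" using m(2) unfolding S_def by auto
    ultimately show False using M m(1) unfolding matchable_def by blast
  qed
  moreover have "finite (S w)" if "w \<in> V - T" for w
    unfolding S_def by (rule finite_subset[OF _ V(1)]) (use SV[OF that] in auto)
  ultimately obtain X where X: "X \<subseteq> V - T" "\<not> card X \<le> card (\<Union>w\<in>X. S w)"
    using hall_marriage[of "V - T" S] V(1) by blast
  define F where "F = (\<Union>v\<in>X. insert v (A `` {v}))"
  have FV: "F \<subseteq> V" unfolding F_def using SV X(1) by blast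
  then have finF: "finite F" using V(1) finite_subset by blast
  have "F - I = (\<Union>w\<in>X. S w)" unfolding F_def S_def by auto
  moreover have "X \<subseteq> enclosed V A T F" using X(1) unfolding enclosed_def F_def by auto
  then have "card X \<le> card (enclosed V A T F)"
    using V(1) by (intro card_mono) (auto simp: enclosed_def)
  moreover have "card F = card (I \<inter> F) + card (F - I)"
    using card_Int_Diff[OF finF, of I] by (simp add: Int_commute)
  ultimately show ?thesis using X(2) FV by (intro exI[of _ F]) auto
qed

section \<open>Inclusion-exclusion for cardinalities\<close>

lemma card_Un_int:
  "finite A \<Longrightarrow> finite B \<Longrightarrow> int (card (A \<union> B)) = int (card A) + int (card B) - int (card (A \<inter> B))"
  using card_Un_Int[of A B] by simp

lemma card_Un4_int:
  assumes "finite A" "finite B" "finite C" "finite D"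
  shows "int (card (A \<union> B \<union> C \<union> D)) =
    int (card A) + int (card B) + int (card C) + int (card D)
    - int (card (A \<inter> B)) - int (card (A \<inter> C)) - int (card (A \<inter> D))
    - int (card (B \<inter> C)) - int (card (B \<inter> D)) - int (card (C \<inter> D))
    + int (card (A \<inter> B \<inter> C)) + int (card (A \<inter> B \<inter> D)) + int (card (A \<inter> C \<inter> D)) + int (card (B \<inter> C \<inter> D))
    - int (card (A \<inter> B \<inter> C \<inter> D))"
proof -
  have three: "int (card (X \<union> Y \<union> Z)) = int (card X) + int (card Y) + int (card Z)
    - int (card (X \<inter> Y)) - int (card (X \<inter> Z)) - int (card (Y \<inter> Z)) + int (card (X \<inter> Y \<inter> Z))"
    if "finite X" "finite Y" "finite Z" for X Y Z :: "'a set"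
  proof -
    have "(X \<union> Y) \<inter> Z = (X \<inter> Z) \<union> (Y \<inter> Z)" "(X \<inter> Z) \<inter> (Y \<inter> Z) = X \<inter> Y \<inter> Z" by auto
    then show ?thesis using that card_Un_int[of "X \<union> Y" Z] card_Un_int[of X Y]
        card_Un_int[of "X \<inter> Z" "Y \<inter> Z"] by simp
  qed
  have e: "(A \<union> B \<union> C) \<inter> D = (A \<inter> D) \<union> (B \<inter> D) \<union> (C \<inter> D)"
    "(A \<inter> D) \<inter> (B \<inter> D) = A \<inter> B \<inter> D" "(A \<inter> D) \<inter> (C \<inter> D) = A \<inter> C \<inter> D"
    "(B \<inter> D) \<inter> (C \<inter> D) = B \<inter> C \<inter> D" "A \<inter> B \<inter> D \<inter> (C \<inter> D) = A \<inter> B \<inter> C \<inter> D"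
    by auto
  have "int (card (A \<union> B \<union> C \<union> D)) = int (card (A \<union> B \<union> C)) + int (card D) - int (card ((A \<union> B \<union> C) \<inter> D))"
    using assms by (intro card_Un_int) auto
  then show ?thesis
    using three[OF assms(1,2,3)] three[of "A \<inter> D" "B \<inter> D" "C \<inter> D"] assms
    unfolding e by simp
qed

text \<open>Every triangle of a minor isomorphic to \<open>M(K\<^sub>4)\<close> lies in a set of \<open>\<mu>\<close>-value two. Since \<open>\<mu>\<close> satisfies
  the inclusion-exclusion inequality for the four sets, their union, which spans the minor, has value
  at most \<open>8 - 6 + 0 - 0 = 2\<close>, less than the rank three of the minor.\<close>

lemma link_rep_imp_no_k4:
  assumes K: "bspace E K" and R: "link_rep E K"
  shows "\<not> has_k4 E K"
proof
  assume "has_k4 E K"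
  then obtain C S where CS: "C \<subseteq> E" "S \<subseteq> E" "C \<inter> S = {}" and form: "six_form k4_pred S (minor_space K C S)"
    unfolding has_k4_def by (elim exE conjE) (rule that)
  obtain a b c d e f where D: "distinct [a, b, c, d, e, f]" and S: "S = {a, b, c, d, e, f}"
    and M: "minor_space K C S = {Z. Z \<subseteq> S \<and> k4_pred (a \<in> Z) (b \<in> Z) (c \<in> Z) (d \<in> Z) (e \<in> Z) (f \<in> Z)}"
    using form unfolding six_form_def by (elim exE conjE) (rule that)
  obtain J where J: "basis_of (space_matroid E K) C J" using ex_basis_of[OF K CS(1)] by blast
  have JC: "J \<subseteq> C" using J by (simp add: basis_of_def)
  obtain V A T \<phi> where V: "finite (V :: nat set)" "A \<subseteq> V \<times> V" "T \<subseteq> V"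
    and \<phi>: "inj_on \<phi> E" "\<phi> ` E \<subseteq> V"
    and rep: "\<And>I. I \<subseteq> E \<Longrightarrow> indep_in K I \<longleftrightarrow> matchable V A T (\<phi> ` I)"
    using R by (rule link_repE) (rule that)
  \<comment> \<open>The last term accounts for the contracted basis \<open>J\<close>: an independent
    set \<open>I\<close> of the minor satisfies the bound for \<open>I \<union> J\<close>, whose
    share of \<open>F\<close> splits into the two images.\<close>
  define \<mu> where "\<mu> F = int (card F) - int (card (enclosed V A T F)) - int (card (\<phi> ` J \<inter> F))" for F
  have fin: "finite F" if "F \<subseteq> V" for F using that V(1) finite_subset by blast
  have fine: "finite (enclosed V A T F)" for F using V(1) by (auto simp: enclosed_def)
  have ind: "indep_in (minor_space K C S) I \<longleftrightarrow> matchable V A T (\<phi> ` I \<union> \<phi> ` J)" if "I \<subseteq> S" for I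
  proof -
    have "I \<union> J \<subseteq> E" using that CS JC by blast
    then show ?thesis
      using indep_in_minor_space[OF K J CS(1,3,2) that] rep[of "I \<union> J"] by (simp add: image_Un)
  qed
  have card_split: "card ((\<phi> ` I \<union> \<phi> ` J) \<inter> F) = card (\<phi> ` I \<inter> F) + card (\<phi> ` J \<inter> F)" if "I \<subseteq> S" "F \<subseteq> V" for I F
  proof -
    have "\<phi> ` I \<inter> \<phi> ` J = \<phi> ` (I \<inter> J)"
      by (rule inj_on_image_Int[OF \<phi>(1), symmetric]) (use that(1) CS JC in blast)+
    also have "I \<inter> J = {}" using that(1) CS(3) JC by auto
    finally have "(\<phi> ` I \<inter> F) \<inter> (\<phi> ` J \<inter> F) = {}" by auto
    then show ?thesis using fin[OF that(2)] by (simp add: Int_Un_distrib2 card_Un_disjoint)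
  qed
  have lower: "int (card (\<phi> ` I \<inter> F)) \<le> \<mu> F" if "indep_in (minor_space K C S) I" "I \<subseteq> S" "F \<subseteq> V" for I F
    using matchable_imp_card_le[OF V(1) that(3), of A T "\<phi> ` I \<union> \<phi> ` J"] ind[OF that(2)] that
      card_split[OF that(2,3)] unfolding \<mu>_def by simp
  have lower': "int (card I) \<le> \<mu> F"
    if "indep_in (minor_space K C S) I" "I \<subseteq> S" "F \<subseteq> V" "\<phi> ` I \<subseteq> F" for I F
  proof -
    have "card (\<phi> ` I) = card I"
      using card_image[OF inj_on_subset[OF \<phi>(1)]] that(2) CS(2) by blast
    then show ?thesis using lower[OF that(1-3)] that(4) by (simp add: Int_absorb2)
  qed
  have indI: "indep_in (minor_space K C S) I"
    if "\<And>Z. Z \<subseteq> I \<Longrightarrow> k4_pred (a \<in> Z) (b \<in> Z) (c \<in> Z) (d \<in> Z) (e \<in> Z) (f \<in> Z) \<Longrightarrow>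
      a \<notin> Z \<and> b \<notin> Z \<and> c \<notin> Z \<and> d \<notin> Z \<and> e \<notin> Z \<and> f \<notin> Z" for I
    unfolding indep_in_def M
  proof (intro ballI impI)
    fix Z assume "Z \<in> {Z. Z \<subseteq> S \<and> k4_pred (a \<in> Z) (b \<in> Z) (c \<in> Z) (d \<in> Z) (e \<in> Z) (f \<in> Z)}" "Z \<subseteq> I"
    then show "Z = {}" using that[of Z] S by auto
  qed
  \<comment> \<open>The union of any two triangles contains one of these four triples.\<close>
  have triples: "indep_in (minor_space K C S) {a, b, c}" "indep_in (minor_space K C S) {a, b, e}"
    "indep_in (minor_space K C S) {a, c, d}" "indep_in (minor_space K C S) {b, c, d}"
    by (rule indI; use D in \<open>auto simp: k4_pred_def\<close>)+
  have pairs: "indep_in (minor_space K C S) {x, y}" for x y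
  proof (rule indI)
    fix Z assume Z: "Z \<subseteq> {x, y}" and P: "k4_pred (a \<in> Z) (b \<in> Z) (c \<in> Z) (d \<in> Z) (e \<in> Z) (f \<in> Z)"
    have no3: "\<not> (p \<in> Z \<and> q \<in> Z \<and> r \<in> Z)" if "distinct [p, q, r]" for p q r using Z that by auto
    have "\<not> (a \<in> Z \<and> b \<in> Z \<and> d \<in> Z)" "\<not> (a \<in> Z \<and> c \<in> Z \<and> e \<in> Z)" "\<not> (b \<in> Z \<and> c \<in> Z \<and> f \<in> Z)"
      "\<not> (d \<in> Z \<and> e \<in> Z \<and> f \<in> Z)" "\<not> (b \<in> Z \<and> c \<in> Z \<and> d \<in> Z)" "\<not> (a \<in> Z \<and> c \<in> Z \<and> d \<in> Z)"
      "\<not> (a \<in> Z \<and> b \<in> Z \<and> e \<in> Z)"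
      by (rule no3, use D in simp)+
    then show "a \<notin> Z \<and> b \<notin> Z \<and> c \<notin> Z \<and> d \<notin> Z \<and> e \<notin> Z \<and> f \<notin> Z" using P unfolding k4_pred_def by argo
  qed
  have depI: "\<not> indep_in (minor_space K C S) Z"
    if "Z \<subseteq> S" "k4_pred (a \<in> Z) (b \<in> Z) (c \<in> Z) (d \<in> Z) (e \<in> Z) (f \<in> Z)" "Z \<noteq> {}" for Z
    using that unfolding indep_in_def M by blast
  have dep: "\<not> indep_in (minor_space K C S) {a, b, d}" "\<not> indep_in (minor_space K C S) {a, c, e}"
    "\<not> indep_in (minor_space K C S) {b, c, f}" "\<not> indep_in (minor_space K C S) {d, e, f}"
    by (rule depI; use D S in \<open>auto simp: k4_pred_def\<close>)+
  \<comment> \<open>The set \<open>F\<close> that witnesses the dependence must contain all three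
    images: if one were outside, the other two would already violate the bound, although pairs are
    independent.\<close>
  have tight: "\<exists>F\<subseteq>V. {\<phi> x, \<phi> y, \<phi> z} \<subseteq> F \<and> \<mu> F \<le> 2"
    if xyz: "x \<in> S" "y \<in> S" "z \<in> S" "distinct [x, y, z]" and dep: "\<not> indep_in (minor_space K C S) {x, y, z}" for x y z
  proof -
    have sub: "{x, y, z} \<subseteq> S" using xyz by simp
    obtain F where F: "F \<subseteq> V" "card F < card ((\<phi> ` {x, y, z} \<union> \<phi> ` J) \<inter> F) + card (enclosed V A T F)"
      using not_matchable_imp_card_less[OF V(1,2), of T "\<phi> ` {x, y, z} \<union> \<phi> ` J"] dep ind[OF sub] by blast
    then have lt: "\<mu> F < int (card (\<phi> ` {x, y, z} \<inter> F))"
      unfolding \<mu>_def card_split[OF sub F(1)] by simp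
    have in_F: "\<phi> v \<in> F" if v: "{x, y, z} = {u, v, w}" for u v w
    proof (rule ccontr)
      assume "\<phi> v \<notin> F"
      then have "\<phi> ` {x, y, z} \<inter> F = \<phi> ` {u, w} \<inter> F" unfolding v by auto
      moreover have "int (card (\<phi> ` {u, w} \<inter> F)) \<le> \<mu> F"
        using v sub by (intro lower[OF pairs _ F(1)]) simp
      ultimately show False using lt by simp
    qed
    have "\<phi> x \<in> F" "\<phi> y \<in> F" "\<phi> z \<in> F" 
      using in_F[of y x z] in_F[of x y z] in_F[of x z y] by (auto simp: insert_commute)
    moreover have "card (\<phi> ` {x, y, z} \<inter> F) \<le> 3"
    proof -
      have "card (\<phi> ` {x, y, z} \<inter> F) \<le> card (\<phi> ` {x, y, z})" by (intro card_mono) auto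
      also have "\<dots> \<le> card {x, y, z}" by (rule card_image_le) simp
      also have "\<dots> = 3" using xyz(4) by simp
      finally show ?thesis .
    qed
    ultimately show ?thesis using F(1) lt by (intro exI[of _ F]) simp
  qed
  have inS: "a \<in> S" "b \<in> S" "c \<in> S" "d \<in> S" "e \<in> S" "f \<in> S" by (simp_all add: S)
  obtain F1 where F1: "F1 \<subseteq> V" "\<phi> a \<in> F1" "\<phi> b \<in> F1" "\<phi> d \<in> F1" "\<mu> F1 \<le> 2"
    using tight[OF inS(1,2,4) _ dep(1)] D by auto
  obtain F2 where F2: "F2 \<subseteq> V" "\<phi> a \<in> F2" "\<phi> c \<in> F2" "\<phi> e \<in> F2" "\<mu> F2 \<le> 2"
    using tight[OF inS(1,3,5) _ dep(2)] D by auto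
  obtain F3 where F3: "F3 \<subseteq> V" "\<phi> b \<in> F3" "\<phi> c \<in> F3" "\<phi> f \<in> F3" "\<mu> F3 \<le> 2"
    using tight[OF inS(2,3,6) _ dep(3)] D by auto
  obtain F4 where F4: "F4 \<subseteq> V" "\<phi> d \<in> F4" "\<phi> e \<in> F4" "\<phi> f \<in> F4" "\<mu> F4 \<le> 2"
    using tight[OF inS(4,5,6) _ dep(4)] D by auto
  \<comment> \<open>The two plain cardinalities are modular. The subtracted term is exact on
    intersections and at least additive on unions, which gives the direction.\<close>
  have submod: "\<mu> (F \<inter> F') + \<mu> (F \<union> F') \<le> \<mu> F + \<mu> F'" if "F \<subseteq> V" "F' \<subseteq> V" for F F'
  proof -
    have "card (enclosed V A T F \<union> enclosed V A T F') \<le> card (enclosed V A T (F \<union> F'))"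
      by (intro card_mono fine Un_least enclosed_mono) auto
    moreover have "(\<phi> ` J \<inter> F) \<inter> (\<phi> ` J \<inter> F') = \<phi> ` J \<inter> (F \<inter> F')" by auto
    ultimately show ?thesis
      using card_Un_int[OF fin[OF that(1)] fin[OF that(2)]] card_Un_int[OF fine[of F] fine[of F']]
        card_Un_int[of "\<phi> ` J \<inter> F" "\<phi> ` J \<inter> F'"] fin[OF that(1)] fin[OF that(2)]
      unfolding \<mu>_def enclosed_Int Int_Un_distrib by simp
  qed
  have nonneg: "0 \<le> \<mu> F" if "F \<subseteq> V" for F
    using lower'[of "{}" F] that by (auto simp: indep_in_def)
  have one: "1 \<le> \<mu> F" if "F \<subseteq> V" "x \<in> S" "\<phi> x \<in> F" for F x
    using lower'[of "{x}" F] pairs[of x x] that by simp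
  have two: "2 \<le> \<mu> F" if "F \<subseteq> V" "x \<in> S" "y \<in> S" "x \<noteq> y" "\<phi> x \<in> F" "\<phi> y \<in> F" for F x y
    using lower'[of "{x, y}" F] pairs[of x y] that by simp
  have three: "3 \<le> \<mu> F" if "F \<subseteq> V" "indep_in (minor_space K C S) {x, y, z}" "{x, y, z} \<subseteq> S" "distinct [x, y, z]"
     "\<phi> x \<in> F" "\<phi> y \<in> F" "\<phi> z \<in> F" for F x y z
    using lower'[of "{x, y, z}" F] that by simp
  \<comment> \<open>Two triangles of K4 together span the whole rank three.\<close>
  have u: "3 \<le> \<mu> (F1 \<union> F2)" "3 \<le> \<mu> (F1 \<union> F3)" "3 \<le> \<mu> (F1 \<union> F4)" "3 \<le> \<mu> (F2 \<union> F3)"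
    "3 \<le> \<mu> (F2 \<union> F4)" "3 \<le> \<mu> (F3 \<union> F4)" "3 \<le> \<mu> (F1 \<union> F2 \<union> F3 \<union> F4)"
    by (rule three[OF _ triples(1)] three[OF _ triples(2)] three[OF _ triples(3)] three[OF _ triples(4)],
      use F1 F2 F3 F4 D inS in auto)+
  have i2: "\<mu> (F1 \<inter> F2) \<le> 1" "\<mu> (F1 \<inter> F3) \<le> 1" "\<mu> (F1 \<inter> F4) \<le> 1" "\<mu> (F2 \<inter> F3) \<le> 1"
    "\<mu> (F2 \<inter> F4) \<le> 1"
    using u submod[OF F1(1) F2(1)] submod[OF F1(1) F3(1)] submod[OF F1(1) F4(1)] submod[OF F2(1) F3(1)]
      submod[OF F2(1) F4(1)] F1(5) F2(5) F3(5) F4(5) by simp_all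
  have l2: "1 \<le> \<mu> (F1 \<inter> F2)" "1 \<le> \<mu> (F1 \<inter> F3)" "1 \<le> \<mu> (F1 \<inter> F4)" "1 \<le> \<mu> (F2 \<inter> F3)"
    "1 \<le> \<mu> (F2 \<inter> F4)" "1 \<le> \<mu> (F3 \<inter> F4)"
    using F1 F2 F3 F4 inS
    by (auto intro: one[of _ a] one[of _ b] one[of _ d] one[of _ c] one[of _ e] one[of _ f])
  \<comment> \<open>\<open>G\<close> and \<open>H\<close> behave like two points: a union holding
    two distinct elements has value at least two, which leaves nothing for the intersection.\<close>
  have triple: "\<mu> (G \<inter> H) \<le> 0"
    if "G \<subseteq> V" "H \<subseteq> V" "\<mu> G \<le> 1" "\<mu> H \<le> 1" "x \<in> S" "y \<in> S" "x \<noteq> y" "\<phi> x \<in> G" "\<phi> y \<in> H" for G H x y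
    using submod[OF that(1,2)] two[of "G \<union> H" x y] that by simp
  have e: "(F1 \<inter> F2) \<inter> (F1 \<inter> F3) = F1 \<inter> F2 \<inter> F3" "(F1 \<inter> F2) \<inter> (F1 \<inter> F4) = F1 \<inter> F2 \<inter> F4"
    "(F1 \<inter> F3) \<inter> (F1 \<inter> F4) = F1 \<inter> F3 \<inter> F4" "(F2 \<inter> F3) \<inter> (F2 \<inter> F4) = F2 \<inter> F3 \<inter> F4" by auto
  have i3: "\<mu> (F1 \<inter> F2 \<inter> F3) \<le> 0" "\<mu> (F1 \<inter> F2 \<inter> F4) \<le> 0" "\<mu> (F1 \<inter> F3 \<inter> F4) \<le> 0" "\<mu> (F2 \<inter> F3 \<inter> F4) \<le> 0"
    using triple[of "F1 \<inter> F2" "F1 \<inter> F3" a b] triple[of "F1 \<inter> F2" "F1 \<inter> F4" a d]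
      triple[of "F1 \<inter> F3" "F1 \<inter> F4" b d] triple[of "F2 \<inter> F3" "F2 \<inter> F4" c e] F1 F2 F3 F4 D inS i2
    unfolding e by auto
  have i4: "0 \<le> \<mu> (F1 \<inter> F2 \<inter> F3 \<inter> F4)" using F1(1) by (intro nonneg) auto
  \<comment> \<open>This inclusion is the only source of inequality: the other two terms of
    \<open>\<mu>\<close>, and \<open>enclosed\<close> on intersections, obey inclusion-exclusion
    with equality.\<close>
  have "card (enclosed V A T F1 \<union> enclosed V A T F2 \<union> enclosed V A T F3 \<union> enclosed V A T F4)
    \<le> card (enclosed V A T (F1 \<union> F2 \<union> F3 \<union> F4))"
    by (intro card_mono fine Un_least enclosed_mono) auto
  moreover have "\<phi> ` J \<inter> (F1 \<union> F2 \<union> F3 \<union> F4) = (\<phi> ` J \<inter> F1) \<union> (\<phi> ` J \<inter> F2) \<union> (\<phi> ` J \<inter> F3) \<union> (\<phi> ` J \<inter> F4)"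
    by auto
  moreover have "(\<phi> ` J \<inter> G) \<inter> (\<phi> ` J \<inter> H) = \<phi> ` J \<inter> (G \<inter> H)" for G H by auto
  ultimately have "\<mu> (F1 \<union> F2 \<union> F3 \<union> F4) \<le> \<mu> F1 + \<mu> F2 + \<mu> F3 + \<mu> F4
    - \<mu> (F1 \<inter> F2) - \<mu> (F1 \<inter> F3) - \<mu> (F1 \<inter> F4) - \<mu> (F2 \<inter> F3) - \<mu> (F2 \<inter> F4) - \<mu> (F3 \<inter> F4)
    + \<mu> (F1 \<inter> F2 \<inter> F3) + \<mu> (F1 \<inter> F2 \<inter> F4) + \<mu> (F1 \<inter> F3 \<inter> F4) + \<mu> (F2 \<inter> F3 \<inter> F4)
    - \<mu> (F1 \<inter> F2 \<inter> F3 \<inter> F4)"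
    using card_Un4_int[OF fin[OF F1(1)] fin[OF F2(1)] fin[OF F3(1)] fin[OF F4(1)]]
      card_Un4_int[OF fine[of F1] fine[of F2] fine[of F3] fine[of F4]]
      card_Un4_int[of "\<phi> ` J \<inter> F1" "\<phi> ` J \<inter> F2" "\<phi> ` J \<inter> F3" "\<phi> ` J \<inter> F4"]
      fin[OF F1(1)] fin[OF F2(1)] fin[OF F3(1)] fin[OF F4(1)]
    unfolding \<mu>_def enclosed_Int by simp
  then show False using u(7) F1(5) F2(5) F3(5) F4(5) l2 i3 i4 by linarith
qed

section \<open>The characterization\<close>

text \<open>The double complement is immediate for a kernel: the supports of the rows lie in
  \<open>L\<close>, and being orthogonal to them is membership in the kernel.\<close>

lemma ex_dual_pair_mat_space:
  assumes E: "finite E"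
  shows "\<exists>L. dual_pair E (mat_space E m A) L"
proof -
  let ?K = "mat_space E m A"
  define L where "L = {Y. Y \<subseteq> E \<and> (\<forall>Z\<in>?K. even (card (Z \<inter> Y)))}"
  define R where "R i = {e \<in> E. A i e = 1}" for i
  have sum: "(\<Sum>e\<in>Z. A i e) = 0 \<longleftrightarrow> even (card (Z \<inter> R i))" if "Z \<subseteq> E" for Z i
  proof -
    have "(\<Sum>e\<in>Z. A i e) = (\<Sum>e\<in>Z. if e \<in> R i then 1 else 0)"
      using that by (intro sum.cong) (auto simp: R_def)
    then show ?thesis using sum_bit_indicator[OF finite_subset[OF that E]] by simp
  qed
  have rows: "R i \<in> L" if "i < m" for i
    using sum that by (auto simp: L_def R_def mat_space_def)
  have "Z \<in> ?K" if Z: "Z \<subseteq> E" "\<forall>Y\<in>L. even (card (Z \<inter> Y))" for Z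
    using Z rows sum[OF Z(1)] by (simp add: mat_space_def)
  moreover have "?K \<subseteq> Pow E" by (auto simp: mat_space_def)
  ultimately have "dual_pair E ?K L"
    unfolding dual_pair_def using E by (simp add: L_def) blast
  then show ?thesis ..
qed

lemma binary_gammoid_vector_matroid_iff:
  assumes E: "finite E"
  shows "binary_gammoid (vector_matroid E m A) \<longleftrightarrow> \<not> has_k4 E (mat_space E m A)"
proof -
  let ?K = "mat_space E m A" and ?M = "vector_matroid E m A"
  have K: "bspace E ?K" by (rule bspace_mat_space[OF E])
  have M: "?M = space_matroid E ?K" by (rule vector_matroid_eq_space_matroid[OF E])
  have "represented_by ?M m A" unfolding represented_by_def by (simp add: vector_matroid_def)
  then have "binary ?M" unfolding binary_def using matroid_space_matroid[OF K] M by auto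
  moreover have "gammoid ?M \<longleftrightarrow> link_rep E ?K" unfolding M by (rule gammoid_space_matroid_iff[OF K])
  moreover obtain L where "dual_pair E ?K L" using ex_dual_pair_mat_space[OF E] by blast
  ultimately show ?thesis
    unfolding binary_gammoid_def
    using link_rep_imp_no_k4[OF K] link_rep_if_no_k4 by blast
qed

theorem theorem1p6:
  fixes B :: "'a matroid"
  assumes "graphic B"
  shows "B \<in> GG 3 \<longleftrightarrow>
    (\<exists>N. minor N B \<and> (\<exists>G\<in>{G3, G4, G5, G6}. isomorphic N (cycle_matroid G)))"
proof -
  obtain m A where fin: "finite (ground B)" and rep: "represented_by B m A"
    and B: "B = space_matroid (ground B) (mat_space (ground B) m A)"
    using graphic_eq_mat_space[OF assms] .
  define E where "E = ground B"
  define K where "K = mat_space E m A"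
  have finE: "finite E" and K: "bspace E K" and BK: "B = space_matroid E K"
    using fin bspace_mat_space B by (auto simp: E_def K_def)
  have split: "binary_gammoid (splitting B X) \<longleftrightarrow> \<not> has_k4 E (even_on X K)" for X
    using splitting_eq[OF fin rep] binary_gammoid_vector_matroid_iff[OF finE]
      mat_space_append_row[OF finE] by (simp add: E_def K_def)
  have "B \<in> GG 3 \<longleftrightarrow> (\<exists>X\<subseteq>E. card X = 3 \<and> has_k4 E (even_on X K))"
    unfolding GG_def using assms by (simp add: split E_def)
  also have "\<dots> \<longleftrightarrow> (\<exists>C S. C \<subseteq> E \<and> S \<subseteq> E \<and> C \<inter> S = {} \<and> (\<exists>P\<in>{k4_pred, g4_pred, g6_pred}. six_form P S (minor_space K C S)))"
  proof
    assume "\<exists>X\<subseteq>E. card X = 3 \<and> has_k4 E (even_on X K)"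
    then obtain X C S where "C \<subseteq> E" "S \<subseteq> E" "C \<inter> S = {}" "six_form k4_pred S (minor_space (even_on X K) C S)"
      unfolding has_k4_def by (elim exE conjE) (rule that)
    then show "\<exists>C S. C \<subseteq> E \<and> S \<subseteq> E \<and> C \<inter> S = {} \<and> (\<exists>P\<in>{k4_pred, g4_pred, g6_pred}. six_form P S (minor_space K C S))"
      using six_form_of_splitting[OF K, of S X C] by blast
  next
    assume "\<exists>C S. C \<subseteq> E \<and> S \<subseteq> E \<and> C \<inter> S = {} \<and> (\<exists>P\<in>{k4_pred, g4_pred, g6_pred}. six_form P S (minor_space K C S))"
    then obtain C S P where CS: "C \<subseteq> E" "S \<subseteq> E" "C \<inter> S = {}"
      and P: "P \<in> {k4_pred, g4_pred, g6_pred}" "six_form P S (minor_space K C S)"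
      by (elim exE conjE bexE) (rule that)
    obtain X where X: "X \<subseteq> S" "card X = 3" "six_form k4_pred S (even_on X (minor_space K C S))"
      using six_form_even_on[OF P] by blast
    \<comment> \<open>\<open>X\<close> was found inside the ground set of the minor, so the parity
      condition on the minor lifts unchanged to \<open>K\<close>.\<close>
    have "X \<inter> C = {}" using X(1) CS(3) by auto
    then have "has_k4 E (even_on X K)"
      unfolding has_k4_def using CS X(3) minor_space_even_on[of X C K S]
      by (intro exI[of _ C] exI[of _ S]) simp
    then show "\<exists>X\<subseteq>E. card X = 3 \<and> has_k4 E (even_on X K)"
      using X(1,2) CS(2) by (intro exI[of _ X]) auto
  qed
  also have "\<dots> \<longleftrightarrow> (\<exists>C S. C \<subseteq> E \<and> S \<subseteq> E \<and> C \<inter> S = {} \<and>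
    (\<exists>G\<in>{G3, G4, G5, G6}. isomorphic (space_matroid S (minor_space K C S)) (cycle_matroid G)))"
  proof -
    have "(\<exists>P\<in>{k4_pred, g4_pred, g6_pred}. six_form P S (minor_space K C S)) \<longleftrightarrow>
      (\<exists>G\<in>{G3, G4, G5, G6}. isomorphic (space_matroid S (minor_space K C S)) (cycle_matroid G))"
      if "S \<subseteq> E" for C S
      using isomorphic_G[OF bspace_minor_space[OF K that]] by simp
    then show ?thesis by (simp cong: conj_cong)
  qed
  also have "\<dots> \<longleftrightarrow> (\<exists>N. minor N B \<and> (\<exists>G\<in>{G3, G4, G5, G6}. isomorphic N (cycle_matroid G)))"
    unfolding BK minor_space_matroid_iff[OF K] by blast
  finally show ?thesis .
qed

end
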